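(* Let $(U_1,U_2,A)$ be strip-admissible analytic data with values in $U(2)$ and $GL(2,\mathbb C)$, admitting a dominated splitting $E^s\oplus E^u$ by continuous invariant line subbundles, over a translation $\tau\in\mathrm{DC}(c,\nu)$ for some $c>0$, $\nu\ge1$. Let $L\in\{E^s,E^u\}$ with $c_1(L)\ne0$. Then $L$ carries no nonzero measurable eigensection: for every $\lambda\in\mathbb C$, every measurable section $F$ of $V$ carried by the line field of $L$ with $A(w)F(w)=\lambda F(w+\tau)$ for a.e. $w$ vanishes a.e.
   Context: Notation. $\mathbb T^2=\mathbb R^2/\mathbb Z^2$, $w=(w_1,w_2)$, Haar probability measure; $e_1=(1,0)$, $e_2=(0,1)$; $\tau=(\alpha,\beta)\in\mathbb R^2$, $Sw=w+\tau$. Sewing system and cocycle. A continuous unitary sewing system is a pair of continuous $U_1,U_2\colon\mathbb R^2\to U(2)$ with (K1) $U_1(w+e_2)U_2(w)=U_2(w+e_1)U_1(w)$; it presents the rank-two Hermitian bundle $V\to\mathbb T^2$ given as the quotient of $\mathbb R^2\times\mathbb C^2$ by the action generated by $(w,\xi)\mapsto(w+e_j,U_j(w)\xi)$. Measurable sections of $V$ are measurable $F\colon\mathbb R^2\to\mathbb C^2$ with $F(w+e_j)=U_j(w)F(w)$ a.e. A continuous equivariant cocycle is a continuous $A\colon\mathbb R^2\to GL(2,\mathbb C)$ with (K2) $A(w+e_j)U_j(w)=U_j(Sw)A(w)$, $j=1,2$. Invariant line. A continuous map $\ell\colon\mathbb R^2\to\mathbb{CP}^1$ (lines in $\mathbb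 C^2$) with $\ell(w+e_j)=U_j(w)\ell(w)$ and $A(w)\ell(w)=\ell(Sw)$ for all $w$; it induces a line subbundle $L\subset V$ over $\mathbb T^2$, and $\ell$ is called the line field of $L$. A measurable section $F$ is carried by $\ell$ if $F(w)\in\ell(w)$ a.e. Strip-admissible. For $\delta>0$ let $\Omega_\delta=\{w\in\mathbb C^2:|\operatorname{Im}w_1|\le\delta,|\operatorname{Im}w_2|\le\delta\}$. $(U_1,U_2,A)$ is strip-admissible if for some $\delta_0>0$ the maps $U_1,U_2,A$ extend to matrix functions holomorphic on an open neighborhood of $\Omega_{\delta_0}$ and bounded on $\Omega_{\delta_0}$, with $U_j(w)$ unitary and $\det A(w)\ne0$ for real $w$, and (K1), (K2) holding on $\mathbb R^2$. Dominated splitting. A pair of invariant lines $\ell_s,\ell_u$ with $\ell_s(w)\ne\ell_u(w)$ for all $w$, inducing subbundles $E^s,E^u$ with $V=E^s\oplus E^u$, such that for some integer $N\ge1$ and some $0<\kappa_0<1$, $$D_N(z)=\frac{\|A^{(N)}(z)|_{\ell_s(z)}\|}{\mathfrak m(A^{(N)}(z)|_{\ell_u(z)})}\le\kappa_0^2\quad\text{for all }z\in\mathbb R^2,$$ where $A^{(N)}(w)=A(S^{N-1}w)\cdots A(w)$ and $\mathfrak m(M)=\min_{|v|=1}|Mv|$. Diophantine condition. $\tau\in\mathrm{DC}(c,\nu)$, $c>0,\nu\ge1$, means $\|\nu_1'\alpha+\nu_2'\beta\|_{\mathbb R/\mathbb Z}\ge c\,(|\nu_1'|+|\nu_2'|)^{-\nu}$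 for all $(\nu_1',\nu_2')\in\mathbb Z^2\setminus\{0\}$, where $\|x\|_{\mathbb R/\mathbb Z}$ is the distance from $x$ to the nearest integer. *)

theory Defs
  imports "HOL-Analysis.Analysis"
begin

abbreviation e1 :: "real^2" where "e1 \<equiv> axis 1 1"
abbreviation e2 :: "real^2" where "e2 \<equiv> axis 2 1"

definition shift :: "real^2 \<Rightarrow> real^2 \<Rightarrow> real^2" where
  "shift \<tau> w = w + \<tau>"

definition adjoint_mat :: "complex^2^2 \<Rightarrow> complex^2^2" where
  "adjoint_mat M = (\<chi> i j. cnj (M $ j $ i))"

definition unitary_mat :: "complex^2^2 \<Rightarrow> bool" where
  "unitary_mat M \<longleftrightarrow> adjoint_mat M ** M = mat 1 \<and> M ** adjoint_mat M = mat 1"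

definition sewing_system :: "(real^2 \<Rightarrow> complex^2^2) \<Rightarrow> (real^2 \<Rightarrow> complex^2^2) \<Rightarrow> bool" where
  "sewing_system U1 U2 \<longleftrightarrow>
     continuous_on UNIV U1 \<and> continuous_on UNIV U2 \<and>
     (\<forall>w. unitary_mat (U1 w)) \<and> (\<forall>w. unitary_mat (U2 w)) \<and>
     (\<forall>w. U1 (w + e2) ** U2 w = U2 (w + e1) ** U1 w)"

definition equivariant_cocycle ::
  "(real^2 \<Rightarrow> complex^2^2) \<Rightarrow> (real^2 \<Rightarrow> complex^2^2) \<Rightarrow> real^2 \<Rightarrow> (real^2 \<Rightarrow> complex^2^2) \<Rightarrow> bool" where
  "equivariant_cocycle U1 U2 \<tau> A \<longleftrightarrow>
     continuous_on UNIV A \<and> (\<forall>w. det (A w) \<noteq> 0) \<and>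
     (\<forall>w. A (w + e1) ** U1 w = U1 (shift \<tau> w) ** A w) \<and>
     (\<forall>w. A (w + e2) ** U2 w = U2 (shift \<tau> w) ** A w)"

text \<open>Sections of the bundle over the torus are quasi-periodic functions on the plane. Measurability
  is with respect to the Lebesgue (completed) sigma-algebra.\<close>

definition measurable_section ::
  "(real^2 \<Rightarrow> complex^2^2) \<Rightarrow> (real^2 \<Rightarrow> complex^2^2) \<Rightarrow> (real^2 \<Rightarrow> complex^2) \<Rightarrow> bool" where
  "measurable_section U1 U2 F \<longleftrightarrow>
     F \<in> borel_measurable lebesgue \<and>
     (AE w in lebesgue. F (w + e1) = U1 w *v F w) \<and>
     (AE w in lebesgue. F (w + e2) = U2 w *v F w)"

text \<open>Holomorphy in several variables on an open set: Frechet differentiability with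
  complex-linear derivative.\<close>

definition holomorphic2_on :: "(complex^2 \<Rightarrow> complex) \<Rightarrow> (complex^2) set \<Rightarrow> bool" where
  "holomorphic2_on f X \<longleftrightarrow>
     (\<forall>z\<in>X. \<exists>D. (f has_derivative D) (at z) \<and> (\<forall>c v. D (c *s v) = c * D v))"

definition strip :: "real \<Rightarrow> (complex^2) set" where
  "strip \<delta> = {z. \<bar>Im (z $ 1)\<bar> \<le> \<delta> \<and> \<bar>Im (z $ 2)\<bar> \<le> \<delta>}"

definition complexify :: "real^2 \<Rightarrow> complex^2" where
  "complexify w = (\<chi> i. complex_of_real (w $ i))"

definition extends_to_strip :: "real \<Rightarrow> (real^2 \<Rightarrow> complex^2^2) \<Rightarrow> bool" where
  "extends_to_strip \<delta> M \<longleftrightarrow>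
     (\<exists>E X. open X \<and> strip \<delta> \<subseteq> X \<and>
        (\<forall>i j. holomorphic2_on (\<lambda>z. E z $ i $ j) X) \<and>
        bounded (E ` strip \<delta>) \<and>
        (\<forall>w. E (complexify w) = M w))"

definition strip_admissible ::
  "(real^2 \<Rightarrow> complex^2^2) \<Rightarrow> (real^2 \<Rightarrow> complex^2^2) \<Rightarrow> real^2 \<Rightarrow> (real^2 \<Rightarrow> complex^2^2) \<Rightarrow> bool" where
  "strip_admissible U1 U2 \<tau> A \<longleftrightarrow>
     sewing_system U1 U2 \<and> equivariant_cocycle U1 U2 \<tau> A \<and>
     (\<exists>\<delta>0>0. extends_to_strip \<delta>0 U1 \<and> extends_to_strip \<delta>0 U2 \<and> extends_to_strip \<delta>0 A)"

definition complex_lines :: "(complex^2) set set" where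
  "complex_lines = {l. vec.subspace l \<and> vec.dim l = 1}"

text \<open>The quotient topology induced by \<open>v \<mapsto> vec.span {v}\<close> on the nonzero vectors.\<close>

definition CP1_topology :: "(complex^2) set topology" where
  "CP1_topology = topology (\<lambda>W. W \<subseteq> complex_lines \<and> open {v. v \<noteq> 0 \<and> vec.span {v} \<in> W})"

lemma openin_CP1_topology:
  "openin CP1_topology W \<longleftrightarrow> W \<subseteq> complex_lines \<and> open {v. v \<noteq> 0 \<and> vec.span {v} \<in> W}"
proof -
  have "istopology (\<lambda>W. W \<subseteq> complex_lines \<and> open {v. v \<noteq> 0 \<and> vec.span {v} \<in> W})"
    unfolding istopology_def
  proof (intro conjI allI impI, goal_cases)
    case (1 S T)
    then show ?case by blast
  next
    case (2 S T)
    have "{v. v \<noteq> 0 \<and> vec.span {v} \<in> S \<inter> T} =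
      {v. v \<noteq> 0 \<and> vec.span {v} \<in> S} \<inter> {v. v \<noteq> 0 \<and> vec.span {v} \<in> T}" by blast
    with 2 show ?case by (simp add: open_Int)
  next
    case (3 K)
    then show ?case by blast
  next
    case (4 K)
    have "{v. v \<noteq> 0 \<and> vec.span {v} \<in> \<Union>K} = (\<Union>S\<in>K. {v. v \<noteq> 0 \<and> vec.span {v} \<in> S})" by blast
    with 4 show ?case by auto
  qed
  then show ?thesis by (simp add: CP1_topology_def topology_inverse')
qed

lemma topspace_CP1_topology: "topspace CP1_topology = complex_lines"
proof -
  have "vec.span {v} \<in> complex_lines" if "v \<noteq> 0" for v :: "complex^2"
    using that by (simp add: complex_lines_def vec.dim_span vec.dim_eq_card_independent)
  then have "{v. v \<noteq> 0 \<and> vec.span {v} \<in> complex_lines} = - {0}" by auto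
  then have "openin CP1_topology complex_lines" by (simp add: openin_CP1_topology open_Compl)
  then show ?thesis
    by (metis openin_CP1_topology openin_subset openin_topspace subset_antisym)
qed

definition invariant_line ::
  "(real^2 \<Rightarrow> complex^2^2) \<Rightarrow> (real^2 \<Rightarrow> complex^2^2) \<Rightarrow> real^2 \<Rightarrow> (real^2 \<Rightarrow> complex^2^2) \<Rightarrow>
     (real^2 \<Rightarrow> (complex^2) set) \<Rightarrow> bool" where
  "invariant_line U1 U2 \<tau> A l \<longleftrightarrow>
     continuous_map euclidean CP1_topology l \<and>
     (\<forall>w. l (w + e1) = (\<lambda>v. U1 w *v v) ` l w) \<and>
     (\<forall>w. l (w + e2) = (\<lambda>v. U2 w *v v) ` l w) \<and>
     (\<forall>w. (\<lambda>v. A w *v v) ` l w = l (shift \<tau> w))"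

definition carried_by :: "(real^2 \<Rightarrow> (complex^2) set) \<Rightarrow> (real^2 \<Rightarrow> complex^2) \<Rightarrow> bool" where
  "carried_by l F \<longleftrightarrow> (AE w in lebesgue. F w \<in> l w)"

text \<open>
  The pullback to the plane of the line bundle \<open>L\<close> with line field \<open>l\<close> has a continuous nowhere
  vanishing section \<open>s\<close>. In this frame \<open>L\<close> is presented by the factors of automorphy
  \<open>g\<^sub>j = exp (2 \<pi> i \<phi>\<^sub>j)\<close>, where \<open>U\<^sub>j w *v s w = g\<^sub>j w *s s (w + e\<^sub>j)\<close>: sections \<open>h *s s\<close> of \<open>L\<close> are given by
  functions \<open>h\<close> with \<open>h (w + e\<^sub>j) = g\<^sub>j w * h w\<close>. The Chern class is the image of this multiplier under the
  connecting homomorphism of the exponential sequence; paired with the fundamental class of the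
  torus, it is the integer below, which does not depend on \<open>w\<close>, \<open>s\<close> or the logarithms. The sign is
  the usual one: the number counts, with multiplicity, the zeros of a section \<open>h\<close> when
  \<open>(e\<^sub>1, e\<^sub>2)\<close> is positively oriented.
\<close>

definition chern_number ::
  "(real^2 \<Rightarrow> complex^2^2) \<Rightarrow> (real^2 \<Rightarrow> complex^2^2) \<Rightarrow> (real^2 \<Rightarrow> (complex^2) set) \<Rightarrow> int" where
  "chern_number U1 U2 l = (THE n. \<exists>(s :: real^2 \<Rightarrow> complex^2) (\<phi>1 :: real^2 \<Rightarrow> complex) (\<phi>2 :: real^2 \<Rightarrow> complex).
     continuous_on UNIV s \<and> continuous_on UNIV \<phi>1 \<and> continuous_on UNIV \<phi>2 \<and>
     (\<forall>w. s w \<in> l w \<and> s w \<noteq> 0) \<and>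
     (\<forall>w. U1 w *v s w = exp (2 * complex_of_real pi * \<i> * \<phi>1 w) *s s (w + e1)) \<and>
     (\<forall>w. U2 w *v s w = exp (2 * complex_of_real pi * \<i> * \<phi>2 w) *s s (w + e2)) \<and>
     (\<forall>w. of_int n = \<phi>1 (w + e2) + \<phi>2 w - \<phi>2 (w + e1) - \<phi>1 w))"

primrec cocycle_iter :: "real^2 \<Rightarrow> (real^2 \<Rightarrow> complex^2^2) \<Rightarrow> nat \<Rightarrow> real^2 \<Rightarrow> complex^2^2" where
  "cocycle_iter \<tau> A 0 w = mat 1"
| "cocycle_iter \<tau> A (Suc n) w = A ((shift \<tau> ^^ n) w) ** cocycle_iter \<tau> A n w"

definition norm_restricted :: "complex^2^2 \<Rightarrow> (complex^2) set \<Rightarrow> real" where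
  "norm_restricted M l = (SUP v\<in>{v\<in>l. norm v = 1}. norm (M *v v))"

text \<open>On a line the infimum below is attained.\<close>

definition conorm_restricted :: "complex^2^2 \<Rightarrow> (complex^2) set \<Rightarrow> real" where
  "conorm_restricted M l = (INF v\<in>{v\<in>l. norm v = 1}. norm (M *v v))"

definition dominated_splitting ::
  "(real^2 \<Rightarrow> complex^2^2) \<Rightarrow> (real^2 \<Rightarrow> complex^2^2) \<Rightarrow> real^2 \<Rightarrow> (real^2 \<Rightarrow> complex^2^2) \<Rightarrow>
     (real^2 \<Rightarrow> (complex^2) set) \<Rightarrow> (real^2 \<Rightarrow> (complex^2) set) \<Rightarrow> bool" where
  "dominated_splitting U1 U2 \<tau> A ls lu \<longleftrightarrow>
     invariant_line U1 U2 \<tau> A ls \<and> invariant_line U1 U2 \<tau> A lu \<and>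
     (\<forall>w. ls w \<noteq> lu w) \<and>
     (\<exists>N\<ge>1. \<exists>\<kappa>0. 0 < \<kappa>0 \<and> \<kappa>0 < 1 \<and>
        (\<forall>z. norm_restricted (cocycle_iter \<tau> A N z) (ls z)
               / conorm_restricted (cocycle_iter \<tau> A N z) (lu z) \<le> \<kappa>0\<^sup>2))"

definition dist_to_int :: "real \<Rightarrow> real" where
  "dist_to_int x = \<bar>x - of_int (round x)\<bar>"

definition DC :: "real \<Rightarrow> real \<Rightarrow> (real^2) set" where
  "DC c \<nu> = {\<tau>. \<forall>n1 n2 :: int. (n1, n2) \<noteq> (0, 0) \<longrightarrow>
      dist_to_int (of_int n1 * \<tau> $ 1 + of_int n2 * \<tau> $ 2) \<ge> c * of_int (\<bar>n1\<bar> + \<bar>n2\<bar>) powr (- \<nu>)}"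

end

theory Submission
  imports Defs "HOL-Complex_Analysis.Cauchy_Integral_Formula"
begin

text \<open>
  Let \<open>n\<close> be the Chern number of the line field \<open>l\<close>. Over the simply connected plane \<open>l\<close> has a frame \<open>s\<close>,
  and \<open>s\<close> can be chosen with \<open>U1 w *v s w = s (w + e1)\<close> and \<open>U2 w *v s w = exp (- 2 pi i n w1) *s s (w + e2)\<close>.
  Write \<open>A w *v s w = exp (2 pi i \<beta> w) *s s (w + \<tau>)\<close>. Compatibility of \<open>A\<close> with \<open>U1\<close> and \<open>U2\<close> makes \<open>\<beta>\<close>
  periodic up to constants, and its increment along \<open>e2\<close> is \<open>\<rho> = p2 - n \<tau>1\<close> for an integer \<open>p2\<close>
  (lemma \<open>invariant_line_normal_form\<close>). Since \<open>\<tau>\<close> is irrational, \<open>\<rho> = 0\<close> only if \<open>n = 0\<close>.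

  An eigensection is \<open>F = h s\<close> with a measurable scalar function \<open>h\<close>. Its zero set is invariant under the
  ergodic translation by \<open>\<tau>\<close>, so if \<open>F\<close> is not null then \<open>h\<close> vanishes almost nowhere, and the phase \<open>u\<close> of \<open>h\<close>
  satisfies \<open>u (w + \<tau>) = \<sigma> exp (2 pi i B w) u w\<close>, where \<open>B\<close> is the real part of \<open>\<beta>\<close> and \<open>\<sigma>\<close> is a constant.
  The contradiction is a count of winding numbers. Put \<open>t = \<epsilon> / m\<close> and compare \<open>u\<close> at \<open>w + t e2\<close> and \<open>w\<close>:
  the quotient \<open>v\<close> is periodic, and \<open>v (w + m \<tau>) / v w = exp (2 pi i D w)\<close>, where \<open>D\<close> is a sum of \<open>m\<close>
  differences of \<open>B\<close> over the distance \<open>t\<close>. If \<open>B\<close> is Lipschitz then \<open>D\<close> is bounded by a multiple of \<open>\<epsilon>\<close>,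
  uniformly in \<open>m\<close>, while its mean is exactly \<open>m t \<rho> = \<epsilon> \<rho>\<close>. Let \<open>\<theta>\<close> be the principal argument of \<open>v\<close>, in turns.
  The integer \<open>\<theta> (w + m \<tau>) - \<theta> w - D w\<close> has mean \<open>- \<epsilon> \<rho>\<close>; on the other hand it vanishes wherever \<open>\<theta>\<close> is
  small at both points. As \<open>m\<close> grows, \<open>t\<close> tends to \<open>0\<close>, and \<open>\<theta>\<close> tends to \<open>0\<close> in measure because translations act
  continuously on measurable functions. So the mean tends to \<open>0\<close> and \<open>\<rho> = 0\<close>
  (lemmas \<open>winding_bound\<close> and \<open>measurable_transfer_imp_no_drift\<close>).

  The argument rests on the Lipschitz continuity of \<open>\<beta>\<close>, that is, of the line field. It comes from domination over
  an isometry: the suitably normalized sine of the angle between the lines at two points is multiplied by a factor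
  below \<open>1\<close> by the iterated cocycle (for the dominated line, by its inverse), up to an error proportional to the
  distance of the two points, which does not change; a quantity with this property is itself bounded by a multiple
  of the distance
  (lemmas \<open>contraction_step_imp_Lipschitz\<close> and \<open>line_proj_Lipschitz\<close>). The strip enters through Cauchy's
  inequality, which makes \<open>A\<close> uniformly Lipschitz on the whole plane.
\<close>

section \<open>Vectors, matrices and lines in the complex plane\<close>

lemma norm_scaled_vec: "norm (c *s (x :: complex^'n)) = norm c * norm x"
  by (simp add: norm_vec_def norm_mult L2_set_right_distrib)

lemma norm_vec2_le: "norm (x :: 'a::real_normed_vector^2) \<le> norm (x $ 1) + norm (x $ 2)"
  using L2_set_le_sum [of UNIV "\<lambda>i. norm (x $ i)"] by (simp add: norm_vec_def sum_2)

lemma norm_mat2_vec_le: "norm ((M :: complex^2^2) *v x) \<le> 4 * norm M * norm x"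
proof -
  have entry: "norm (M $ i $ j * x $ j) \<le> norm M * norm x" for i j
    unfolding norm_mult
    using Finite_Cartesian_Product.norm_nth_le [of M i]
      Finite_Cartesian_Product.norm_nth_le [of "M $ i" j]
      Finite_Cartesian_Product.norm_nth_le [of x j]
    by (intro mult_mono) auto
  have "norm ((M *v x) $ i) \<le> 2 * norm M * norm x" for i
    using norm_triangle_ineq [of "M $ i $ 1 * x $ 1" "M $ i $ 2 * x $ 2"] entry [of i 1] entry [of i 2]
    by (simp add: matrix_vector_mult_def sum_2)
  from this [of 1] this [of 2] norm_vec2_le [of "M *v x"] show ?thesis by simp
qed

text \<open>
  The area form: for unit vectors its modulus is the sine of the angle between the spanned lines, so
  it vanishes exactly on equal lines and does not see the phases.
\<close>
definition wedge :: "complex^2 \<Rightarrow> complex^2 \<Rightarrow> complex" where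
  "wedge x y = x $ 1 * y $ 2 - x $ 2 * y $ 1"

lemma wedge_add_right: "wedge x (y + z) = wedge x y + wedge x z"
  by (simp add: wedge_def algebra_simps)

lemma wedge_scale: "wedge (a *s x) (b *s y) = a * b * wedge x y"
  by (simp add: wedge_def algebra_simps)

lemma wedge_matrix: "wedge (M *v x) (M *v y) = det M * wedge x y"
  by (simp add: wedge_def det_2 matrix_vector_mult_def sum_2 algebra_simps)

lemma norm_wedge_le: "norm (wedge x y) \<le> 2 * norm x * norm y"
proof -
  have "norm (x $ i * y $ j) \<le> norm x * norm y" for i j
    unfolding norm_mult by (intro mult_mono Finite_Cartesian_Product.norm_nth_le) auto
  from this [of 1 2] this [of 2 1] norm_triangle_ineq4 [of "x $ 1 * y $ 2" "x $ 2 * y $ 1"]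
  show ?thesis unfolding wedge_def by simp
qed

definition outer :: "complex^2 \<Rightarrow> complex^2 \<Rightarrow> complex^2^2" where
  "outer x y = (\<chi> i j. x $ i * cnj (y $ j))"

lemma norm_outer: "norm (outer x y) = norm x * norm y"
  by (simp add: outer_def norm_vec_def norm_mult L2_set_right_distrib [symmetric]
      L2_set_left_distrib [symmetric])

lemma outer_scale: "outer (c *s x) (d *s y) = (\<chi> i j. c * cnj d * outer x y $ i $ j)"
  by (simp add: outer_def vec_eq_iff)

lemma matrix_mult_outer: "M ** outer x y = outer (M *v x) y"
  by (simp add: outer_def vec_eq_iff matrix_matrix_mult_def matrix_vector_mult_def sum_2 algebra_simps)

lemma norm_eq_1_vec2:
  assumes "norm (x :: complex^2) = 1"
  shows "x $ 1 * cnj (x $ 1) + x $ 2 * cnj (x $ 2) = 1"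
proof -
  have "(norm x)\<^sup>2 = (norm (x $ 1))\<^sup>2 + (norm (x $ 2))\<^sup>2"
    by (simp add: norm_vec_def L2_set_def sum_2)
  then have "complex_of_real ((norm (x $ 1))\<^sup>2 + (norm (x $ 2))\<^sup>2) = 1" using assms by simp
  then show ?thesis by (simp add: complex_norm_square del: of_real_power)
qed

lemma outer_mult_unit:
  assumes "norm x = 1"
  shows "outer x x *v (c *s x) = c *s x"
proof -
  have "(outer x x *v (c *s x)) $ i = c * x $ i * (x $ 1 * cnj (x $ 1) + x $ 2 * cnj (x $ 2))" for i
    by (simp add: outer_def matrix_vector_mult_def sum_2 algebra_simps)
  then show ?thesis using norm_eq_1_vec2 [OF assms] by (simp add: vec_eq_iff)
qed

text \<open>
  The difference of two rank-one projections is \<open>(1 - P) Q - P (1 - Q)\<close>, and the entries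
  of both products are entries of a unit vector times the wedge product. Thus the wedge product
  controls the distance of two lines in the matrix norm.
\<close>
lemma norm_outer_diff_le_wedge:
  assumes x: "norm x = 1" and y: "norm y = 1"
  shows "norm (outer y y - outer x x) \<le> 8 * norm (wedge x y)"
proof -
  define p where "p = (\<lambda>u v :: complex^2. v - (cnj (u $ 1) * v $ 1 + cnj (u $ 2) * v $ 2) *s u)"
  have p: "norm (p u v $ i) \<le> norm (wedge u v)" if "norm u = 1" for u v i
  proof -
    have *: "v $ j = v $ j * (u $ 1 * cnj (u $ 1) + u $ 2 * cnj (u $ 2))" for j
      using norm_eq_1_vec2 [OF that] by simp
    have "p u v $ 1 = - (cnj (u $ 2)) * wedge u v"
      unfolding p_def wedge_def
      by (simp, subst * [of 1], simp add: algebra_simps)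
    moreover have "p u v $ 2 = cnj (u $ 1) * wedge u v"
      unfolding p_def wedge_def
      by (simp, subst * [of 2], simp add: algebra_simps)
    ultimately have "norm (p u v $ i) \<le> norm (u $ (3 - i)) * norm (wedge u v)"
      using exhaust_2 [of i] by (auto simp: norm_mult)
    also have "\<dots> \<le> 1 * norm (wedge u v)"
      using Finite_Cartesian_Product.norm_nth_le [of u "3 - i"] that
      by (intro mult_right_mono) auto
    finally show ?thesis by simp
  qed
  have wsym: "norm (wedge y x) = norm (wedge x y)"
    unfolding wedge_def by (metis mult.commute norm_minus_commute)
  have entry: "norm ((outer y y - outer x x) $ i $ j) \<le> 2 * norm (wedge x y)" for i j
  proof -
    have "(outer y y - outer x x) $ i $ j = p x y $ i * cnj (y $ j) - x $ i * cnj (p y x $ j)"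
      by (simp add: outer_def p_def algebra_simps)
    also have "norm \<dots> \<le> norm (p x y $ i) * norm (y $ j) + norm (x $ i) * norm (p y x $ j)"
      by (rule order_trans [OF norm_triangle_ineq4]) (simp add: norm_mult)
    also have "\<dots> \<le> norm (wedge x y) * 1 + 1 * norm (wedge x y)"
      using p [OF x, of y i] p [OF y, of x j] wsym x y
        Finite_Cartesian_Product.norm_nth_le [of y j] Finite_Cartesian_Product.norm_nth_le [of x i]
      by (intro add_mono mult_mono) auto
    finally show ?thesis by simp
  qed
  have "norm ((outer y y - outer x x) $ i) \<le> 4 * norm (wedge x y)" for i
    using norm_vec2_le [of "(outer y y - outer x x) $ i"] entry [of i 1] entry [of i 2] by simp
  from this [of 1] this [of 2] norm_vec2_le [of "outer y y - outer x x"] show ?thesis by simp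
qed

lemma complex_lines_unit_span:
  assumes "L \<in> complex_lines"
  shows "\<exists>v. norm v = 1 \<and> L = range (\<lambda>c. c *s v)"
proof -
  have sub: "vec.subspace L" and dim: "vec.dim L = 1" using assms by (auto simp: complex_lines_def)
  obtain B where B: "B \<subseteq> L" "vec.independent B" "L \<subseteq> vec.span B" "card B = vec.dim L"
    using vec.basis_exists by blast
  then obtain b where b: "B = {b}" using dim card_1_singletonE by metis
  have L: "L = vec.span {b}" using B b sub vec.span_minimal by blast
  have "b \<noteq> 0" using B(2) b by (auto simp: vec.dependent_zero)
  define v where "v = complex_of_real (1 / norm b) *s b"
  have "norm v = 1" using \<open>b \<noteq> 0\<close> by (simp add: v_def norm_scaled_vec norm_divide)
  moreover have "L = range (\<lambda>c. c *s v)"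
  proof
    show "L \<subseteq> range (\<lambda>c. c *s v)"
    proof
      fix x assume "x \<in> L"
      then obtain c where "x = c *s b" unfolding L vec.span_singleton by blast
      then have "x = (c * norm b) *s v" using \<open>b \<noteq> 0\<close> by (simp add: v_def vec_eq_iff)
      then show "x \<in> range (\<lambda>c. c *s v)" by blast
    qed
    show "range (\<lambda>c. c *s v) \<subseteq> L" unfolding L vec.span_singleton v_def by auto
  qed
  ultimately show ?thesis by blast
qed

text \<open>
  A choice without any continuity in the line; only phase-independent expressions in it are used.
\<close>
definition unit_vec :: "(complex^2) set \<Rightarrow> complex^2" where
  "unit_vec L = (SOME v. norm v = 1 \<and> L = range (\<lambda>c. c *s v))"

lemma unit_vec:
  assumes "L \<in> complex_lines"
  shows "norm (unit_vec L) = 1" and "L = range (\<lambda>c. c *s unit_vec L)"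
  using someI_ex [OF complex_lines_unit_span [OF assms]] by (auto simp: unit_vec_def)

text \<open>
  The orthogonal projection onto the line. In contrast to the unit vector it is a function of the line
  alone, so it turns line fields into continuous matrix functions.
\<close>
definition line_proj :: "(complex^2) set \<Rightarrow> complex^2^2" where
  "line_proj L = outer (unit_vec L) (unit_vec L)"

lemma line_proj_in:
  assumes "L \<in> complex_lines"
  shows "line_proj L *v x \<in> L"
proof -
  have "line_proj L *v x = (cnj (unit_vec L $ 1) * x $ 1 + cnj (unit_vec L $ 2) * x $ 2) *s unit_vec L"
    by (simp add: line_proj_def outer_def vec_eq_iff matrix_vector_mult_def sum_2 algebra_simps)
  then show ?thesis using unit_vec(2) [OF assms] by (metis rangeI)
qed

lemma line_proj_fixes:
  assumes "L \<in> complex_lines" and "x \<in> L"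
  shows "line_proj L *v x = x"
  using assms unit_vec [OF assms(1)] outer_mult_unit unfolding line_proj_def by (metis rangeE)

lemma vec_span_singleton_in_complex_lines:
  assumes "(v :: complex^2) \<noteq> 0" shows "vec.span {v} \<in> complex_lines"
  using assms by (simp add: complex_lines_def vec.dim_span vec.dim_eq_card_independent)

lemma line_proj_span:
  assumes "v \<noteq> 0"
  shows "line_proj (vec.span {v}) = (\<chi> i j. outer v v $ i $ j / of_real ((norm v)\<^sup>2))"
proof -
  let ?L = "vec.span {v}"
  have L: "?L \<in> complex_lines" by (rule vec_span_singleton_in_complex_lines [OF assms])
  have "unit_vec ?L \<in> ?L" using unit_vec(2) [OF L] by (metis rangeI vec.scale_one)
  then obtain c where c: "unit_vec ?L = c *s v" unfolding vec.span_singleton by blast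
  have "norm c * norm v = 1" using unit_vec(1) [OF L] by (simp add: c norm_scaled_vec)
  then have "(norm c)\<^sup>2 = 1 / (norm v)\<^sup>2"
    using assms by (simp add: field_simps flip: power_mult_distrib)
  then have "c * cnj c = 1 / of_real ((norm v)\<^sup>2)"
    by (metis complex_norm_square of_real_1 of_real_divide)
  then show ?thesis unfolding line_proj_def c outer_scale by (simp add: vec_eq_iff)
qed

text \<open>
  The quotient topology is tested on spanning vectors, where the projection is an explicit continuous
  expression.
\<close>
lemma continuous_on_line_proj:
  fixes l :: "'a::topological_space \<Rightarrow> (complex^2) set"
  assumes l: "continuous_map euclidean CP1_topology l"
  shows "continuous_on UNIV (\<lambda>w. line_proj (l w))"
proof -
  have lines: "l w \<in> complex_lines" for w
    using continuous_map_image_subset_topspace [OF l] by (auto simp: topspace_CP1_topology)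
  have "open ((\<lambda>w. line_proj (l w)) -` T)" if "open T" for T
  proof -
    define S where "S = {L \<in> complex_lines. line_proj L \<in> T}"
    have cont: "continuous_on (- {0}) (\<lambda>v::complex^2. (\<chi> i j. outer v v $ i $ j / of_real ((norm v)\<^sup>2)))"
      unfolding outer_def by (auto intro!: continuous_intros)
    have "{v. v \<noteq> 0 \<and> vec.span {v} \<in> S} =
        - {0} \<inter> (\<lambda>v. (\<chi> i j. outer v v $ i $ j / of_real ((norm v)\<^sup>2))) -` T"
      using vec_span_singleton_in_complex_lines by (auto simp: S_def line_proj_span)
    then have "open {v. v \<noteq> 0 \<and> vec.span {v} \<in> S}"
      using continuous_open_preimage [OF cont _ \<open>open T\<close>] by (simp add: open_Compl)
    then have "openin CP1_topology S" by (auto simp: openin_CP1_topology S_def)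
    then have "open {w. l w \<in> S}"
      using openin_continuous_map_preimage [OF l] by fastforce
    moreover have "(\<lambda>w. line_proj (l w)) -` T = {w. l w \<in> S}" using lines by (auto simp: S_def)
    ultimately show ?thesis by simp
  qed
  then show ?thesis by (simp add: continuous_on_open_vimage)
qed

section \<open>Lipschitz bounds from the analytic strip\<close>

text \<open>
  Restriction to a complex line reduces the several-variable notion to one complex variable.
\<close>
lemma holomorphic2_on_complex_line:
  assumes "holomorphic2_on f X" and "z + \<zeta> *s v \<in> X"
  shows "\<exists>d. ((\<lambda>\<zeta>. f (z + \<zeta> *s v)) has_field_derivative d) (at \<zeta>)"
proof -
  obtain D where D: "(f has_derivative D) (at (z + \<zeta> *s v))" and lin: "\<And>c v. D (c *s v) = c * D v"
    using assms unfolding holomorphic2_on_def by blast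
  have "((\<lambda>\<zeta>. z + \<zeta> *s v) has_derivative (\<lambda>h. h *s v)) (at \<zeta>)"
  proof -
    have "linear (\<lambda>h. h *s v)"
      by (rule linearI) (simp_all add: vec_eq_iff algebra_simps)
    then have "bounded_linear (\<lambda>h. h *s v)" by (simp add: linear_conv_bounded_linear)
    from bounded_linear.has_derivative [OF this has_derivative_ident]
    have "((\<lambda>\<zeta>. z + \<zeta> *s v) has_derivative (\<lambda>h. 0 + h *s v)) (at \<zeta>)"
      by (intro has_derivative_add has_derivative_const)
    then show ?thesis by simp
  qed
  from has_derivative_compose [OF this D]
  have "((\<lambda>\<zeta>. f (z + \<zeta> *s v)) has_derivative (\<lambda>h. h * D v)) (at \<zeta>)" by (simp add: lin)
  moreover have "(\<lambda>h. h * D v) = (*) (D v)" by (simp add: fun_eq_iff)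
  ultimately show ?thesis by (auto simp: has_field_derivative_def)
qed

text \<open>
  On the complex line through two real points, the strip contains a disc of radius \<open>\<delta> /
  |w' - w|\<close> around every point of the segment between them, so Cauchy's inequality bounds the
  derivative there.
\<close>
lemma bounded_holomorphic_on_strip_imp_Lipschitz:
  assumes "holomorphic2_on f X" and "open X" and "strip \<delta> \<subseteq> X" and "\<delta> > 0"
    and bound: "\<And>z. z \<in> strip \<delta> \<Longrightarrow> norm (f z) \<le> B"
  shows "norm (f (complexify w') - f (complexify w)) \<le> B / \<delta> * norm (w' - w)"
proof (cases "w' = w")
  case False
  define v where "v = w' - w"
  define r where "r = \<delta> / norm v"
  define g where "g = (\<lambda>\<zeta>. f (complexify w + \<zeta> *s complexify v))"
  have v: "norm v > 0" using False by (simp add: v_def)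
  then have r: "r > 0" using \<open>\<delta> > 0\<close> by (simp add: r_def)
  have strip: "complexify w + \<zeta> *s complexify v \<in> strip \<delta>" if "\<bar>Im \<zeta>\<bar> \<le> r" for \<zeta>
  proof -
    have "\<bar>Im \<zeta> * v $ i\<bar> \<le> r * norm v" for i
      unfolding abs_mult using that r by (intro mult_mono) (auto simp: component_le_norm_cart)
    also have "r * norm v = \<delta>" using v by (simp add: r_def)
    finally show ?thesis by (simp add: strip_def complexify_def)
  qed
  have diff: "\<exists>d. (g has_field_derivative d) (at \<zeta>)" if "\<bar>Im \<zeta>\<bar> \<le> r" for \<zeta>
    unfolding g_def
    by (rule holomorphic2_on_complex_line [OF assms(1) subsetD [OF assms(3) strip [OF that]]])
  have hol: "g holomorphic_on {\<zeta>. \<bar>Im \<zeta>\<bar> \<le> r}"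
    unfolding holomorphic_on_def field_differentiable_def
    using diff has_field_derivative_at_within by blast
  have deriv_bound: "norm (deriv g \<xi>) \<le> B / r" if "\<xi> \<in> closed_segment 0 1" for \<xi>
  proof -
    have "Im \<xi> = 0" using that by (auto simp: closed_segment_def)
    have sub: "cball \<xi> r \<subseteq> {\<zeta>. \<bar>Im \<zeta>\<bar> \<le> r}"
    proof
      fix x assume "x \<in> cball \<xi> r"
      then show "x \<in> {\<zeta>. \<bar>Im \<zeta>\<bar> \<le> r}"
        using abs_Im_le_cmod [of "\<xi> - x"] \<open>Im \<xi> = 0\<close> by (simp add: dist_norm)
    qed
    have "norm ((deriv ^^ 1) g \<xi>) \<le> fact 1 * B / r ^ 1"
    proof (rule Cauchy_inequality)
      show "g holomorphic_on ball \<xi> r"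
        by (rule holomorphic_on_subset [OF hol order_trans [OF ball_subset_cball sub]])
      show "continuous_on (cball \<xi> r) g"
        by (rule holomorphic_on_imp_continuous_on [OF holomorphic_on_subset [OF hol sub]])
      show "norm (g x) \<le> B" if "norm (\<xi> - x) = r" for x
        unfolding g_def using that sub by (intro bound strip) (auto simp: dist_norm)
    qed (fact r)
    then show ?thesis by simp
  qed
  have "norm (g 1 - g 0) \<le> B / r * norm (1 - 0 :: complex)"
  proof (rule field_differentiable_bound)
    show "(g has_field_derivative deriv g z) (at z within closed_segment 0 1)"
      if "z \<in> closed_segment 0 1" for z
    proof -
      have "Im z = 0" using that by (auto simp: closed_segment_def)
      then have "g field_differentiable at z"
        using diff [of z] r by (auto simp: field_differentiable_def)
      then show ?thesis
        by (meson DERIV_deriv_iff_field_differentiable has_field_derivative_at_within)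
    qed
  qed (use deriv_bound in auto)
  moreover have "g 1 = f (complexify w')" "g 0 = f (complexify w)"
    by (auto simp: g_def v_def complexify_def vec_eq_iff intro!: arg_cong [of _ _ f])
  ultimately show ?thesis by (simp add: r_def v_def mult_ac)
qed simp

lemma extends_to_strip_imp_bounded_Lipschitz:
  assumes "extends_to_strip \<delta> M" and "\<delta> > 0"
  shows "\<exists>K L. (\<forall>w. norm (M w) \<le> K) \<and> L-lipschitz_on UNIV M"
proof -
  obtain E X where "open X" "strip \<delta> \<subseteq> X" and hol: "\<And>i j. holomorphic2_on (\<lambda>z. E z $ i $ j) X"
    and bdd: "bounded (E ` strip \<delta>)" and E: "\<And>w. E (complexify w) = M w"
    using assms(1) unfolding extends_to_strip_def by blast
  obtain K where K: "\<And>z. z \<in> strip \<delta> \<Longrightarrow> norm (E z) \<le> K"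
    using bdd unfolding bounded_iff by auto
  have real: "complexify w \<in> strip \<delta>" for w
    using assms(2) by (simp add: strip_def complexify_def)
  have K0: "K \<ge> 0" using K [OF real] norm_ge_zero order_trans by blast
  have entry: "norm (M w' $ i $ j - M w $ i $ j) \<le> K / \<delta> * norm (w' - w)" for w w' i j
  proof -
    have "norm (E z $ i $ j) \<le> K" if "z \<in> strip \<delta>" for z
      using K [OF that] Finite_Cartesian_Product.norm_nth_le [of "E z" i] Finite_Cartesian_Product.norm_nth_le [of "E z $ i" j] by linarith
    from bounded_holomorphic_on_strip_imp_Lipschitz
      [OF hol [of i j] \<open>open X\<close> \<open>strip \<delta> \<subseteq> X\<close> assms(2) this, of w' w]
    show ?thesis by (simp add: E)
  qed
  have row: "norm (M w' $ i - M w $ i) \<le> 2 * (K / \<delta>) * norm (w' - w)" for w w' i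
  proof -
    have "norm (M w' $ i - M w $ i) \<le> (\<Sum>j\<in>UNIV. norm ((M w' $ i - M w $ i) $ j))"
      unfolding norm_vec_def by (rule L2_set_le_sum) simp
    also have "\<dots> \<le> (\<Sum>j\<in>(UNIV::2 set). K / \<delta> * norm (w' - w))"
      by (intro sum_mono) (use entry in auto)
    finally show ?thesis by simp
  qed
  have "norm (M w' - M w) \<le> 4 * (K / \<delta>) * norm (w' - w)" for w w'
  proof -
    have "norm (M w' - M w) \<le> (\<Sum>i\<in>UNIV. norm ((M w' - M w) $ i))"
      unfolding norm_vec_def by (rule L2_set_le_sum) simp
    also have "\<dots> \<le> (\<Sum>i\<in>(UNIV::2 set). 2 * (K / \<delta>) * norm (w' - w))"
      by (intro sum_mono) (use row in auto)
    finally show ?thesis by simp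
  qed
  then have "(4 * (K / \<delta>))-lipschitz_on UNIV M"
    using K0 assms(2) by (intro lipschitz_onI) (auto simp: dist_norm)
  moreover have "norm (M w) \<le> K" for w using K [OF real [of w]] by (simp add: E)
  ultimately show ?thesis by blast
qed

section \<open>Contraction of dominated line fields\<close>

lemma periodic_int:
  fixes a :: "'a::real_vector"
  assumes "\<And>w. f (w + a) = f w"
  shows "f (w + of_int m *\<^sub>R a) = f w"
proof (induction m arbitrary: w rule: int_induct [where k = 0])
  case (step1 i)
  have "f (w + of_int (i + 1) *\<^sub>R a) = f ((w + of_int i *\<^sub>R a) + a)" by (simp add: algebra_simps)
  then show ?case using step1 assms by metis
next
  case (step2 i)
  have "f (w + of_int (i - 1) *\<^sub>R a) = f ((w + of_int (i - 1) *\<^sub>R a) + a)" by (simp only: assms)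
  also have "\<dots> = f (w + of_int i *\<^sub>R a)" by (simp add: algebra_simps)
  finally show ?case using step2 by metis
qed simp

lemma periodic_lattice:
  fixes f :: "real^2 \<Rightarrow> 'b"
  assumes "\<And>w. f (w + e1) = f w" and "\<And>w. f (w + e2) = f w"
  shows "f (w + of_int m *\<^sub>R e1 + of_int n *\<^sub>R e2) = f w"
  using periodic_int [where f = f and a = e1] periodic_int [where f = f and a = e2] assms by metis

lemma lattice_reduction:
  fixes w :: "real^2"
  obtains m n :: int where "norm (w + of_int m *\<^sub>R e1 + of_int n *\<^sub>R e2) \<le> 2"
proof -
  define v where "v = w + of_int (- \<lfloor>w $ 1\<rfloor>) *\<^sub>R e1 + of_int (- \<lfloor>w $ 2\<rfloor>) *\<^sub>R e2"
  have "\<bar>v $ 1\<bar> \<le> 1" "\<bar>v $ 2\<bar> \<le> 1"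
    by (auto simp: v_def axis_def; linarith)+
  then have "norm v \<le> 2" using norm_vec2_le [of v] by simp
  then show ?thesis using that unfolding v_def by blast
qed

text \<open>
  Two nearby points are moved by one common lattice vector into a fixed compact ball.
\<close>
lemma periodic_continuous_imp_uniformly_continuous:
  fixes f :: "real^2 \<Rightarrow> real"
  assumes cont: "continuous_on UNIV f" and per: "\<And>w. f (w + e1) = f w" "\<And>w. f (w + e2) = f w"
    and "\<epsilon> > 0"
  obtains \<delta> where "\<delta> > 0" "\<And>w w'. norm (w' - w) \<le> \<delta> \<Longrightarrow> \<bar>f w' - f w\<bar> < \<epsilon>"
proof -
  have "uniformly_continuous_on (cball 0 3) f"
    by (rule compact_uniformly_continuous [OF continuous_on_subset [OF cont subset_UNIV] compact_cball])
  then obtain d where d: "d > 0"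
    "\<And>w w'. \<lbrakk>w \<in> cball 0 3; w' \<in> cball 0 3; dist w' w < d\<rbrakk> \<Longrightarrow> dist (f w') (f w) < \<epsilon>"
    unfolding uniformly_continuous_on_def using \<open>\<epsilon> > 0\<close> by blast
  show ?thesis
  proof
    show "min (d / 2) 1 > 0" using d by simp
    fix w w' :: "real^2" assume *: "norm (w' - w) \<le> min (d / 2) 1"
    obtain m n where mn: "norm (w + of_int m *\<^sub>R e1 + of_int n *\<^sub>R e2) \<le> 2" (is "norm ?v \<le> 2")
      by (rule lattice_reduction)
    let ?v' = "w' + of_int m *\<^sub>R e1 + of_int n *\<^sub>R e2"
    have diff: "?v' - ?v = w' - w" by simp
    have "norm ?v' \<le> norm ?v + norm (?v' - ?v)" by (rule norm_triangle_sub)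
    then have "norm ?v' \<le> 3" using mn * unfolding diff by simp
    moreover have "dist ?v' ?v < d" using * d(1) unfolding dist_norm diff by simp
    ultimately have "dist (f ?v') (f ?v) < \<epsilon>" using mn by (intro d(2)) auto
    then show "\<bar>f w' - f w\<bar> < \<epsilon>" by (simp add: periodic_lattice [OF per] dist_real_def)
  qed
qed

lemma periodic_continuous_pos_imp_bounded_below:
  fixes f :: "real^2 \<Rightarrow> real"
  assumes cont: "continuous_on UNIV f" and per: "\<And>w. f (w + e1) = f w" "\<And>w. f (w + e2) = f w"
    and pos: "\<And>w. f w > 0"
  obtains c where "c > 0" "\<And>w. f w \<ge> c"
proof -
  have "continuous_on (cball 0 2) f" by (rule continuous_on_subset [OF cont subset_UNIV])
  then obtain x where x: "\<And>y. y \<in> cball 0 2 \<Longrightarrow> f x \<le> f y"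
    using continuous_attains_inf [of "cball (0 :: real^2) 2" f] by force
  have "f x \<le> f w" for w
  proof -
    obtain m n where "norm (w + of_int m *\<^sub>R e1 + of_int n *\<^sub>R e2) \<le> 2" by (rule lattice_reduction)
    then have "f x \<le> f (w + of_int m *\<^sub>R e1 + of_int n *\<^sub>R e2)" by (intro x) simp
    then show ?thesis by (simp add: periodic_lattice [OF per])
  qed
  then show ?thesis using pos that by blast
qed

text \<open>
  Iterating the step \<open>k\<close> times leaves \<open>\<kappa> ^ k M\<close> plus a geometric
  series in the distance of the two points, which translations do not change. The limit \<open>k
  \<longlongrightarrow> \<infinity>\<close> gives the bound.
\<close>
lemma contraction_step_imp_Lipschitz:
  fixes D :: "'a::real_normed_vector \<Rightarrow> 'a \<Rightarrow> real"
  assumes step: "\<And>w w'. norm (w' - w) \<le> \<delta> \<Longrightarrow> D w w' \<le> \<kappa> * D (w + a) (w' + a) + C * norm (w' - w)"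
    and "\<delta> > 0" and \<kappa>: "0 \<le> \<kappa>" "\<kappa> < 1" and C: "C \<ge> 0" and M: "\<And>w w'. D w w' \<le> M" "M \<ge> 0"
  shows "\<exists>K \<ge> 0. \<forall>w w'. D w w' \<le> K * norm (w' - w)"
proof -
  have iter: "D w w' \<le> \<kappa> ^ k * M + C / (1 - \<kappa>) * norm (w' - w)" if "norm (w' - w) \<le> \<delta>" for k w w'
    using that
  proof (induction k arbitrary: w w')
    case 0
    have "0 \<le> C / (1 - \<kappa>) * norm (w' - w)" using C \<kappa> by simp
    then show ?case using M(1) [of w w'] by simp
  next
    case (Suc k)
    let ?d = "norm (w' - w)"
    have "D w w' \<le> \<kappa> * D (w + a) (w' + a) + C * ?d" by (rule step [OF Suc.prems])
    also have "D (w + a) (w' + a) \<le> \<kappa> ^ k * M + C / (1 - \<kappa>) * ?d"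
      using Suc.IH [of "w' + a" "w + a"] Suc.prems by simp
    also have "\<kappa> * (\<kappa> ^ k * M + C / (1 - \<kappa>) * ?d) + C * ?d = \<kappa> ^ Suc k * M + C / (1 - \<kappa>) * ?d"
      using \<kappa> by (simp add: field_simps)
    finally show ?case using \<kappa> by (simp add: mult_left_mono)
  qed
  have near: "D w w' \<le> C / (1 - \<kappa>) * norm (w' - w)" if "norm (w' - w) \<le> \<delta>" for w w'
  proof -
    have "(\<lambda>k. \<kappa> ^ k * M + C / (1 - \<kappa>) * norm (w' - w)) \<longlonglongrightarrow> 0 * M + C / (1 - \<kappa>) * norm (w' - w)"
      using \<kappa> by (intro tendsto_intros LIMSEQ_power_zero) auto
    then show ?thesis using iter [OF that] by (intro LIMSEQ_le_const) auto
  qed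
  define K where "K = max (C / (1 - \<kappa>)) (M / \<delta>)"
  have K0: "K \<ge> 0" unfolding K_def using M(2) \<open>\<delta> > 0\<close> by (intro max.coboundedI2) simp
  have "D w w' \<le> K * norm (w' - w)" for w w'
  proof (cases "norm (w' - w) \<le> \<delta>")
    case True
    then show ?thesis
      using near [OF True] mult_right_mono [of "C / (1 - \<kappa>)" K "norm (w' - w)"] by (simp add: K_def)
  next
    case False
    have "M = M / \<delta> * \<delta>" using \<open>\<delta> > 0\<close> by simp
    also have "\<dots> \<le> K * norm (w' - w)"
      using False K0 \<open>\<delta> > 0\<close> by (intro mult_mono) (auto simp: K_def)
    finally show ?thesis using M(1) order_trans by blast
  qed
  then show ?thesis using K0 by blast
qed

text \<open>
  Both inequalities come from \<open>B x \<and> B y = det B (x \<and> y)\<close>, where the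
  determinant is read off from the two invariant lines: \<open>|det B| \<Delta> w = |p w| |q w|
  \<Delta> (w + a)\<close>. Replacing \<open>B w\<close> by \<open>B w'\<close> in the second slot
  costs an error of the size of \<open>|w' - w|\<close>. The first inequality follows the dynamics
  forwards, the second backwards.
\<close>
lemma wedge_step_bounds:
  assumes s: "norm (s w') = 1"
    and Bs: "\<And>v. B v *v s v = p v *s s (v + a)" and Bt: "B w *v t w = q w *s t (w + a)"
    and ns: "norm (s (w + a)) = 1"
    and lip: "norm (B w' - B w) \<le> L * d"
    and \<Delta>: "norm (wedge (s w) (t w)) = \<Delta> w" "norm (wedge (s (w + a)) (t (w + a))) = \<Delta> (w + a)"
  shows "norm (p w) * norm (p w') * \<Delta> w * norm (wedge (s (w + a)) (s (w' + a)))
      \<le> norm (p w) * norm (q w) * \<Delta> (w + a) * norm (wedge (s w) (s w')) + 8 * L * d * norm (p w) * \<Delta> w"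
    and "norm (p w) * norm (q w) * \<Delta> (w + a) * norm (wedge (s w) (s w'))
      \<le> norm (p w) * norm (p w') * \<Delta> w * norm (wedge (s (w + a)) (s (w' + a))) + 8 * L * d * norm (p w) * \<Delta> w"
proof -
  have \<Delta>0: "\<Delta> w \<ge> 0" by (simp flip: \<Delta>(1))
  have "det (B w) * wedge (s w) (t w) = p w * q w * wedge (s (w + a)) (t (w + a))"
    by (simp add: Bs Bt wedge_scale flip: wedge_matrix)
  then have det: "norm (det (B w)) * \<Delta> w = norm (p w) * norm (q w) * \<Delta> (w + a)"
    by (metis \<Delta> norm_mult)
  have det': "norm (det (B w)) * norm (wedge (s w) (s w')) * \<Delta> w
      = norm (p w) * norm (q w) * \<Delta> (w + a) * norm (wedge (s w) (s w'))"
    using arg_cong [OF det, of "\<lambda>z. z * norm (wedge (s w) (s w'))"] by (simp add: mult_ac)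
  define E where "E = wedge (B w *v s w) ((B w' - B w) *v s w')"
  have eq: "p w * p w' * wedge (s (w + a)) (s (w' + a)) = det (B w) * wedge (s w) (s w') + E"
  proof -
    have "B w' *v s w' = B w *v s w' + (B w' - B w) *v s w'"
      by (simp flip: matrix_vector_mult_add_rdistrib)
    then have "wedge (B w *v s w) (B w' *v s w') = det (B w) * wedge (s w) (s w') + E"
      by (simp add: wedge_add_right wedge_matrix E_def)
    then show ?thesis by (simp add: Bs wedge_scale)
  qed
  have "norm E \<le> 2 * norm (p w) * (4 * norm (B w' - B w) * norm (s w'))"
    unfolding E_def Bs
    by (rule order_trans [OF norm_wedge_le]) (intro mult_mono norm_mat2_vec_le, auto simp: norm_scaled_vec ns)
  also have "\<dots> \<le> 2 * norm (p w) * (4 * (L * d))"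
    using lip s by (intro mult_left_mono) auto
  finally have E: "norm E \<le> 8 * L * d * norm (p w)" by (simp add: mult_ac)
  have 1: "norm (p w) * norm (p w') * norm (wedge (s (w + a)) (s (w' + a)))
      \<le> norm (det (B w)) * norm (wedge (s w) (s w')) + 8 * L * d * norm (p w)"
    using E norm_triangle_ineq [of "det (B w) * wedge (s w) (s w')" E] by (simp add: norm_mult flip: eq)
  have 2: "norm (det (B w)) * norm (wedge (s w) (s w'))
      \<le> norm (p w) * norm (p w') * norm (wedge (s (w + a)) (s (w' + a))) + 8 * L * d * norm (p w)"
  proof -
    have "norm (det (B w) * wedge (s w) (s w')) \<le> norm (p w * p w' * wedge (s (w + a)) (s (w' + a))) + norm E"
      unfolding eq using norm_triangle_ineq4 [of "det (B w) * wedge (s w) (s w') + E" E] by simp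
    then show ?thesis using E by (simp add: norm_mult)
  qed
  show "norm (p w) * norm (p w') * \<Delta> w * norm (wedge (s (w + a)) (s (w' + a)))
      \<le> norm (p w) * norm (q w) * \<Delta> (w + a) * norm (wedge (s w) (s w')) + 8 * L * d * norm (p w) * \<Delta> w"
    using mult_right_mono [OF 1 \<Delta>0] unfolding distrib_right det' by (simp add: mult_ac)
  show "norm (p w) * norm (q w) * \<Delta> (w + a) * norm (wedge (s w) (s w'))
      \<le> norm (p w) * norm (p w') * \<Delta> w * norm (wedge (s (w + a)) (s (w' + a))) + 8 * L * d * norm (p w) * \<Delta> w"
    using mult_right_mono [OF 2 \<Delta>0] unfolding distrib_right det' by (simp add: mult_ac)
qed

text \<open>
  Dividing the wedge product by \<open>\<Delta>\<close> makes the factor in the two step inequalities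
  a quotient \<open>|q| / |p|\<close>, evaluated at two nearby points; it is at most
  \<open>\<kappa>\<close> because \<open>|p|\<close> varies slowly. The dominating line
  \<open>s\<close> contracts under forward iteration and the dominated line \<open>t\<close> under
  backward iteration.
\<close>
lemma dominated_lines_wedge_Lipschitz:
  fixes s t :: "real^2 \<Rightarrow> complex^2"
  assumes s: "\<And>w. norm (s w) = 1" and t: "\<And>w. norm (t w) = 1"
    and Bs: "\<And>w. B w *v s w = p w *s s (w + a)" and Bt: "\<And>w. B w *v t w = q w *s t (w + a)"
    and dom: "\<And>w. norm (q w) \<le> \<kappa>\<^sup>2 * norm (p w)" and \<kappa>: "0 < \<kappa>" "\<kappa> < 1"
    and q: "\<And>w. q w \<noteq> 0"
    and p0: "p0 > 0" "\<And>w. norm (p w) \<ge> p0"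
    and \<Delta>0: "\<Delta>0 > 0" "\<And>w. norm (wedge (s w) (t w)) \<ge> \<Delta>0"
    and lip: "\<And>w w'. norm (B w' - B w) \<le> L * norm (w' - w)" and L: "L \<ge> 0"
    and \<delta>: "\<delta> > 0" "\<And>w w'. norm (w' - w) \<le> \<delta> \<Longrightarrow> \<bar>norm (p w') - norm (p w)\<bar> < (1 - \<kappa>) * p0"
  shows "\<exists>K \<ge> 0. \<forall>w w'. norm (wedge (s w) (s w')) \<le> K * norm (w' - w)"
    and "\<exists>K \<ge> 0. \<forall>w w'. norm (wedge (t w) (t w')) \<le> K * norm (w' - w)"
proof -
  \<comment> \<open>The sine of the angle between the two invariant lines.\<close>
  define \<Delta> where "\<Delta> = (\<lambda>w. norm (wedge (s w) (t w)))"
  have \<Delta>: "\<Delta> w \<ge> \<Delta>0" "\<Delta> w > 0" "\<Delta> w \<le> 2" for w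
    using \<Delta>0(1) \<Delta>0(2) [of w] norm_wedge_le [of "s w" "t w"] s [of w] t [of w] by (auto simp: \<Delta>_def simp del: zero_less_norm_iff intro: less_le_trans)
  have p: "norm (p w) > 0" for w using p0 less_le_trans by blast
  have qn: "norm (q w) > 0" for w using q by simp
  have comp: "\<kappa> * norm (p w) \<le> norm (p w')" if "norm (w' - w) \<le> \<delta>" for w w'
  proof -
    have "norm (p w) - norm (p w') \<le> (1 - \<kappa>) * p0" using \<delta>(2) [OF that] by linarith
    also have "\<dots> \<le> (1 - \<kappa>) * norm (p w)" using p0(2) \<kappa> by (intro mult_left_mono) auto
    finally show ?thesis by (simp add: algebra_simps)
  qed
  have ratio: "norm (q w) \<le> \<kappa> * norm (p w')" if "norm (w' - w) \<le> \<delta>" for w w'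
  proof -
    have "norm (q w) \<le> \<kappa> * (\<kappa> * norm (p w))" using dom [of w] by (simp add: power2_eq_square mult.assoc)
    also have "\<dots> \<le> \<kappa> * norm (p w')" using comp [OF that] \<kappa> by (intro mult_left_mono) auto
    finally show ?thesis .
  qed
  define C where "C = 8 * L / (p0 * \<Delta>0)"
  have C: "C \<ge> 0" using L p0 \<Delta>0 by (simp add: C_def)
  have CI: "8 * L * d / (norm (p w) * \<Delta> w') \<le> C * d" if "d \<ge> 0" for d w w'
  proof -
    have "p0 * \<Delta>0 \<le> norm (p w) * \<Delta> w'" using p0 \<Delta>0 \<Delta> by (intro mult_mono) auto
    then have "8 * L * d / (norm (p w) * \<Delta> w') \<le> 8 * L * d / (p0 * \<Delta>0)"
      using L that p0 \<Delta>0 by (intro divide_left_mono mult_nonneg_nonneg mult_pos_pos p \<Delta>) auto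
    then show ?thesis by (simp add: C_def)
  qed
  have bound: "norm (wedge (x w) (x w')) / \<Delta> w \<le> 2 / \<Delta>0" if "\<And>w. norm (x w) = 1" for x w w'
    using norm_wedge_le [of "x w" "x w'"] that \<Delta> \<Delta>0 by (intro frac_le) auto
  have finish: "\<exists>K \<ge> 0. \<forall>w w'. norm (wedge (x w) (x w')) \<le> K * norm (w' - w)"
    if "\<exists>K \<ge> 0. \<forall>w w'. norm (wedge (x w) (x w')) / \<Delta> w \<le> K * norm (w' - w)" for x
  proof -
    from that obtain K where K0: "K \<ge> 0" and "\<forall>w w'. norm (wedge (x w) (x w')) / \<Delta> w \<le> K * norm (w' - w)"
      by (elim exE conjE)
    then have K: "norm (wedge (x w) (x w')) / \<Delta> w \<le> K * norm (w' - w)" for w w' by simp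
    have "norm (wedge (x w) (x w')) \<le> (K * 2) * norm (w' - w)" for w w'
    proof -
      have "norm (wedge (x w) (x w')) \<le> K * norm (w' - w) * \<Delta> w"
        using K [of w w'] \<Delta>(2) [of w] by (simp add: field_simps)
      also have "\<dots> \<le> K * norm (w' - w) * 2" using K0 \<Delta> by (intro mult_left_mono) auto
      finally show ?thesis by (simp add: mult_ac)
    qed
    then show ?thesis using K0 by (intro exI [of _ "K * 2"]) auto
  qed
  show "\<exists>K \<ge> 0. \<forall>w w'. norm (wedge (s w) (s w')) \<le> K * norm (w' - w)"
  proof (rule finish, rule contraction_step_imp_Lipschitz [where \<delta> = \<delta> and \<kappa> = \<kappa> and a = "- a" and C = C and M = "2 / \<Delta>0"])
    fix v v' :: "real^2" assume v: "norm (v' - v) \<le> \<delta>"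
    define w w' where "w = v - a" and "w' = v' - a"
    define d where "d = norm (w' - w)"
    have w: "norm (w' - w) \<le> \<delta>" "v = w + a" "v' = w' + a" using v by (auto simp: w_def w'_def)
    let ?X = "norm (wedge (s w) (s w'))" and ?Y = "norm (wedge (s (w + a)) (s (w' + a)))"
    have "norm (p w) * norm (p w') * \<Delta> w * ?Y \<le> norm (p w) * norm (q w) * \<Delta> (w + a) * ?X + 8 * L * d * norm (p w) * \<Delta> w"
      unfolding d_def by (rule wedge_step_bounds(1) [where t = t and B = B]) (auto simp: s Bs Bt \<Delta>_def lip)
    then have "norm (p w) * \<Delta> w * (norm (p w') * ?Y) \<le> norm (p w) * \<Delta> w * (norm (q w) * \<Delta> (w + a) * (?X / \<Delta> w) + 8 * L * d)"
      using \<Delta>(2) [of w] by (simp add: algebra_simps)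
    then have "norm (p w') * ?Y \<le> norm (q w) * \<Delta> (w + a) * (?X / \<Delta> w) + 8 * L * d"
      unfolding mult_le_cancel_left_pos [OF mult_pos_pos [OF p \<Delta>(2)]] .
    then have "norm (p w') * ?Y / (norm (p w') * \<Delta> (w + a))
        \<le> (norm (q w) * \<Delta> (w + a) * (?X / \<Delta> w) + 8 * L * d) / (norm (p w') * \<Delta> (w + a))"
      using \<Delta>(2) [of "w + a"] by (intro divide_right_mono) auto
    moreover have "norm (p w') * ?Y / (norm (p w') * \<Delta> (w + a)) = ?Y / \<Delta> (w + a)"
      using p [of w'] by simp
    ultimately have "?Y / \<Delta> (w + a)
        \<le> (norm (q w) * \<Delta> (w + a) * (?X / \<Delta> w) + 8 * L * d) / (norm (p w') * \<Delta> (w + a))"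
      by simp
    also have "\<dots> = norm (q w) / norm (p w') * (?X / \<Delta> w) + 8 * L * d / (norm (p w') * \<Delta> (w + a))"
      using \<Delta>(2) [of "w + a"] by (auto simp: add_divide_distrib)
    also have "\<dots> \<le> \<kappa> * (?X / \<Delta> w) + C * d"
      using ratio [OF w(1)] p \<Delta>(2) by (intro add_mono mult_right_mono CI) (auto simp: d_def divide_le_eq order_less_imp_le)
    finally show "norm (wedge (s v) (s v')) / \<Delta> v \<le> \<kappa> * (norm (wedge (s (v + - a)) (s (v' + - a))) / \<Delta> (v + - a)) + C * norm (v' - v)"
      by (simp add: w d_def)
  qed (use \<kappa> \<delta> C bound s \<Delta>0 in auto)
  show "\<exists>K \<ge> 0. \<forall>w w'. norm (wedge (t w) (t w')) \<le> K * norm (w' - w)"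
  proof (rule finish, rule contraction_step_imp_Lipschitz [where \<delta> = \<delta> and \<kappa> = \<kappa> and a = a and C = C and M = "2 / \<Delta>0"])
    fix w w' :: "real^2" assume w: "norm (w' - w) \<le> \<delta>"
    define d where "d = norm (w' - w)"
    let ?X = "norm (wedge (t w) (t w'))" and ?Y = "norm (wedge (t (w + a)) (t (w' + a)))"
    have sym: "norm (wedge (t w) (s w)) = \<Delta> w" for w
      unfolding \<Delta>_def wedge_def by (metis mult.commute norm_minus_commute)
    have "norm (q w) * norm (p w) * \<Delta> (w + a) * ?X \<le> norm (q w) * norm (q w') * \<Delta> w * ?Y + 8 * L * d * norm (q w) * \<Delta> w"
      unfolding d_def by (rule wedge_step_bounds(2) [where t = s and B = B]) (auto simp: t Bs Bt sym lip)
    then have "norm (q w) * \<Delta> w * (norm (p w) * \<Delta> (w + a) * (?X / \<Delta> w)) \<le> norm (q w) * \<Delta> w * (norm (q w') * ?Y + 8 * L * d)"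
      using \<Delta>(2) [of w] by (simp add: algebra_simps)
    then have "norm (p w) * \<Delta> (w + a) * (?X / \<Delta> w) \<le> norm (q w') * ?Y + 8 * L * d"
      unfolding mult_le_cancel_left_pos [OF mult_pos_pos [OF qn \<Delta>(2)]] .
    then have "?X / \<Delta> w \<le> (norm (q w') * ?Y + 8 * L * d) / (norm (p w) * \<Delta> (w + a))"
      by (subst pos_le_divide_eq) (use p \<Delta>(2) in \<open>auto simp: mult_ac\<close>)
    also have "\<dots> = norm (q w') / norm (p w) * (?Y / \<Delta> (w + a)) + 8 * L * d / (norm (p w) * \<Delta> (w + a))"
      by (simp add: add_divide_distrib)
    also have "\<dots> \<le> \<kappa> * (?Y / \<Delta> (w + a)) + C * d"
      using ratio [of w w'] w p \<Delta>(2)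
      by (intro add_mono mult_right_mono CI) (auto simp: d_def divide_le_eq order_less_imp_le norm_minus_commute)
    finally show "norm (wedge (t w) (t w')) / \<Delta> w \<le> \<kappa> * (norm (wedge (t (w + a)) (t (w' + a))) / \<Delta> (w + a)) + C * norm (w' - w)"
      by (simp add: d_def)
  qed (use \<kappa> \<delta> C bound t \<Delta>0 in auto)
qed

section \<open>Dominated invariant lines are Lipschitz\<close>

lemma vec_inner_matrix_adjoint:
  "(\<Sum>i\<in>UNIV. (M *v x) $ i * cnj (y $ i)) = (\<Sum>i\<in>UNIV. x $ i * cnj ((adjoint_mat M *v y) $ i))"
  by (simp add: sum_2 matrix_vector_mult_def adjoint_mat_def algebra_simps)

lemma norm_unitary_mat:
  assumes "unitary_mat M" shows "norm (M *v x) = norm x"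
proof -
  have sq: "complex_of_real ((norm y)\<^sup>2) = (\<Sum>i\<in>UNIV. y $ i * cnj (y $ i))" for y :: "complex^2"
    by (simp add: norm_vec_def L2_set_def sum_2 complex_norm_square del: of_real_power)
  have "adjoint_mat M *v (M *v x) = x"
    using assms by (simp add: unitary_mat_def matrix_vector_mul_assoc)
  then have "complex_of_real ((norm (M *v x))\<^sup>2) = complex_of_real ((norm x)\<^sup>2)"
    unfolding sq vec_inner_matrix_adjoint by simp
  then have "(norm (M *v x))\<^sup>2 = (norm x)\<^sup>2" by (simp only: of_real_eq_iff)
  then show ?thesis by simp
qed

lemma norm_det_unitary_mat:
  assumes "unitary_mat M" shows "norm (det M) = 1"
proof -
  have "det (adjoint_mat M) = cnj (det M)" by (simp add: det_2 adjoint_mat_def)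
  then have "cnj (det M) * det M = 1"
    using assms det_mul [of "adjoint_mat M" M] by (simp add: unitary_mat_def)
  then have "norm (det M) * norm (det M) = 1" by (metis complex_mod_cnj norm_mult norm_one)
  then show ?thesis using norm_ge_zero [of "det M"] by (metis abs_of_nonneg abs_1 abs_mult_self_eq real_sqrt_abs2 real_sqrt_one)
qed

lemma norm_mat2_mult_le: "norm ((M :: complex^2^2) ** (N :: complex^2^2)) \<le> 8 * norm M * norm N"
proof -
  have entry: "norm (M $ i $ k * N $ k $ j) \<le> norm M * norm N" for i j k
    unfolding norm_mult
    using Finite_Cartesian_Product.norm_nth_le [of M i]
      Finite_Cartesian_Product.norm_nth_le [of "M $ i" k]
      Finite_Cartesian_Product.norm_nth_le [of N k]
      Finite_Cartesian_Product.norm_nth_le [of "N $ k" j]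
    by (intro mult_mono) auto
  have row: "norm ((M ** N) $ i $ j) \<le> 2 * norm M * norm N" for i j
    using norm_triangle_ineq [of "M $ i $ 1 * N $ 1 $ j" "M $ i $ 2 * N $ 2 $ j"]
      entry [of i 1 j] entry [of i 2 j]
    by (simp add: matrix_matrix_mult_def sum_2)
  have "norm ((M ** N) $ i) \<le> 4 * norm M * norm N" for i
    using norm_vec2_le [of "(M ** N) $ i"] row [of i 1] row [of i 2] by simp
  from this [of 1] this [of 2] norm_vec2_le [of "M ** N"] show ?thesis by simp
qed

lemma shift_iterate: "(shift \<tau> ^^ n) w = w + of_nat n *\<^sub>R \<tau>"
  by (induction n) (simp_all add: shift_def algebra_simps)

lemma cocycle_iter_Suc:
  "cocycle_iter \<tau> A (Suc n) w = A (w + of_nat n *\<^sub>R \<tau>) ** cocycle_iter \<tau> A n w"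
  by (simp add: shift_iterate)

declare cocycle_iter.simps(2) [simp del]

lemma det_cocycle_iter:
  assumes "\<And>w. det (A w) \<noteq> 0" shows "det (cocycle_iter \<tau> A n w) \<noteq> 0"
  by (induction n) (simp_all add: cocycle_iter_Suc det_mul assms)

lemma cocycle_iter_equivariant:
  assumes "\<And>w. A (w + e) ** U w = U (w + \<tau>) ** A w"
  shows "cocycle_iter \<tau> A n (w + e) ** U w = U (w + of_nat n *\<^sub>R \<tau>) ** cocycle_iter \<tau> A n w"
proof (induction n)
  case (Suc n)
  let ?v = "w + of_nat n *\<^sub>R \<tau>"
  have "cocycle_iter \<tau> A (Suc n) (w + e) ** U w = A (?v + e) ** (cocycle_iter \<tau> A n (w + e) ** U w)"
    by (simp add: cocycle_iter_Suc matrix_mul_assoc add_ac)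
  also have "\<dots> = (A (?v + e) ** U ?v) ** cocycle_iter \<tau> A n w"
    by (simp add: Suc matrix_mul_assoc)
  also have "\<dots> = U (?v + \<tau>) ** cocycle_iter \<tau> A (Suc n) w"
    by (simp add: assms cocycle_iter_Suc matrix_mul_assoc)
  finally show ?case by (simp add: algebra_simps)
qed simp

lemma cocycle_iter_line:
  assumes "\<And>w. (\<lambda>v. A w *v v) ` l w = l (w + \<tau>)"
  shows "(\<lambda>v. cocycle_iter \<tau> A n w *v v) ` l w = l (w + of_nat n *\<^sub>R \<tau>)"
proof (induction n)
  case (Suc n)
  have "(\<lambda>v. cocycle_iter \<tau> A (Suc n) w *v v) ` l w =
      (\<lambda>v. A (w + of_nat n *\<^sub>R \<tau>) *v v) ` (\<lambda>v. cocycle_iter \<tau> A n w *v v) ` l w"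
    by (simp add: cocycle_iter_Suc image_image matrix_vector_mul_assoc)
  also have "\<dots> = l (w + of_nat n *\<^sub>R \<tau> + \<tau>)" by (simp only: Suc assms)
  finally show ?case by (simp add: algebra_simps)
qed simp

lemma cocycle_iter_Lipschitz:
  assumes bdd: "\<And>w. norm (A w) \<le> K" and lip: "\<And>w w'. norm (A w' - A w) \<le> L * norm (w' - w)"
    and "L \<ge> 0"
  shows "\<exists>K' L'. L' \<ge> 0 \<and> (\<forall>w. norm (cocycle_iter \<tau> A n w) \<le> K') \<and>
    (\<forall>w w'. norm (cocycle_iter \<tau> A n w' - cocycle_iter \<tau> A n w) \<le> L' * norm (w' - w))"
proof (induction n)
  case 0
  then show ?case by (intro exI [of _ "norm (mat 1 :: complex^2^2)"] exI [of _ 0]) simp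
next
  case (Suc n)
  let ?B = "cocycle_iter \<tau> A n"
  obtain K' L' where L': "L' \<ge> 0" and K': "\<And>w. norm (?B w) \<le> K'"
    and lip': "\<And>w w'. norm (?B w' - ?B w) \<le> L' * norm (w' - w)" using Suc by blast
  have K0: "K \<ge> 0" "K' \<ge> 0"
    using bdd [of 0] K' [of 0] norm_ge_zero order_trans by blast+
  have "norm (cocycle_iter \<tau> A (Suc n) w) \<le> 8 * K * K'" for w
  proof -
    have "norm (cocycle_iter \<tau> A (Suc n) w) \<le> 8 * norm (A (w + of_nat n *\<^sub>R \<tau>)) * norm (?B w)"
      unfolding cocycle_iter_Suc by (rule norm_mat2_mult_le)
    also have "\<dots> \<le> 8 * K * K'" using bdd K' K0 by (intro mult_mono) auto
    finally show ?thesis .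
  qed
  moreover have "norm (cocycle_iter \<tau> A (Suc n) w' - cocycle_iter \<tau> A (Suc n) w)
      \<le> (8 * K * L' + 8 * L * K') * norm (w' - w)" for w w'
  proof -
    let ?A = "A (w + of_nat n *\<^sub>R \<tau>)" and ?A' = "A (w' + of_nat n *\<^sub>R \<tau>)"
    have "cocycle_iter \<tau> A (Suc n) w' - cocycle_iter \<tau> A (Suc n) w
        = ?A' ** (?B w' - ?B w) + (?A' - ?A) ** ?B w"
      by (simp add: cocycle_iter_Suc vec_eq_iff matrix_matrix_mult_def sum_2 algebra_simps)
    also have "norm \<dots> \<le> 8 * norm ?A' * norm (?B w' - ?B w) + 8 * norm (?A' - ?A) * norm (?B w)"
      by (rule norm_triangle_mono [OF norm_mat2_mult_le norm_mat2_mult_le])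
    also have "\<dots> \<le> 8 * K * (L' * norm (w' - w)) + 8 * (L * norm (w' - w)) * K'"
      using bdd lip' K' K0 L' \<open>L \<ge> 0\<close> lip [of "w' + of_nat n *\<^sub>R \<tau>" "w + of_nat n *\<^sub>R \<tau>"]
      by (intro add_mono mult_mono) auto
    finally show ?thesis by (simp add: algebra_simps)
  qed
  moreover have "8 * K * L' + 8 * L * K' \<ge> 0" using K0 L' \<open>L \<ge> 0\<close> by simp
  ultimately show ?case by blast
qed

lemma unit_vectors_of_line:
  assumes "L \<in> complex_lines"
  shows "{v \<in> L. norm v = 1} = (\<lambda>c. c *s unit_vec L) ` {c. norm c = 1}"
proof safe
  fix v assume "v \<in> L" "norm v = 1"
  then obtain c where "v = c *s unit_vec L" using unit_vec(2) [OF assms] by blast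
  moreover from this have "norm c = 1" using \<open>norm v = 1\<close> unit_vec(1) [OF assms] by (simp add: norm_scaled_vec)
  ultimately show "v \<in> (\<lambda>c. c *s unit_vec L) ` {c. norm c = 1}" by blast
next
  fix c :: complex
  show "c *s unit_vec L \<in> L" using unit_vec(2) [OF assms] by blast
  show "norm (c *s unit_vec L) = 1" if "norm c = 1"
    using that unit_vec(1) [OF assms] by (simp add: norm_scaled_vec)
qed

lemma matrix_mult_scaled: "M *v (c *s x) = c *s (M *v (x :: complex^2))"
  by (simp add: vec_eq_iff matrix_vector_mult_def sum_2 algebra_simps)

text \<open>
  Unit vectors of a line differ by phases, so supremum and infimum are over constant functions.
\<close>
lemma norms_restricted_unit_vec:
  assumes "L \<in> complex_lines"
  shows "norm_restricted M L = norm (M *v unit_vec L)"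
    and "conorm_restricted M L = norm (M *v unit_vec L)"
proof -
  have "\<exists>c. cmod c = 1" by (rule exI [of _ 1]) simp
  then have "(\<lambda>v. norm (M *v v)) ` {v \<in> L. norm v = 1} = {norm (M *v unit_vec L)}"
    unfolding unit_vectors_of_line [OF assms]
    by (auto simp: matrix_mult_scaled norm_scaled_vec image_iff)
  then show "norm_restricted M L = norm (M *v unit_vec L)"
    "conorm_restricted M L = norm (M *v unit_vec L)"
    by (simp_all add: norm_restricted_def conorm_restricted_def)
qed

lemma invariant_line_lines:
  assumes "invariant_line U1 U2 \<tau> A l" shows "l w \<in> complex_lines"
  using assms continuous_map_image_subset_topspace
  by (fastforce simp: invariant_line_def topspace_CP1_topology)

lemma line_image_unit_vec:
  assumes "l \<in> complex_lines" "l' \<in> complex_lines" and "(\<lambda>v. M *v v) ` l = l'"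
  obtains c where "M *v unit_vec l = c *s unit_vec l'"
  using assms unit_vec(2) by (metis (no_types, lifting) image_eqI rangeE rangeI vec.scale_one)

lemma norm_image_line:
  assumes "l \<in> complex_lines" "l' \<in> complex_lines" and "(\<lambda>v. U *v v) ` l = l'" and "unitary_mat U"
  obtains c where "norm c = 1" "unit_vec l' = c *s (U *v unit_vec l)"
proof -
  obtain c where c: "U *v unit_vec l = c *s unit_vec l'"
    using line_image_unit_vec assms by metis
  have "norm c = 1"
    using arg_cong [OF c, of norm] assms unit_vec(1) by (simp add: norm_unitary_mat norm_scaled_vec)
  moreover from this have "c \<noteq> 0" by auto
  then have "unit_vec l' = (1 / c) *s (U *v unit_vec l)" by (simp add: c)
  ultimately show ?thesis using that [of "1 / c"] by (simp add: norm_divide)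
qed

lemma continuous_on_matrix_mult:
  fixes f g :: "'a::topological_space \<Rightarrow> complex^2^2"
  assumes "continuous_on S f" "continuous_on S g"
  shows "continuous_on S (\<lambda>x. f x ** g x)"
  unfolding matrix_matrix_mult_def
  by (intro continuous_intros assms)

text \<open>
  The quantities \<open>|p|\<close> and \<open>\<Delta>\<close> of the preceding section do not see
  unitary changes of the fibre, so they are periodic functions, bounded below and uniformly continuous
  on the plane.
\<close>
theorem line_proj_Lipschitz:
  assumes adm: "strip_admissible U1 U2 \<tau> A" and dom: "dominated_splitting U1 U2 \<tau> A ls lu"
    and l: "l \<in> {ls, lu}"
  shows "\<exists>K. K-lipschitz_on UNIV (\<lambda>w. line_proj (l w))"
proof -
  have sew: "sewing_system U1 U2" and eq: "equivariant_cocycle U1 U2 \<tau> A"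
    using adm by (auto simp: strip_admissible_def)
  have unit: "unitary_mat (U1 w)" "unitary_mat (U2 w)" for w using sew by (auto simp: sewing_system_def)
  have inv: "invariant_line U1 U2 \<tau> A ls" "invariant_line U1 U2 \<tau> A lu" and neq: "\<And>w. ls w \<noteq> lu w"
    using dom by (auto simp: dominated_splitting_def)
  obtain N \<kappa> where \<kappa>: "0 < \<kappa>" "\<kappa> < 1"
    and ratio: "\<And>z. norm_restricted (cocycle_iter \<tau> A N z) (ls z)
               / conorm_restricted (cocycle_iter \<tau> A N z) (lu z) \<le> \<kappa>\<^sup>2"
    using dom by (auto simp: dominated_splitting_def)
  define B where "B = cocycle_iter \<tau> A N"
  define a where "a = of_nat N *\<^sub>R \<tau>"
  obtain K L where K: "\<And>w. norm (A w) \<le> K" and "L-lipschitz_on UNIV A"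
    using adm extends_to_strip_imp_bounded_Lipschitz by (meson strip_admissible_def)
  then have "L \<ge> 0" "\<And>w w'. norm (A w' - A w) \<le> L * norm (w' - w)"
    using lipschitz_on_nonneg by (auto simp: lipschitz_on_def dist_norm)
  from cocycle_iter_Lipschitz [OF K this(2,1), of \<tau> N] obtain L' where L': "L' \<ge> 0"
    and lip: "\<And>w w'. norm (B w' - B w) \<le> L' * norm (w' - w)" unfolding B_def by blast
  have contB: "continuous_on UNIV B"
    by (rule lipschitz_on_continuous_on [of L']) (auto simp: lipschitz_on_def dist_norm L' lip norm_minus_commute)
  have detB: "det (B w) \<noteq> 0" for w
    unfolding B_def by (rule det_cocycle_iter) (use eq in \<open>simp add: equivariant_cocycle_def\<close>)
  have equiv: "B (w + e1) ** U1 w = U1 (w + a) ** B w" "B (w + e2) ** U2 w = U2 (w + a) ** B w" for w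
    using eq unfolding B_def a_def equivariant_cocycle_def shift_def
    by (auto intro!: cocycle_iter_equivariant)
  have lines: "ls w \<in> complex_lines" "lu w \<in> complex_lines" for w
    using inv invariant_line_lines by blast+
  define s t where "s = (\<lambda>w. unit_vec (lu w))" and "t = (\<lambda>w. unit_vec (ls w))"
  have s1: "norm (s w) = 1" and t1: "norm (t w) = 1" for w
    using unit_vec(1) lines by (auto simp: s_def t_def)
  have "\<exists>c. B w *v s w = c *s s (w + a)" for w
  proof -
    have "(\<lambda>v. B w *v v) ` lu w = lu (w + a)"
      unfolding B_def a_def using inv(2) by (intro cocycle_iter_line) (auto simp: invariant_line_def shift_def)
    then show ?thesis unfolding s_def using line_image_unit_vec lines by metis
  qed
  then obtain p where p: "\<And>w. B w *v s w = p w *s s (w + a)" by metis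
  have "\<exists>c. B w *v t w = c *s t (w + a)" for w
  proof -
    have "(\<lambda>v. B w *v v) ` ls w = ls (w + a)"
      unfolding B_def a_def using inv(1) by (intro cocycle_iter_line) (auto simp: invariant_line_def shift_def)
    then show ?thesis unfolding t_def using line_image_unit_vec lines by metis
  qed
  then obtain q where q: "\<And>w. B w *v t w = q w *s t (w + a)" by metis
  have wedge_pos: "wedge (s w) (t w) \<noteq> 0" for w
  proof
    assume 0: "wedge (s w) (t w) = 0"
    then have "line_proj (ls w) = line_proj (lu w)"
      using norm_outer_diff_le_wedge [OF s1 t1, of w w] by (simp add: line_proj_def s_def t_def)
    then show False
      using neq [of w] line_proj_in line_proj_fixes lines by (metis subsetI subset_antisym)
  qed
  have pq: "p w \<noteq> 0 \<and> q w \<noteq> 0" for w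
  proof -
    have "p w * q w * wedge (s (w + a)) (t (w + a)) = det (B w) * wedge (s w) (t w)"
      by (simp add: p q wedge_scale flip: wedge_matrix)
    then show ?thesis using detB wedge_pos by fastforce
  qed
  have np: "norm (p w) = norm (B w *v s w)" and nq: "norm (q w) = norm (B w *v t w)" for w
    by (simp_all add: p q norm_scaled_vec s1 t1)
  have dom': "norm (q w) \<le> \<kappa>\<^sup>2 * norm (p w)" for w
  proof -
    have "norm (q w) / norm (p w) \<le> \<kappa>\<^sup>2"
      using ratio [of w] unfolding norms_restricted_unit_vec(1) [OF lines(1)]
        norms_restricted_unit_vec(2) [OF lines(2)] np nq B_def s_def t_def .
    then show ?thesis using pq [of w] by (simp add: pos_divide_le_eq)
  qed
  have perL: "\<exists>c. norm c = 1 \<and> unit_vec (l (w + e)) = c *s (U w *v unit_vec (l w))"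
    if "(U, e) = (U1, e1) \<or> (U, e) = (U2, e2)" "l = ls \<or> l = lu" for U e w l
  proof -
    have "(\<lambda>v. U w *v v) ` l w = l (w + e)"
      using that inv by (auto simp: invariant_line_def)
    moreover have "unitary_mat (U w)" using that unit by auto
    ultimately show ?thesis using that(2) lines norm_image_line by metis
  qed
  have per: "norm (p (w + e)) = norm (p w) \<and> norm (wedge (s (w + e)) (t (w + e))) = norm (wedge (s w) (t w))"
    if Ue: "(U, e) = (U1, e1) \<or> (U, e) = (U2, e2)" for U e w
  proof -
    obtain c d where c: "norm c = 1" "s (w + e) = c *s (U w *v s w)"
      and d: "norm d = 1" "t (w + e) = d *s (U w *v t w)"
      using perL [OF Ue, of lu] perL [OF Ue, of ls] unfolding s_def t_def by metis
    have U: "unitary_mat (U v)" for v using Ue unit by auto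
    have "B (w + e) ** U w = U (w + a) ** B w" using Ue equiv by auto
    then have "B (w + e) *v s (w + e) = c *s (U (w + a) *v (B w *v s w))"
      by (simp add: c matrix_mult_scaled matrix_vector_mul_assoc)
    then have "norm (p (w + e)) = norm (p w)" by (simp add: np norm_scaled_vec c norm_unitary_mat U)
    moreover have "norm (wedge (s (w + e)) (t (w + e))) = norm (wedge (s w) (t w))"
      by (simp add: c d wedge_scale wedge_matrix norm_mult norm_det_unitary_mat U)
    ultimately show ?thesis by blast
  qed
  have contP: "continuous_on UNIV (\<lambda>w. line_proj (lu w))" "continuous_on UNIV (\<lambda>w. line_proj (ls w))"
    using inv by (auto simp: invariant_line_def intro: continuous_on_line_proj)
  have "norm (p w) = norm (B w ** line_proj (lu w))" for w
    using s1 [of w] by (simp add: np line_proj_def matrix_mult_outer norm_outer s_def)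
  then have contp: "continuous_on UNIV (\<lambda>w. norm (p w))"
    by (simp add: continuous_on_norm continuous_on_matrix_mult contB contP)
  \<comment> \<open>Expressing the angle through the two projections shows that it is continuous although
    \<open>s\<close> and \<open>t\<close> need not be.\<close>
  have "norm (wedge (s w) (t w)) = norm (transpose (line_proj (lu w)) **
      (\<chi> i j. if i = j then 0 else if i = 1 then 1 else - 1) ** line_proj (ls w))" for w
  proof -
    have "transpose (line_proj (lu w)) ** (\<chi> i j. if i = j then 0 else if i = 1 then 1 else - 1) ** line_proj (ls w)
      = outer (\<chi> i. wedge (s w) (t w) * cnj (s w $ i)) (t w)"
      by (simp add: vec_eq_iff forall_2 line_proj_def outer_def transpose_def matrix_matrix_mult_def sum_2
          wedge_def s_def t_def algebra_simps)
    moreover have "norm (\<chi> i. wedge (s w) (t w) * cnj (s w $ i)) = norm (wedge (s w) (t w)) * norm (s w)"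
      by (simp add: norm_vec_def norm_mult L2_set_right_distrib)
    ultimately show ?thesis by (simp add: norm_outer s1 t1)
  qed
  then have contw: "continuous_on UNIV (\<lambda>w. norm (wedge (s w) (t w)))"
    by (simp add: transpose_def continuous_on_norm continuous_on_matrix_mult contP continuous_on_vec_lambda
        continuous_on_component continuous_on_const)
  obtain p0 where p0: "p0 > 0" "\<And>w. norm (p w) \<ge> p0"
    using periodic_continuous_pos_imp_bounded_below [OF contp] per pq by (metis zero_less_norm_iff)
  obtain \<Delta>0 where \<Delta>0: "\<Delta>0 > 0" "\<And>w. norm (wedge (s w) (t w)) \<ge> \<Delta>0"
    using periodic_continuous_pos_imp_bounded_below [OF contw] per wedge_pos by (metis zero_less_norm_iff)
  have "(1 - \<kappa>) * p0 > 0" using \<kappa> p0 by simp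
  then obtain \<delta> where \<delta>: "\<delta> > 0" "\<And>w w'. norm (w' - w) \<le> \<delta> \<Longrightarrow> \<bar>norm (p w') - norm (p w)\<bar> < (1 - \<kappa>) * p0"
    using periodic_continuous_imp_uniformly_continuous [OF contp] per by metis
  note K = dominated_lines_wedge_Lipschitz [OF s1 t1 p q dom' \<kappa> _ p0 \<Delta>0 lip L' \<delta>]
  have "\<exists>K \<ge> 0. \<forall>w w'. norm (wedge (unit_vec (l w)) (unit_vec (l w'))) \<le> K * norm (w' - w)"
    using l K pq unfolding s_def t_def by auto
  then obtain K where K: "K \<ge> 0"
    "\<And>w w'. norm (wedge (unit_vec (l w)) (unit_vec (l w'))) \<le> K * norm (w' - w)" by blast
  have "(8 * K)-lipschitz_on UNIV (\<lambda>w. line_proj (l w))"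
  proof (rule lipschitz_onI)
    fix w w' :: "real^2"
    have l1: "norm (unit_vec (l v)) = 1" for v using l lines unit_vec(1) by auto
    have "norm (line_proj (l w) - line_proj (l w')) \<le> 8 * norm (wedge (unit_vec (l w')) (unit_vec (l w)))"
      unfolding line_proj_def by (rule norm_outer_diff_le_wedge [OF l1 l1])
    also have "\<dots> \<le> 8 * (K * norm (w - w'))" using K by (intro mult_left_mono) auto
    finally show "dist (line_proj (l w)) (line_proj (l w')) \<le> 8 * K * dist w w'" by (simp add: dist_norm)
  qed (use K in simp)
  then show ?thesis by blast
qed

section \<open>Locally Lipschitz functions and frames\<close>

text \<open>
  Lipschitz on bounded sets. A frame of a line field of nonzero degree is in general not uniformly
  Lipschitz on the plane, since the curl of its connection form has nonzero mean.
\<close>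
definition ball_Lipschitz :: "(real^2 \<Rightarrow> 'b::metric_space) \<Rightarrow> bool" where
  "ball_Lipschitz f \<longleftrightarrow> (\<forall>R. \<exists>L. L-lipschitz_on (cball 0 R) f)"

lemma ball_LipschitzE:
  assumes "ball_Lipschitz f"
  obtains L where "L \<ge> 0" "\<And>x y. \<lbrakk>norm x \<le> R; norm y \<le> R\<rbrakk> \<Longrightarrow> dist (f x) (f y) \<le> L * norm (x - y)"
proof -
  obtain L where "L-lipschitz_on (cball 0 R) f" using assms unfolding ball_Lipschitz_def by blast
  then show ?thesis using that [of L] unfolding lipschitz_on_def by (simp add: dist_norm)
qed

lemma ball_LipschitzI:
  assumes "\<And>R. \<exists>L. \<forall>x y. norm x \<le> R \<longrightarrow> norm y \<le> R \<longrightarrow> dist (f x) (f y) \<le> L * norm (x - y)"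
  shows "ball_Lipschitz f"
  unfolding ball_Lipschitz_def
proof
  fix R
  obtain L where L: "\<And>x y. norm x \<le> R \<Longrightarrow> norm y \<le> R \<Longrightarrow> dist (f x) (f y) \<le> L * norm (x - y)"
    using assms [of R] by blast
  have "dist (f x) (f y) \<le> max L 0 * dist x y" if "norm x \<le> R" "norm y \<le> R" for x y
    using L [OF that] mult_right_mono [of L "max L 0" "norm (x - y)"] by (simp add: dist_norm)
  then have "(max L 0)-lipschitz_on (cball 0 R) f" by (intro lipschitz_onI) auto
  then show "\<exists>L. L-lipschitz_on (cball 0 R) f" by blast
qed

lemma ball_Lipschitz_const: "ball_Lipschitz (\<lambda>w. c)"
  by (rule ball_LipschitzI) (auto intro: exI [of _ 0])

lemma Lipschitz_imp_ball_Lipschitz: "K-lipschitz_on UNIV f \<Longrightarrow> ball_Lipschitz f"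
  unfolding ball_Lipschitz_def using lipschitz_on_subset by blast

lemma ball_Lipschitz_imp_continuous:
  assumes "ball_Lipschitz f" shows "continuous_on UNIV f"
proof -
  have "isCont f x" for x
  proof -
    obtain L where "L-lipschitz_on (cball 0 (norm x + 1)) f"
      using assms unfolding ball_Lipschitz_def by blast
    then have "continuous_on (ball 0 (norm x + 1)) f"
      using lipschitz_on_continuous_on continuous_on_subset ball_subset_cball by blast
    then show ?thesis by (simp add: continuous_on_eq_continuous_at)
  qed
  then show ?thesis by (simp add: continuous_on_eq_continuous_at)
qed

lemma ball_Lipschitz_bounded:
  fixes f :: "real^2 \<Rightarrow> 'b::real_normed_vector"
  assumes "ball_Lipschitz f"
  obtains M where "M \<ge> 0" "\<And>x. norm x \<le> R \<Longrightarrow> norm (f x) \<le> M"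
proof -
  have "compact (f ` cball 0 R)"
    by (intro compact_continuous_image continuous_on_subset [OF ball_Lipschitz_imp_continuous [OF assms]]) auto
  then obtain M where M: "\<forall>x \<in> cball 0 R. norm (f x) \<le> M"
    using compact_imp_bounded bounded_iff by (metis imageI)
  then show ?thesis using that [of "max M 0"] by (simp add: le_max_iff_disj)
qed

lemma ball_Lipschitz_add:
  fixes f g :: "real^2 \<Rightarrow> 'b::real_normed_vector"
  assumes "ball_Lipschitz f" "ball_Lipschitz g" shows "ball_Lipschitz (\<lambda>w. f w + g w)"
  using assms lipschitz_on_add unfolding ball_Lipschitz_def by blast

lemma ball_Lipschitz_bounded_linear:
  assumes "bounded_linear h" "ball_Lipschitz f" shows "ball_Lipschitz (\<lambda>w. h (f w))"
proof (rule ball_LipschitzI)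
  fix R
  obtain L where L: "\<And>x y. \<lbrakk>norm x \<le> R; norm y \<le> R\<rbrakk> \<Longrightarrow> dist (f x) (f y) \<le> L * norm (x - y)"
    using ball_LipschitzE [OF assms(2)] by metis
  obtain K where K: "K > 0" "\<And>x. norm (h x) \<le> norm x * K" using bounded_linear.pos_bounded [OF assms(1)] by blast
  have "dist (h (f x)) (h (f y)) \<le> (L * K) * norm (x - y)" if "norm x \<le> R" "norm y \<le> R" for x y
  proof -
    have "dist (h (f x)) (h (f y)) \<le> dist (f x) (f y) * K"
      using K(2) [of "f x - f y"] bounded_linear.linear [OF assms(1)] by (simp add: dist_norm linear_diff)
    also have "\<dots> \<le> L * norm (x - y) * K" using L [OF that] K by (intro mult_right_mono) auto
    finally show ?thesis by (simp add: mult_ac)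
  qed
  then show "\<exists>L. \<forall>x y. norm x \<le> R \<longrightarrow> norm y \<le> R \<longrightarrow> dist (h (f x)) (h (f y)) \<le> L * norm (x - y)" by blast
qed

lemma ball_Lipschitz_bilinear:
  fixes f :: "real^2 \<Rightarrow> 'b::real_normed_vector" and g :: "real^2 \<Rightarrow> 'c::real_normed_vector"
  assumes "bounded_bilinear pr" and f: "ball_Lipschitz f" and g: "ball_Lipschitz g"
  shows "ball_Lipschitz (\<lambda>w. pr (f w) (g w))"
proof (rule ball_LipschitzI)
  fix R
  interpret bounded_bilinear pr by fact
  obtain Lf where Lf: "Lf \<ge> 0" "\<And>x y. \<lbrakk>norm x \<le> R; norm y \<le> R\<rbrakk> \<Longrightarrow> dist (f x) (f y) \<le> Lf * norm (x - y)"
    by (rule ball_LipschitzE [OF f, where R = R]) (rule that, assumption+)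
  obtain Lg where Lg: "Lg \<ge> 0" "\<And>x y. \<lbrakk>norm x \<le> R; norm y \<le> R\<rbrakk> \<Longrightarrow> dist (g x) (g y) \<le> Lg * norm (x - y)"
    by (rule ball_LipschitzE [OF g, where R = R]) (rule that, assumption+)
  obtain Mf where Mf: "Mf \<ge> 0" "\<And>x. norm x \<le> R \<Longrightarrow> norm (f x) \<le> Mf" by (rule ball_Lipschitz_bounded [OF f, where R = R]) (rule that, assumption+)
  obtain Mg where Mg: "Mg \<ge> 0" "\<And>x. norm x \<le> R \<Longrightarrow> norm (g x) \<le> Mg" by (rule ball_Lipschitz_bounded [OF g, where R = R]) (rule that, assumption+)
  obtain K where K: "K > 0" "\<And>a b. norm (pr a b) \<le> norm a * norm b * K" using pos_bounded by blast
  have "dist (pr (f x) (g x)) (pr (f y) (g y)) \<le> ((Mf * Lg + Lf * Mg) * K) * norm (x - y)"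
    if x: "norm x \<le> R" and y: "norm y \<le> R" for x y
  proof -
    have "pr (f x) (g x) - pr (f y) (g y) = pr (f x) (g x - g y) + pr (f x - f y) (g y)"
      by (simp add: diff_left diff_right)
    then have "dist (pr (f x) (g x)) (pr (f y) (g y))
        \<le> norm (f x) * norm (g x - g y) * K + norm (f x - f y) * norm (g y) * K"
      unfolding dist_norm using norm_triangle_mono [OF K(2) K(2)] by metis
    also have "\<dots> \<le> Mf * (Lg * norm (x - y)) * K + (Lf * norm (x - y)) * Mg * K"
      using Lf(2) [OF x y] Lg(2) [OF x y] Mf(2) [OF x] Mg(2) [OF y] Mf(1) Mg(1) Lf(1) Lg(1) K(1)
      by (intro add_mono mult_right_mono mult_mono) (auto simp: dist_norm)
    finally show ?thesis by (simp add: algebra_simps)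
  qed
  then show "\<exists>L. \<forall>x y. norm x \<le> R \<longrightarrow> norm y \<le> R \<longrightarrow>
      dist (pr (f x) (g x)) (pr (f y) (g y)) \<le> L * norm (x - y)" by blast
qed

lemmas ball_Lipschitz_mult = ball_Lipschitz_bilinear [OF bounded_bilinear_mult]

lemma ball_Lipschitz_minus:
  fixes f :: "real^2 \<Rightarrow> 'b::real_normed_vector"
  shows "ball_Lipschitz f \<Longrightarrow> ball_Lipschitz (\<lambda>w. - f w)"
  by (rule ball_Lipschitz_bounded_linear [OF bounded_linear_minus [OF bounded_linear_ident]])

lemma ball_Lipschitz_diff:
  fixes f g :: "real^2 \<Rightarrow> 'b::real_normed_vector"
  assumes "ball_Lipschitz f" "ball_Lipschitz g" shows "ball_Lipschitz (\<lambda>w. f w - g w)"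
  using ball_Lipschitz_add [OF assms(1) ball_Lipschitz_minus [OF assms(2)]] by simp

lemma ball_Lipschitz_sum:
  fixes f :: "'i \<Rightarrow> real^2 \<Rightarrow> 'b::real_normed_vector"
  assumes "\<And>i. i \<in> I \<Longrightarrow> ball_Lipschitz (f i)" shows "ball_Lipschitz (\<lambda>w. \<Sum>i\<in>I. f i w)"
  using assms
  by (induction I rule: infinite_finite_induct) (auto intro: ball_Lipschitz_const ball_Lipschitz_add)

lemma ball_Lipschitz_compose:
  assumes f: "ball_Lipschitz f" and g: "ball_Lipschitz g"
  shows "ball_Lipschitz (\<lambda>w. f (g w))"
proof (rule ball_LipschitzI)
  fix R
  obtain M where M: "M \<ge> 0" "\<And>x. norm x \<le> R \<Longrightarrow> norm (g x) \<le> M" by (rule ball_Lipschitz_bounded [OF g, where R = R]) (rule that, assumption+)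
  obtain Lf where Lf: "Lf \<ge> 0" "\<And>x y. \<lbrakk>norm x \<le> M; norm y \<le> M\<rbrakk> \<Longrightarrow> dist (f x) (f y) \<le> Lf * norm (x - y)"
    by (rule ball_LipschitzE [OF f, where R = M]) (rule that, assumption+)
  obtain Lg where Lg: "\<And>x y. \<lbrakk>norm x \<le> R; norm y \<le> R\<rbrakk> \<Longrightarrow> dist (g x) (g y) \<le> Lg * norm (x - y)"
    using ball_LipschitzE [OF g] by metis
  have "dist (f (g x)) (f (g y)) \<le> (Lf * Lg) * norm (x - y)" if "norm x \<le> R" "norm y \<le> R" for x y
  proof -
    have "dist (f (g x)) (f (g y)) \<le> Lf * norm (g x - g y)" using M(2) that by (intro Lf(2)) auto
    also have "\<dots> \<le> Lf * (Lg * norm (x - y))" using Lg [OF that] Lf(1) by (intro mult_left_mono) (auto simp: dist_norm)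
    finally show ?thesis by simp
  qed
  then show "\<exists>L. \<forall>x y. norm x \<le> R \<longrightarrow> norm y \<le> R \<longrightarrow> dist (f (g x)) (f (g y)) \<le> L * norm (x - y)" by blast
qed

lemma ball_Lipschitz_ident: "ball_Lipschitz (\<lambda>w. w)"
  by (rule ball_LipschitzI) (auto simp: dist_norm intro: exI [of _ 1])

lemma ball_Lipschitz_translate:
  assumes "ball_Lipschitz f" shows "ball_Lipschitz (\<lambda>w. f (w + a))"
  by (rule ball_Lipschitz_compose [OF assms ball_Lipschitz_add [OF ball_Lipschitz_ident ball_Lipschitz_const]])

lemma ball_Lipschitz_component:
  fixes f :: "real^2 \<Rightarrow> 'b::real_normed_vector^'n"
  shows "ball_Lipschitz f \<Longrightarrow> ball_Lipschitz (\<lambda>w. f w $ i)"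
  by (rule ball_Lipschitz_bounded_linear [OF bounded_linear_vec_nth])

lemma ball_Lipschitz_bounded_below:
  fixes f :: "real^2 \<Rightarrow> 'b::real_normed_vector"
  assumes "ball_Lipschitz f" and "\<And>w. f w \<noteq> 0"
  obtains m where "m > 0" "\<And>x. norm x \<le> R \<Longrightarrow> norm (f x) \<ge> m"
proof (cases "R \<ge> 0")
  case True
  have "continuous_on (cball 0 R) (\<lambda>w. norm (f w))"
    by (intro continuous_intros continuous_on_subset [OF ball_Lipschitz_imp_continuous [OF assms(1)]]) auto
  then obtain x where "\<forall>y \<in> cball 0 R. norm (f x) \<le> norm (f y)"
    using continuous_attains_inf [of "cball (0::real^2) R" "\<lambda>w. norm (f w)"] True by auto
  then show ?thesis using that [of "norm (f x)"] assms(2) by auto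
next
  case False
  then have "\<not> norm x \<le> R" for x :: "real^2" using norm_ge_zero [of x] by linarith
  then show ?thesis using that [of 1] by auto
qed

lemma ball_Lipschitz_normalize:
  fixes s :: "real^2 \<Rightarrow> 'b::real_normed_vector"
  assumes s: "ball_Lipschitz s" and nz: "\<And>w. s w \<noteq> 0"
  shows "ball_Lipschitz (\<lambda>w. (1 / norm (s w)) *\<^sub>R s w)"
proof (rule ball_Lipschitz_bilinear [OF bounded_bilinear_scaleR _ s], rule ball_LipschitzI)
  fix R
  obtain L where L: "L \<ge> 0" "\<And>x y. \<lbrakk>norm x \<le> R; norm y \<le> R\<rbrakk> \<Longrightarrow> dist (s x) (s y) \<le> L * norm (x - y)"
    by (rule ball_LipschitzE [OF s, where R = R]) (rule that, assumption+)
  obtain m where m: "m > 0" "\<And>x. norm x \<le> R \<Longrightarrow> norm (s x) \<ge> m"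
    by (rule ball_Lipschitz_bounded_below [OF s nz, where R = R]) (rule that, assumption+)
  have "dist (1 / norm (s x)) (1 / norm (s y)) \<le> (L / (m * m)) * norm (x - y)"
    if x: "norm x \<le> R" and y: "norm y \<le> R" for x y
  proof -
    have "dist (1 / norm (s x)) (1 / norm (s y)) = \<bar>norm (s y) - norm (s x)\<bar> / (norm (s x) * norm (s y))"
      using nz by (simp add: dist_real_def abs_mult abs_divide divide_simps flip: abs_divide) (simp add: abs_divide)
    also have "\<dots> \<le> (L * norm (x - y)) / (m * m)"
      using m(1) m(2) [OF x] m(2) [OF y] L(2) [OF x y] norm_triangle_ineq3 [of "s y" "s x"]
      by (intro frac_le mult_mono) (auto simp: dist_norm norm_minus_commute)
    finally show ?thesis by simp
  qed
  then show "\<exists>L. \<forall>x y. norm x \<le> R \<longrightarrow> norm y \<le> R \<longrightarrow>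
      dist (1 / norm (s x)) (1 / norm (s y)) \<le> L * norm (x - y)" by blast
qed

text \<open>
  At nearby points the principal logarithm of the quotient \<open>f x / f y\<close> is the difference
  \<open>g x - g y\<close>; for distant points boundedness of \<open>g\<close> suffices.
\<close>
lemma ball_Lipschitz_logarithm:
  fixes f g :: "real^2 \<Rightarrow> complex"
  assumes f: "ball_Lipschitz f" and g: "continuous_on UNIV g" and fg: "\<And>w. f w = exp (g w)"
  shows "ball_Lipschitz g"
proof (rule ball_LipschitzI)
  fix R
  obtain L where L: "L \<ge> 0" "\<And>x y. \<lbrakk>norm x \<le> R; norm y \<le> R\<rbrakk> \<Longrightarrow> dist (f x) (f y) \<le> L * norm (x - y)"
    by (rule ball_LipschitzE [OF f, where R = R]) (rule that, assumption+)
  obtain m where m: "m > 0" "\<And>x. norm x \<le> R \<Longrightarrow> norm (f x) \<ge> m"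
    by (rule ball_Lipschitz_bounded_below [OF f, where R = R]) (simp add: fg, rule that, assumption+)
  have contg: "continuous_on (cball 0 R) g" by (rule continuous_on_subset [OF g subset_UNIV])
  have "uniformly_continuous_on (cball 0 R) g"
    by (rule compact_uniformly_continuous [OF contg compact_cball])
  then have "\<exists>\<delta>>0. \<forall>x\<in>cball 0 R. \<forall>x'\<in>cball 0 R. dist x' x < \<delta> \<longrightarrow> dist (g x') (g x) < 1"
    unfolding uniformly_continuous_on_def by (elim allE [of _ 1]) simp
  then obtain \<delta> where \<delta>: "\<delta> > 0"
    "\<And>x y. \<lbrakk>norm x \<le> R; norm y \<le> R; norm (x - y) < \<delta>\<rbrakk> \<Longrightarrow> norm (g x - g y) < 1"
    by (auto simp: dist_norm)
  have "compact (g ` cball 0 R)" by (intro compact_continuous_image contg compact_cball)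
  then obtain G where "\<forall>x\<in>cball 0 R. norm (g x) \<le> G"
    using compact_imp_bounded [of "g ` cball 0 R"] by (auto simp: bounded_iff)
  then have G: "norm (g x) \<le> G" if "norm x \<le> R" for x using that by simp
  \<comment> \<open>Within this distance \<open>f x / f y\<close> is within \<open>1/4\<close> of
    \<open>1\<close>, and \<open>g x - g y\<close> lies in the strip where the logarithm inverts
    the exponential function.\<close>
  define \<epsilon> where "\<epsilon> = min \<delta> (m / (4 * (L + 1)))"
  have \<epsilon>: "\<epsilon> > 0" using \<delta> m L by (simp add: \<epsilon>_def)
  have "norm (g x - g y) \<le> max (2 * L / m) (2 * G / \<epsilon>) * norm (x - y)"
    if x: "norm x \<le> R" and y: "norm y \<le> R" for x y
  proof (cases "norm (x - y) < \<epsilon>")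
    case True
    define z where "z = f x / f y - 1"
    have fy: "norm (f y) \<ge> m" "f y \<noteq> 0" using m y by (auto simp: fg)
    have "norm z = norm (f x - f y) / norm (f y)"
      using fy by (simp add: z_def diff_divide_distrib flip: norm_divide)
    also have "\<dots> \<le> L * norm (x - y) / m"
      using L(1) L(2) [OF x y] m(1) fy(1) by (intro frac_le) (auto simp: dist_norm)
    finally have z: "norm z \<le> L * norm (x - y) / m" .
    also have "\<dots> \<le> (L + 1) * (m / (4 * (L + 1))) / m"
      using True L(1) m(1) by (intro divide_right_mono mult_mono) (auto simp: \<epsilon>_def)
    also have "\<dots> = 1 / 4"
    proof -
      have "L + 1 \<noteq> 0" using L(1) by linarith
      then show ?thesis using m(1) by simp
    qed
    finally have "norm (Ln (1 + z)) \<le> 2 * norm z" by (intro norm_Ln_le) simp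
    moreover have "Ln (1 + z) = g x - g y"
    proof -
      have "norm (g x - g y) < 1" using True x y by (intro \<delta>(2)) (auto simp: \<epsilon>_def)
      then have "\<bar>Im (g x - g y)\<bar> < 1" using abs_Im_le_cmod le_less_trans by blast
      then have "Ln (exp (g x - g y)) = g x - g y" using pi_gt3 by (intro Ln_exp) auto
      then show ?thesis by (simp add: z_def fg exp_diff)
    qed
    ultimately have "norm (g x - g y) \<le> 2 * L / m * norm (x - y)" using z by simp
    also have "\<dots> \<le> max (2 * L / m) (2 * G / \<epsilon>) * norm (x - y)" by (intro mult_right_mono) auto
    finally show ?thesis .
  next
    case False
    have "norm (g x - g y) \<le> 2 * G" using G [OF x] G [OF y] norm_triangle_ineq4 [of "g x" "g y"] by linarith
    also have "\<dots> = 2 * G / \<epsilon> * \<epsilon>" using \<epsilon> by simp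
    also have "\<dots> \<le> max (2 * L / m) (2 * G / \<epsilon>) * norm (x - y)"
      using False \<epsilon> L(1) m(1) by (intro mult_mono) (auto simp: le_max_iff_disj)
    finally show ?thesis .
  qed
  then show "\<exists>L. \<forall>x y. norm x \<le> R \<longrightarrow> norm y \<le> R \<longrightarrow> dist (g x) (g y) \<le> L * norm (x - y)"
    unfolding dist_norm by blast
qed

text \<open>
  A common device for the two constructions below: on every ball the sequence is eventually constant,
  so the limit inherits its local properties.
\<close>
lemma stabilizing_ball_Lipschitz_limit:
  assumes "r > 0" and lip: "\<And>k. ball_Lipschitz (S k)"
    and stable: "\<And>k w. norm w \<le> r * of_nat k \<Longrightarrow> S (Suc k) w = S k w"
  obtains s where "ball_Lipschitz s" "\<And>k w. norm w \<le> r * of_nat k \<Longrightarrow> s w = S k w"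
proof
  define N where "N = (\<lambda>w :: real^2. nat \<lceil>norm w / r\<rceil>)"
  have N: "norm w \<le> r * of_nat (N w)" for w
  proof -
    have "norm w / r \<le> of_nat (N w)" unfolding N_def by (rule real_nat_ceiling_ge)
    then show ?thesis using \<open>r > 0\<close> by (simp add: pos_divide_le_eq mult.commute)
  qed
  have later: "S (k + j) w = S k w" if "norm w \<le> r * of_nat k" for k j w
  proof (induction j)
    case (Suc j)
    have "norm w \<le> r * of_nat (k + j)"
      using \<open>r > 0\<close> by (intro order_trans [OF that] mult_left_mono) auto
    then show ?case using stable Suc by simp
  qed simp
  show eq: "S (N w) w = S k w" if "norm w \<le> r * of_nat k" for k w
  proof (cases "N w \<le> k")
    case True
    then show ?thesis using later [OF N, of w "k - N w"] by simp
  next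
    case False
    then show ?thesis using later [OF that, of "N w - k"] by simp
  qed
  show "ball_Lipschitz (\<lambda>w. S (N w) w)"
  proof (rule ball_LipschitzI)
    fix R :: real
    define k where "k = nat \<lceil>R / r\<rceil>"
    have "R / r \<le> of_nat k" unfolding k_def by (rule real_nat_ceiling_ge)
    then have k: "R \<le> r * of_nat k" using \<open>r > 0\<close> by (simp add: pos_divide_le_eq mult.commute)
    obtain L where L: "\<And>x y. \<lbrakk>norm x \<le> R; norm y \<le> R\<rbrakk> \<Longrightarrow> dist (S k x) (S k y) \<le> L * norm (x - y)"
      using ball_LipschitzE [OF lip] by metis
    have "S (N x) x = S k x" if "norm x \<le> R" for x
      using that k by (intro eq) auto
    then show "\<exists>L. \<forall>x y. norm x \<le> R \<longrightarrow> norm y \<le> R \<longrightarrow> dist (S (N x) x) (S (N y) y) \<le> L * norm (x - y)"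
      using L by auto
  qed
qed

lemma ball_Lipschitz_clamp:
  "ball_Lipschitz (\<lambda>w. max a (min b ((w :: real^2) $ i)) :: real)"
proof (rule ball_LipschitzI, intro exI [of _ 1] allI impI)
  fix R and x y :: "real^2"
  have "\<bar>max a (min b (x $ i)) - max a (min b (y $ i))\<bar> \<le> \<bar>(x - y) $ i\<bar>" by (simp; linarith)
  also have "\<dots> \<le> norm (x - y)" by (rule component_le_norm_cart)
  finally show "dist (max a (min b (x $ i))) (max a (min b (y $ i))) \<le> 1 * norm (x - y)"
    by (simp add: dist_real_def)
qed

lemma ball_Lipschitz_vec2:
  fixes f :: "real^2 \<Rightarrow> 'b::real_normed_vector^2"
  assumes "\<And>i. ball_Lipschitz (\<lambda>w. f w $ i)"
  shows "ball_Lipschitz f"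
proof (rule ball_LipschitzI)
  fix R
  obtain L1 where L1: "\<And>x y. \<lbrakk>norm x \<le> R; norm y \<le> R\<rbrakk> \<Longrightarrow> dist (f x $ 1) (f y $ 1) \<le> L1 * norm (x - y)"
    using ball_LipschitzE [OF assms] by metis
  obtain L2 where L2: "\<And>x y. \<lbrakk>norm x \<le> R; norm y \<le> R\<rbrakk> \<Longrightarrow> dist (f x $ 2) (f y $ 2) \<le> L2 * norm (x - y)"
    using ball_LipschitzE [OF assms] by metis
  have "dist (f x) (f y) \<le> (L1 + L2) * norm (x - y)" if "norm x \<le> R" "norm y \<le> R" for x y
    using L1 [OF that] L2 [OF that] norm_vec2_le [of "f x - f y"] by (simp add: dist_norm algebra_simps)
  then show "\<exists>L. \<forall>x y. norm x \<le> R \<longrightarrow> norm y \<le> R \<longrightarrow> dist (f x) (f y) \<le> L * norm (x - y)" by blast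
qed

lemma ball_Lipschitz_matrix_vector:
  fixes M :: "real^2 \<Rightarrow> complex^2^2"
  assumes "ball_Lipschitz M" "ball_Lipschitz x"
  shows "ball_Lipschitz (\<lambda>w. M w *v x w)"
  unfolding matrix_vector_mult_def
  by (rule ball_Lipschitz_vec2)
    (simp add: ball_Lipschitz_sum ball_Lipschitz_mult ball_Lipschitz_component assms)

text \<open>
  Discrete parallel transport: project a fixed vector of \<open>l 0\<close> successively onto the
  lines at points of a path from \<open>0\<close> to \<open>w\<close> whose steps are so short that no
  projection kills the vector. The path consists of the points obtained by clamping \<open>w\<close>
  to growing squares, so it depends on \<open>w\<close> in a Lipschitz way, and it stays at
  \<open>w\<close> once the square contains \<open>w\<close>.
\<close>
theorem line_field_frame:
  assumes lines: "\<And>w. l w \<in> complex_lines" and lip: "K-lipschitz_on UNIV (\<lambda>w. line_proj (l w))"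
  obtains s where "ball_Lipschitz s" "\<And>w. s w \<in> l w" "\<And>w. norm (s w) = 1"
proof -
  define P where "P = (\<lambda>w. line_proj (l w))"
  have K: "K \<ge> 0" "\<And>w w'. norm (P w - P w') \<le> K * norm (w - w')"
    using lip lipschitz_on_nonneg by (auto simp: P_def lipschitz_on_def dist_norm)
  \<comment> \<open>Consecutive points of the path are at distance at most \<open>2 r\<close>, so the
    projections differ by less than the identity can absorb: \<open>4 K (2 r) < 1\<close>.\<close>
  define r where "r = 1 / (8 * K + 8)"
  have r: "r > 0" "8 * K * r < 1" using K(1) by (auto simp: r_def)
  have nonzero: "P w *v x \<noteq> 0" if "x \<in> l w'" "x \<noteq> 0" "norm (w' - w) \<le> 2 * r" for w w' x
  proof
    assume 0: "P w *v x = 0"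
    have "x = (P w' - P w) *v x"
      using line_proj_fixes [OF lines that(1)] 0 by (simp add: P_def matrix_vector_mult_diff_rdistrib)
    then have "norm x \<le> 4 * norm (P w' - P w) * norm x" using norm_mat2_vec_le by metis
    also have "\<dots> \<le> 4 * (K * (2 * r)) * norm x"
      using K(2) [of w' w] mult_left_mono [OF that(3) K(1)] by (intro mult_right_mono) auto
    also have "\<dots> < 1 * norm x" using r(2) that(2) by (intro mult_strict_right_mono) auto
    finally show False by simp
  qed
  define c :: "nat \<Rightarrow> real^2 \<Rightarrow> real^2"
    where "c = (\<lambda>k w. \<chi> i. max (- (of_nat k * r)) (min (of_nat k * r) (w $ i)))"
  have c_lip: "ball_Lipschitz (c k)" for k
    by (rule ball_Lipschitz_vec2) (simp add: c_def ball_Lipschitz_clamp)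
  have c_step: "norm (c k w - c (Suc k) w) \<le> 2 * r" for k w
  proof -
    have "\<bar>(c k w - c (Suc k) w) $ i\<bar> \<le> r" for i
    proof -
      have "0 \<le> of_nat k * r" using r by simp
      moreover have "of_nat (Suc k) * r = of_nat k * r + r" by (simp add: algebra_simps)
      ultimately show ?thesis unfolding c_def using r(1) by (simp del: of_nat_Suc; linarith)
    qed
    from this [of 1] this [of 2] norm_vec2_le [of "c k w - c (Suc k) w"] show ?thesis by simp
  qed
  have c_eq: "c k w = w" if "norm w \<le> r * of_nat k" for k w
    using that component_le_norm_cart [of w] by (auto simp: c_def vec_eq_iff mult.commute max_def min_def abs_le_iff)
      (smt (verit, best))+
  \<comment> \<open>The vector after \<open>k\<close> steps of the transport along the path to \<open>w\<close>.\<close>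
  define S where "S = rec_nat (\<lambda>w. unit_vec (l 0)) (\<lambda>k f w. P (c (Suc k) w) *v f w)"
  have S0: "S 0 = (\<lambda>w. unit_vec (l 0))" and SS: "S (Suc k) = (\<lambda>w. P (c (Suc k) w) *v S k w)" for k
    by (simp_all add: S_def)
  have S: "S k w \<in> l (c k w) \<and> S k w \<noteq> 0" for k w
  proof (induction k)
    case 0
    have "c 0 w = 0" by (simp add: c_def vec_eq_iff)
    moreover have "unit_vec (l 0) \<in> l 0" "unit_vec (l 0) \<noteq> 0"
      using unit_vec [OF lines, of 0] by (metis rangeI vec.scale_one, force)
    ultimately show ?case by (simp add: S0)
  next
    case (Suc k)
    then show ?case
      using nonzero [OF _ _ c_step] line_proj_in [OF lines] by (simp add: SS P_def)
  qed
  have P_lip: "ball_Lipschitz P" using lip Lipschitz_imp_ball_Lipschitz by (simp add: P_def)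
  have S_lip: "ball_Lipschitz (S k)" for k
  proof (induction k)
    case (Suc k)
    then show ?case unfolding SS
      by (rule ball_Lipschitz_matrix_vector [OF ball_Lipschitz_compose [OF P_lip c_lip]])
  qed (simp add: S0 ball_Lipschitz_const)
  have "S (Suc k) w = S k w" if "norm w \<le> r * of_nat k" for k w
  proof -
    have "norm w \<le> r * of_nat (Suc k)" using that r by (simp add: algebra_simps)
    then have "S (Suc k) w = P w *v S k w" by (simp add: SS c_eq)
    moreover have "S k w \<in> l w" using S [of k w] c_eq [OF that] by simp
    ultimately show ?thesis by (simp add: P_def line_proj_fixes lines)
  qed
  from stabilizing_ball_Lipschitz_limit [where S = S, OF r(1) S_lip this]
  obtain s where s: "ball_Lipschitz s" "\<And>k w. norm w \<le> r * of_nat k \<Longrightarrow> s w = S k w" by blast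
  have sl: "s w \<in> l w \<and> s w \<noteq> 0" for w
  proof -
    obtain k where "norm w \<le> r * of_nat k"
      using reals_Archimedean2 [of "norm w / r"] r(1) by (metis less_imp_le mult.commute pos_divide_le_eq)
    then show ?thesis using s(2) S c_eq by metis
  qed
  show ?thesis
  proof
    show "ball_Lipschitz (\<lambda>w. (1 / norm (s w)) *\<^sub>R s w)"
      using s(1) sl by (intro ball_Lipschitz_normalize) auto
    show "(1 / norm (s w)) *\<^sub>R s w \<in> l w" for w
    proof -
      have "(1 / norm (s w)) *\<^sub>R s w = complex_of_real (1 / norm (s w)) *s s w"
        by (rule vec_eq_iff [THEN iffD2], rule allI, subst vector_scaleR_component,
            subst vector_smult_component, rule scaleR_conv_of_real)
      moreover have "vec.subspace (l w)" using lines by (auto simp: complex_lines_def)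
      ultimately show ?thesis using sl by (simp add: vec.subspace_scale)
    qed
    show "norm ((1 / norm (s w)) *\<^sub>R s w) = 1" for w using sl by simp
  qed
qed

text \<open>
  Split \<open>\<phi> = f + h\<close>, where \<open>f\<close> vanishes for \<open>w j \<le> 0\<close>
  and \<open>h\<close> for \<open>w j \<ge> 1\<close>. Then the sum of \<open>f\<close> over the
  backward translates minus the sum of \<open>h\<close> over the forward translates is locally finite
  and telescopes to a primitive.
\<close>
lemma additive_cocycle_primitive:
  fixes \<phi> :: "real^2 \<Rightarrow> complex" and j :: 2
  assumes \<phi>: "ball_Lipschitz \<phi>"
  obtains \<gamma> where "ball_Lipschitz \<gamma>" "\<And>w. \<gamma> (w + axis j 1) - \<gamma> w = \<phi> w"
    "\<And>i w. \<lbrakk>i \<noteq> j; \<And>w. \<phi> (w + axis i 1) = \<phi> w\<rbrakk> \<Longrightarrow> \<gamma> (w + axis i 1) = \<gamma> w"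
proof -
  define e :: "real^2" where "e = axis j 1"
  define f where "f = (\<lambda>w. of_real (max 0 (min 1 (w $ j))) * \<phi> w)"
  define h where "h = (\<lambda>w. \<phi> w - f w)"
  have f_lip: "ball_Lipschitz f"
    unfolding f_def
    by (intro ball_Lipschitz_mult ball_Lipschitz_bounded_linear [OF bounded_linear_of_real] ball_Lipschitz_clamp \<phi>)
  have h_lip: "ball_Lipschitz h" unfolding h_def by (intro ball_Lipschitz_diff \<phi> f_lip)
  have f0: "f w = 0" if "w $ j \<le> 0" for w using that by (simp add: f_def)
  have h0: "h w = 0" if "w $ j \<ge> 1" for w using that by (simp add: f_def h_def)
  define S where "S = (\<lambda>n w. (\<Sum>k<Suc n. f (w - (of_nat k + 1) *\<^sub>R e)) - (\<Sum>k<Suc n. h (w + of_nat k *\<^sub>R e)))"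
  have S_lip: "ball_Lipschitz (S n)" for n
    unfolding S_def diff_conv_add_uminus
    by (intro ball_Lipschitz_add ball_Lipschitz_minus ball_Lipschitz_sum ball_Lipschitz_translate f_lip h_lip)
  have "S (Suc n) w = S n w" if "norm w \<le> 1 * of_nat n" for n w
  proof -
    have "\<bar>w $ j\<bar> \<le> of_nat n" using that component_le_norm_cart [of w j] by simp
    then have "f (w - (of_nat (Suc n) + 1) *\<^sub>R e) = 0" "h (w + of_nat (Suc n) *\<^sub>R e) = 0"
      by (auto intro!: f0 h0 simp: e_def axis_def)
    then show ?thesis by (simp add: S_def)
  qed
  from stabilizing_ball_Lipschitz_limit [where S = S, OF zero_less_one S_lip this]
  obtain \<gamma> where \<gamma>: "ball_Lipschitz \<gamma>" "\<And>n w. norm w \<le> 1 * of_nat n \<Longrightarrow> \<gamma> w = S n w" by blast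
  show ?thesis
  proof
    show "ball_Lipschitz \<gamma>" by fact
    show "\<gamma> (w + axis j 1) - \<gamma> w = \<phi> w" for w
    proof -
      define n where "n = nat \<lceil>norm w + norm (w + e)\<rceil>"
      have "norm w + norm (w + e) \<le> of_nat n" unfolding n_def by (rule real_nat_ceiling_ge)
      then have n: "norm w \<le> of_nat n" "norm (w + e) \<le> of_nat n"
        using norm_ge_zero [of w] norm_ge_zero [of "w + e"] by linarith+
      have fs: "(\<Sum>k<Suc n. f (w + e - (of_nat k + 1) *\<^sub>R e)) - (\<Sum>k<Suc n. f (w - (of_nat k + 1) *\<^sub>R e))
          = f w - f (w - (of_nat n + 1) *\<^sub>R e)"
      proof -
        have "(\<Sum>k<Suc n. f (w - of_nat k *\<^sub>R e) - f (w - of_nat (Suc k) *\<^sub>R e))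
            = f (w - of_nat 0 *\<^sub>R e) - f (w - of_nat (Suc n) *\<^sub>R e)"
          by (rule sum_lessThan_telescope')
        then show ?thesis by (simp add: sum_subtractf algebra_simps)
      qed
      have hs: "(\<Sum>k<Suc n. h (w + e + of_nat k *\<^sub>R e)) - (\<Sum>k<Suc n. h (w + of_nat k *\<^sub>R e))
          = h (w + (of_nat n + 1) *\<^sub>R e) - h w"
      proof -
        have "(\<Sum>k<Suc n. h (w + of_nat (Suc k) *\<^sub>R e) - h (w + of_nat k *\<^sub>R e))
            = h (w + of_nat (Suc n) *\<^sub>R e) - h (w + of_nat 0 *\<^sub>R e)"
          by (rule sum_lessThan_telescope)
        then show ?thesis by (simp add: sum_subtractf algebra_simps)
      qed
      have "\<bar>w $ j\<bar> \<le> of_nat n" using n component_le_norm_cart [of w j] by simp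
      then have "f (w - (of_nat n + 1) *\<^sub>R e) = 0" "h (w + (of_nat n + 1) *\<^sub>R e) = 0"
        by (auto intro!: f0 h0 simp: e_def axis_def)
      moreover have "\<gamma> (w + e) - \<gamma> w = S n (w + e) - S n w" using n \<gamma>(2) by simp
      moreover have "(a - b) - (c - d) = (a - c) - (b - d)" for a b c d :: complex by simp
      ultimately have "\<gamma> (w + e) - \<gamma> w = f w + h w" by (simp only: S_def fs hs) simp
      then show ?thesis by (simp add: h_def e_def)
    qed
    show "\<gamma> (w + axis i 1) = \<gamma> w" if "i \<noteq> j" and per: "\<And>w. \<phi> (w + axis i 1) = \<phi> w" for i w
    proof -
      define n where "n = nat \<lceil>norm w + norm (w + axis i 1)\<rceil>"
      have "norm w + norm (w + axis i 1) \<le> of_nat n" unfolding n_def by (rule real_nat_ceiling_ge)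
      then have n: "norm w \<le> of_nat n" "norm (w + axis i 1) \<le> of_nat n"
        using norm_ge_zero [of w] norm_ge_zero [of "w + axis i 1"] by linarith+
      have "f (w + axis i 1) = f w" for w using \<open>i \<noteq> j\<close> per by (simp add: f_def axis_def)
      moreover from this have "h (w + axis i 1) = h w" for w using per by (simp add: h_def)
      moreover have "w + axis i 1 - u = (w - u) + axis i 1" "w + axis i 1 + u = (w + u) + axis i 1" for u
        by simp_all
      ultimately have "S n (w + axis i 1) = S n w" by (simp only: S_def)
      then show ?thesis using n \<gamma>(2) by simp
    qed
  qed
qed

section \<open>Multipliers, the Chern number and a normal form\<close>

definition ee :: "complex \<Rightarrow> complex" where
  "ee z = exp (2 * complex_of_real pi * \<i> * z)"

lemma ee_0 [simp]: "ee 0 = 1" and ee_nonzero [simp]: "ee z \<noteq> 0"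
  by (simp_all add: ee_def)

lemma ee_add: "ee (x + y) = ee x * ee y"
  by (simp add: ee_def distrib_left exp_add)

lemma ee_diff: "ee (x - y) = ee x / ee y"
  by (simp add: ee_def right_diff_distrib exp_diff)

lemma ee_minus: "ee (- x) = 1 / ee x"
  using ee_diff [of 0 x] by simp

lemma ee_eq_1_iff: "ee z = 1 \<longleftrightarrow> z \<in> \<int>"
proof -
  have "ee z = 1 \<longleftrightarrow> (\<exists>n::int. z = of_int n)"
    unfolding ee_def exp_eq_1 by (auto simp: complex_eq_iff intro: exI [of _ "_ :: int"])
  then show ?thesis by (auto elim: Ints_cases)
qed

lemma continuous_integer_valued_constant:
  fixes f :: "real^2 \<Rightarrow> complex"
  assumes "continuous_on UNIV f" and "\<And>w. ee (f w) = 1"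
  obtains n :: int where "\<And>w. f w = of_int n"
proof -
  have int: "f w \<in> \<int>" for w using assms(2) by (simp add: ee_eq_1_iff)
  have "f constant_on UNIV"
  proof (rule continuous_discrete_range_constant)
    fix w
    have "1 \<le> norm (f y - f w)" if "f y \<noteq> f w" for y
    proof -
      obtain m where m: "f y - f w = of_int m" using int by (meson Ints_cases Ints_diff)
      with that have "m \<noteq> 0" by auto
      then have "1 \<le> real_of_int \<bar>m\<bar>" by linarith
      then show ?thesis by (simp add: m)
    qed
    then show "\<exists>e>0. \<forall>y. y \<in> UNIV \<and> f y \<noteq> f w \<longrightarrow> e \<le> norm (f y - f w)" by (intro exI [of _ 1]) auto
  qed (use assms in auto)
  then obtain c where c: "\<And>w. f w = c" by (auto simp: constant_on_def)
  then have "c \<in> \<int>" using int by metis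
  then show ?thesis using c that by (metis Ints_cases)
qed

lemma continuous_nonvanishing_ee:
  fixes f :: "real^2 \<Rightarrow> complex"
  assumes "continuous_on UNIV f" and "\<And>w. f w \<noteq> 0"
  obtains \<phi> where "continuous_on UNIV \<phi>" "\<And>w. f w = ee (\<phi> w)"
proof -
  obtain g where g: "continuous_on UNIV g" "\<And>w. f w = exp (g w)"
    using continuous_logarithm_on_contractible [of UNIV f] assms
    by (metis UNIV_I contractible_UNIV)
  show ?thesis
  proof
    show "continuous_on UNIV (\<lambda>w. g w / (2 * complex_of_real pi * \<i>))"
      by (intro continuous_intros g) auto
    show "f w = ee (g w / (2 * complex_of_real pi * \<i>))" for w by (simp add: ee_def g)
  qed
qed

lemma ball_Lipschitz_nonvanishing_ee:
  assumes f: "ball_Lipschitz f" and "\<And>w. f w \<noteq> 0"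
  obtains \<phi> where "ball_Lipschitz \<phi>" "\<And>w. f w = ee (\<phi> w)"
proof -
  obtain \<phi> where \<phi>: "continuous_on UNIV \<phi>" "\<And>w. f w = ee (\<phi> w)"
    using continuous_nonvanishing_ee [OF ball_Lipschitz_imp_continuous [OF f] assms(2)] by blast
  have "ball_Lipschitz (\<lambda>w. 2 * complex_of_real pi * \<i> * \<phi> w)"
    by (rule ball_Lipschitz_logarithm [OF f])
      (auto intro!: continuous_intros \<phi>(1) simp: \<phi>(2) ee_def)
  then have "ball_Lipschitz (\<lambda>w. (1 / (2 * complex_of_real pi * \<i>)) * (2 * complex_of_real pi * \<i> * \<phi> w))"
    by (rule ball_Lipschitz_mult [OF ball_Lipschitz_const])
  then have "ball_Lipschitz \<phi>" by simp
  then show ?thesis using \<phi> that by blast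
qed

text \<open>
  The Hermitian product, linear in the first argument; for a unit vector \<open>y\<close> it is the
  coordinate along \<open>y\<close>.
\<close>
definition coord :: "complex^2 \<Rightarrow> complex^2 \<Rightarrow> complex" where
  "coord x y = x $ 1 * cnj (y $ 1) + x $ 2 * cnj (y $ 2)"

lemma coord_scaled:
  assumes "norm y = 1" shows "coord (c *s y) y = c"
proof -
  have "coord (c *s y) y = c * (y $ 1 * cnj (y $ 1) + y $ 2 * cnj (y $ 2))"
    by (simp add: coord_def algebra_simps)
  then show ?thesis using norm_eq_1_vec2 [OF assms] by simp
qed

lemma line_coord:
  assumes "L \<in> complex_lines" "x \<in> L" "y \<in> L" "norm y = 1"
  shows "x = coord x y *s y"
proof -
  obtain a b where ab: "x = a *s unit_vec L" "y = b *s unit_vec L" using unit_vec(2) [OF assms(1)] assms by blast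
  have "b \<noteq> 0" using ab assms(4) by auto
  then have "x = (a / b) *s y" by (simp add: ab)
  then show ?thesis using coord_scaled [OF assms(4)] by metis
qed

lemma ball_Lipschitz_coord:
  assumes "ball_Lipschitz x" "ball_Lipschitz y"
  shows "ball_Lipschitz (\<lambda>w. coord (x w) (y w))"
  unfolding coord_def
  by (intro ball_Lipschitz_add ball_Lipschitz_mult ball_Lipschitz_component assms
      ball_Lipschitz_bounded_linear [OF bounded_linear_cnj])

lemma scaled_eq_iff: "a *s (x :: complex^2) = b *s x \<longleftrightarrow> a = b \<or> x = 0"
  by (auto simp: vec_eq_iff)

text \<open>
  The factor of a bundle map in a frame is nonvanishing on the simply connected plane, so it has a
  logarithm.
\<close>
lemma frame_multiplier:
  assumes lines: "\<And>w. l w \<in> complex_lines"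
    and s: "ball_Lipschitz s" "\<And>w. s w \<in> l w" "\<And>w. norm (s w) = 1"
    and M: "ball_Lipschitz M" "\<And>w. det (M w) \<noteq> 0" "\<And>w. (\<lambda>v. M w *v v) ` l w = l (w + a)"
  obtains \<phi> where "ball_Lipschitz \<phi>" "\<And>w. M w *v s w = ee (\<phi> w) *s s (w + a)"
proof -
  define g where "g = (\<lambda>w. coord (M w *v s w) (s (w + a)))"
  have g: "M w *v s w = g w *s s (w + a)" for w
    unfolding g_def by (rule line_coord [OF lines _ s(2,3)]) (use s(2) M(3) in blast)
  have "g w \<noteq> 0" for w
  proof
    assume "g w = 0"
    then have "M w *v s w = 0" using g by simp
    moreover have "wedge (M w *v s w) (M w *v x) = det (M w) * wedge (s w) x" for x by (rule wedge_matrix)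
    ultimately have "wedge (s w) x = 0" for x using M(2) [of w] by (simp add: wedge_def)
    from this [of "axis 1 1"] this [of "axis 2 1"] have "s w = 0"
      by (simp add: wedge_def axis_def vec_eq_iff forall_2)
    then show False using s(3) [of w] by simp
  qed
  moreover have "ball_Lipschitz g"
    unfolding g_def by (intro ball_Lipschitz_coord ball_Lipschitz_matrix_vector ball_Lipschitz_translate s M)
  ultimately obtain \<phi> where "ball_Lipschitz \<phi>" "\<And>w. g w = ee (\<phi> w)"
    using ball_Lipschitz_nonvanishing_ee by metis
  then show ?thesis using g that by metis
qed

lemma add_axes_commute: "w + e1 + e2 = w + e2 + (e1 :: real^2)"
  by simp

text \<open>
  Two nonvanishing sections differ by a function \<open>ee \<circ> \<eta>\<close>, so their
  logarithmic multipliers differ by the coboundary of \<open>\<eta>\<close> and integer constants.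
  Both cancel in the alternating sum that defines the Chern number, so the description in the
  definition is unique and any continuous unit frame computes it.
\<close>
lemma chern_number_eqI:
  assumes lines: "\<And>w. l w \<in> complex_lines"
    and s: "continuous_on UNIV s" "\<And>w. s w \<in> l w" "\<And>w. norm (s w) = 1"
    and \<phi>: "continuous_on UNIV \<phi>1" "continuous_on UNIV \<phi>2"
    and U: "\<And>w. U1 w *v s w = ee (\<phi>1 w) *s s (w + e1)" "\<And>w. U2 w *v s w = ee (\<phi>2 w) *s s (w + e2)"
    and n: "\<And>w. of_int n = \<phi>1 (w + e2) + \<phi>2 w - \<phi>2 (w + e1) - \<phi>1 w"
  shows "chern_number U1 U2 l = n"
  unfolding chern_number_def
proof (rule the_equality, goal_cases)
  case 1
  have "s w \<noteq> 0" for w using s(3) [of w] by auto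
  then show ?case using s \<phi> U n unfolding ee_def
    by (intro exI [of _ s] exI [of _ \<phi>1] exI [of _ \<phi>2]) auto
next
  case (2 n')
  then obtain s' \<psi>1 \<psi>2 where s': "continuous_on UNIV s'" "\<And>w. s' w \<in> l w" "\<And>w. s' w \<noteq> 0"
    and \<psi>: "continuous_on UNIV \<psi>1" "continuous_on UNIV \<psi>2"
    and U': "\<And>w. U1 w *v s' w = ee (\<psi>1 w) *s s' (w + e1)" "\<And>w. U2 w *v s' w = ee (\<psi>2 w) *s s' (w + e2)"
    and n': "\<And>w. of_int n' = \<psi>1 (w + e2) + \<psi>2 w - \<psi>2 (w + e1) - \<psi>1 w"
    unfolding ee_def by auto
  define f where "f = (\<lambda>w. coord (s' w) (s w))"
  have f: "s' w = f w *s s w" for w unfolding f_def by (rule line_coord [OF lines s'(2) s(2,3)])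
  have "f w \<noteq> 0" for w using f [of w] s'(3) [of w] by auto
  moreover have "continuous_on UNIV f"
    unfolding f_def coord_def by (intro continuous_intros s s')
  ultimately obtain \<eta> where \<eta>: "continuous_on UNIV \<eta>" "\<And>w. f w = ee (\<eta> w)"
    using continuous_nonvanishing_ee by metis
  have trans: "\<exists>k::int. \<forall>w. \<psi> w = \<phi> w + \<eta> w - \<eta> (w + e) + of_int k"
    if "continuous_on UNIV \<phi>" "continuous_on UNIV \<psi>"
      and Us: "\<And>w. U w *v s w = ee (\<phi> w) *s s (w + e)" "\<And>w. U w *v s' w = ee (\<psi> w) *s s' (w + e)"
    for \<phi> \<psi> U and e :: "real^2"
  proof -
    have one: "ee (\<psi> w - (\<phi> w + \<eta> w - \<eta> (w + e))) = 1" for w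
    proof -
      have "s (w + e) \<noteq> 0" using s(3) [of "w + e"] by auto
      moreover have "(ee (\<psi> w) * f (w + e)) *s s (w + e) = (f w * ee (\<phi> w)) *s s (w + e)"
        using Us [of w] unfolding f matrix_mult_scaled by (auto simp: vec.scale_scale mult_ac)
      ultimately have "ee (\<psi> w) * f (w + e) = f w * ee (\<phi> w)" by (simp add: scaled_eq_iff)
      then show ?thesis by (simp add: ee_diff ee_add \<eta> mult_ac)
    qed
    have cont: "continuous_on UNIV (\<lambda>w. \<psi> w - (\<phi> w + \<eta> w - \<eta> (w + e)))"
      by (intro continuous_intros that continuous_on_compose2 [OF \<eta>(1)] \<eta>(1)) auto
    obtain k :: int where "\<And>w. \<psi> w - (\<phi> w + \<eta> w - \<eta> (w + e)) = of_int k"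
      by (rule continuous_integer_valued_constant [OF cont one]) (rule that, assumption+)
    then show ?thesis by (intro exI [of _ k]) (auto simp: algebra_simps)
  qed
  obtain k1 :: int where k1: "\<And>w. \<psi>1 w = \<phi>1 w + \<eta> w - \<eta> (w + e1) + of_int k1"
    using trans [OF \<phi>(1) \<psi>(1) U(1) U'(1)] by blast
  obtain k2 :: int where k2: "\<And>w. \<psi>2 w = \<phi>2 w + \<eta> w - \<eta> (w + e2) + of_int k2"
    using trans [OF \<phi>(2) \<psi>(2) U(2) U'(2)] by blast
  have "(of_int n' :: complex) = of_int n"
    unfolding n' [of 0] n [of 0] k1 k2 add_axes_commute by simp
  then show ?case by simp
qed

text \<open>
  A first change of frame \<open>\<gamma>1\<close> removes the multiplier in the direction
  \<open>e1\<close>. The remaining multiplier \<open>\<phi>2 + \<gamma>1 - \<gamma>1 (\<cdot> +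
  e2)\<close> then changes by \<open>- n\<close> under \<open>e1\<close>, so it is \<open>- n
  w1\<close> plus a function periodic in the direction \<open>e1\<close>; a second change
  \<open>\<gamma>2\<close>, periodic in that direction, removes this function.
\<close>
theorem invariant_line_normal_form:
  assumes adm: "strip_admissible U1 U2 \<tau> A" and dom: "dominated_splitting U1 U2 \<tau> A ls lu"
    and l: "l \<in> {ls, lu}"
  obtains s \<beta> and p1 p2 :: int where
    "continuous_on UNIV s" "\<And>w. s w \<in> l w" "\<And>w. s w \<noteq> 0"
    "\<And>w. U1 w *v s w = s (w + e1)"
    "\<And>w. U2 w *v s w = ee (- of_int (chern_number U1 U2 l) * of_real (w $ 1)) *s s (w + e2)"
    "\<And>w. A w *v s w = ee (\<beta> w) *s s (w + \<tau>)"
    "ball_Lipschitz \<beta>" "\<And>w. \<beta> (w + e1) = \<beta> w + of_int p1"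
    "\<And>w. \<beta> (w + e2) = \<beta> w + of_int p2 - of_int (chern_number U1 U2 l) * of_real (\<tau> $ 1)"
proof -
  have sew: "sewing_system U1 U2" and eq: "equivariant_cocycle U1 U2 \<tau> A"
    using adm by (auto simp: strip_admissible_def)
  have inv: "invariant_line U1 U2 \<tau> A l" using dom l by (auto simp: dominated_splitting_def)
  have lines: "l w \<in> complex_lines" for w by (rule invariant_line_lines [OF inv])
  have Lip: "ball_Lipschitz U1" "ball_Lipschitz U2" "ball_Lipschitz A"
  proof -
    have "ball_Lipschitz M" if "extends_to_strip \<delta> M" "\<delta> > 0" for M \<delta>
      using extends_to_strip_imp_bounded_Lipschitz [OF that] Lipschitz_imp_ball_Lipschitz by blast
    then show "ball_Lipschitz U1" "ball_Lipschitz U2" "ball_Lipschitz A"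
      using adm by (auto simp: strip_admissible_def)
  qed
  have det: "det (U1 w) \<noteq> 0" "det (U2 w) \<noteq> 0" "det (A w) \<noteq> 0" for w
    using sew eq norm_det_unitary_mat [of "U1 w"] norm_det_unitary_mat [of "U2 w"]
    by (auto simp: sewing_system_def equivariant_cocycle_def)
  obtain K where K: "K-lipschitz_on UNIV (\<lambda>w. line_proj (l w))" using line_proj_Lipschitz [OF adm dom l] by blast
  obtain s0 where s0: "ball_Lipschitz s0" "\<And>w. s0 w \<in> l w" "\<And>w. norm (s0 w) = 1"
    by (rule line_field_frame [OF lines K]) (rule that, assumption+)
  have images: "(\<lambda>v. U1 w *v v) ` l w = l (w + e1)" "(\<lambda>v. U2 w *v v) ` l w = l (w + e2)"
    "(\<lambda>v. A w *v v) ` l w = l (w + \<tau>)" for w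
    using inv by (simp_all add: invariant_line_def shift_def)
  have s0nz: "s0 w \<noteq> 0" for w using s0(3) [of w] by auto
  have cont0: "continuous_on UNIV s0" by (rule ball_Lipschitz_imp_continuous [OF s0(1)])
  obtain \<phi>1 where \<phi>1: "ball_Lipschitz \<phi>1" "\<And>w. U1 w *v s0 w = ee (\<phi>1 w) *s s0 (w + e1)"
    by (rule frame_multiplier [OF lines s0 Lip(1) det(1) images(1)]) (rule that, assumption+)
  obtain \<phi>2 where \<phi>2: "ball_Lipschitz \<phi>2" "\<And>w. U2 w *v s0 w = ee (\<phi>2 w) *s s0 (w + e2)"
    by (rule frame_multiplier [OF lines s0 Lip(2) det(2) images(2)]) (rule that, assumption+)
  obtain \<beta>0 where \<beta>0: "ball_Lipschitz \<beta>0" "\<And>w. A w *v s0 w = ee (\<beta>0 w) *s s0 (w + \<tau>)"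
    by (rule frame_multiplier [OF lines s0 Lip(3) det(3) images(3)]) (rule that, assumption+)
  have lin: "continuous_on UNIV (\<lambda>w. f (w + a))" if "continuous_on UNIV f"
    for f :: "real^2 \<Rightarrow> complex" and a
    by (rule continuous_on_compose2 [OF that]) (auto intro: continuous_intros)
  have c1: "continuous_on UNIV \<phi>1" and c2: "continuous_on UNIV \<phi>2"
    using \<phi>1(1) \<phi>2(1) ball_Lipschitz_imp_continuous by auto
  have one: "ee (\<phi>1 (w + e2) + \<phi>2 w - \<phi>2 (w + e1) - \<phi>1 w) = 1" for w
  proof -
    have "(U1 (w + e2) ** U2 w) *v s0 w = (U2 (w + e1) ** U1 w) *v s0 w"
      using sew by (simp add: sewing_system_def)
    then have "(ee (\<phi>1 (w + e2)) * ee (\<phi>2 w)) *s s0 (w + e1 + e2) = (ee (\<phi>2 (w + e1)) * ee (\<phi>1 w)) *s s0 (w + e1 + e2)"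
      by (simp add: \<phi>1 \<phi>2 matrix_mult_scaled add_axes_commute vec.scale_scale mult_ac flip: matrix_vector_mul_assoc)
    then show ?thesis using s0nz by (simp add: scaled_eq_iff ee_add ee_diff)
  qed
  have cont: "continuous_on UNIV (\<lambda>w. \<phi>1 (w + e2) + \<phi>2 w - \<phi>2 (w + e1) - \<phi>1 w)"
    by (intro continuous_intros lin c1 c2)
  obtain n :: int where n: "\<And>w. \<phi>1 (w + e2) + \<phi>2 w - \<phi>2 (w + e1) - \<phi>1 w = of_int n"
    by (rule continuous_integer_valued_constant [OF cont one]) (rule that, assumption+)
  have chern: "chern_number U1 U2 l = n"
    by (rule chern_number_eqI [OF lines cont0 s0(2,3) c1 c2 \<phi>1(2) \<phi>2(2)]) (simp add: n)
  obtain \<gamma>1 where \<gamma>1: "ball_Lipschitz \<gamma>1" "\<And>w. \<gamma>1 (w + e1) - \<gamma>1 w = \<phi>1 w"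
    by (rule additive_cocycle_primitive [OF \<phi>1(1), of 1]) (rule that, assumption+)
  define \<psi> where "\<psi> = (\<lambda>w. \<phi>2 w + \<gamma>1 w - \<gamma>1 (w + e2) + of_int n * of_real (w $ 1))"
  have "ball_Lipschitz \<psi>"
    unfolding \<psi>_def
    by (rule ball_Lipschitz_add [OF ball_Lipschitz_diff [OF ball_Lipschitz_add [OF \<phi>2(1) \<gamma>1(1)]
          ball_Lipschitz_translate [OF \<gamma>1(1)]] ball_Lipschitz_mult [OF ball_Lipschitz_const
          ball_Lipschitz_bounded_linear [OF bounded_linear_of_real ball_Lipschitz_component [OF ball_Lipschitz_ident]]]])
  moreover have "\<psi> (w + e1) = \<psi> w" for w
  proof -
    have "\<gamma>1 (w + e1) = \<gamma>1 w + \<phi>1 w" "\<gamma>1 (w + e1 + e2) = \<gamma>1 (w + e2) + \<phi>1 (w + e2)"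
      using \<gamma>1(2) [of w] \<gamma>1(2) [of "w + e2"] by (auto simp: algebra_simps)
    moreover have "(w + e1) $ 1 = w $ 1 + 1" by (simp add: axis_def)
    ultimately show ?thesis using n [of w] by (simp add: \<psi>_def algebra_simps)
  qed
  ultimately have \<psi>: "ball_Lipschitz \<psi>" "\<And>w. \<psi> (w + e1) = \<psi> w" by auto
  obtain \<gamma>2 where \<gamma>2: "ball_Lipschitz \<gamma>2" "\<And>w. \<gamma>2 (w + e2) - \<gamma>2 w = \<psi> w"
    "\<And>w. \<gamma>2 (w + e1) = \<gamma>2 w"
  proof (rule additive_cocycle_primitive [OF \<psi>(1), of 2])
    fix \<gamma> :: "real^2 \<Rightarrow> complex"
    assume g: "ball_Lipschitz \<gamma>" "\<And>w. \<gamma> (w + e2) - \<gamma> w = \<psi> w"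
      and per: "\<And>i w. \<lbrakk>i \<noteq> 2; \<And>w. \<psi> (w + axis i 1) = \<psi> w\<rbrakk> \<Longrightarrow> \<gamma> (w + axis i 1) = \<gamma> w"
    have "\<gamma> (w + e1) = \<gamma> w" for w by (rule per [of 1, OF _ \<psi>(2)]) simp
    with g show thesis by (rule that)
  qed
  define \<gamma> where "\<gamma> = (\<lambda>w. \<gamma>1 w + \<gamma>2 w)"
  have \<gamma>: "ball_Lipschitz \<gamma>" unfolding \<gamma>_def by (intro ball_Lipschitz_add \<gamma>1 \<gamma>2)
  have \<gamma>e1: "\<gamma> (w + e1) = \<gamma> w + \<phi>1 w" for w
    using \<gamma>1(2) [of w] \<gamma>2(3) [of w] by (simp add: \<gamma>_def algebra_simps)
  have \<gamma>e2: "\<gamma> (w + e2) = \<gamma> w + \<phi>2 w + of_int n * of_real (w $ 1)" for w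
    using \<gamma>2(2) [of w] by (simp add: \<gamma>_def \<psi>_def algebra_simps)
  define s where "s = (\<lambda>w. ee (\<gamma> w) *s s0 w)"
  define \<beta> where "\<beta> = (\<lambda>w. \<beta>0 w + \<gamma> w - \<gamma> (w + \<tau>))"
  have snz: "s w \<noteq> 0" for w using s0nz by (simp add: s_def)
  have U1s: "U1 w *v s w = s (w + e1)" for w
    by (simp add: s_def matrix_mult_scaled \<phi>1 \<gamma>e1 ee_add vec.scale_scale)
  have U2s: "U2 w *v s w = ee (- of_int n * of_real (w $ 1)) *s s (w + e2)" for w
    by (simp add: s_def matrix_mult_scaled \<phi>2 \<gamma>e2 ee_add ee_minus vec.scale_scale)
  have As: "A w *v s w = ee (\<beta> w) *s s (w + \<tau>)" for w
    by (simp add: s_def \<beta>_def matrix_mult_scaled \<beta>0 ee_add ee_diff vec.scale_scale)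
  have \<beta>: "ball_Lipschitz \<beta>"
    unfolding \<beta>_def
    by (rule ball_Lipschitz_diff [OF ball_Lipschitz_add [OF \<beta>0(1) \<gamma>] ball_Lipschitz_translate [OF \<gamma>]])
  have \<beta>c: "continuous_on UNIV \<beta>" by (rule ball_Lipschitz_imp_continuous [OF \<beta>])
  have one1: "ee (\<beta> (w + e1) - \<beta> w) = 1" for w
  proof -
    have "A (w + e1) *v (U1 w *v s w) = U1 (w + \<tau>) *v (A w *v s w)"
      using eq by (simp add: equivariant_cocycle_def shift_def matrix_vector_mul_assoc)
    moreover have "w + e1 + \<tau> = w + \<tau> + e1" by simp
    ultimately have "ee (\<beta> (w + e1)) *s s (w + \<tau> + e1) = ee (\<beta> w) *s s (w + \<tau> + e1)"
      by (simp only: U1s As matrix_mult_scaled)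
    then show ?thesis using snz by (simp add: scaled_eq_iff ee_diff)
  qed
  obtain p1 :: int where p1': "\<And>w. \<beta> (w + e1) - \<beta> w = of_int p1"
    by (rule continuous_integer_valued_constant [OF continuous_on_diff [OF lin [OF \<beta>c] \<beta>c] one1])
      (rule that, assumption+)
  have p1: "\<beta> (w + e1) = \<beta> w + of_int p1" for w using p1' [of w] by (simp add: algebra_simps)
  \<comment> \<open>The multiplier in the direction \<open>e2\<close> has slope \<open>- n\<close> in
    \<open>w1\<close>, so comparing it at \<open>w\<close> and \<open>w + \<tau>\<close> leaves
    the drift \<open>- n \<tau> 1\<close>.\<close>
  have one2: "ee (\<beta> (w + e2) - \<beta> w + of_int n * of_real (\<tau> $ 1)) = 1" for w
  proof -
    have "A (w + e2) *v (U2 w *v s w) = U2 (w + \<tau>) *v (A w *v s w)"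
      using eq by (simp add: equivariant_cocycle_def shift_def matrix_vector_mul_assoc)
    moreover have "w + e2 + \<tau> = w + \<tau> + e2" by simp
    ultimately have "(ee (- of_int n * of_real (w $ 1)) * ee (\<beta> (w + e2))) *s s (w + \<tau> + e2)
        = (ee (\<beta> w) * ee (- of_int n * of_real ((w + \<tau>) $ 1))) *s s (w + \<tau> + e2)"
      by (simp only: U2s As matrix_mult_scaled vec.scale_scale)
    then have "ee (- of_int n * of_real (w $ 1)) * ee (\<beta> (w + e2))
        = ee (\<beta> w) * ee (- of_int n * of_real ((w + \<tau>) $ 1))"
      using snz by (simp only: scaled_eq_iff) simp
    then have "ee (- of_int n * of_real (w $ 1) + \<beta> (w + e2)) = ee (\<beta> w - of_int n * of_real ((w + \<tau>) $ 1))"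
      by (simp only: ee_add diff_conv_add_uminus mult_minus_left)
    then have "ee (- of_int n * of_real (w $ 1) + \<beta> (w + e2) - (\<beta> w - of_int n * of_real ((w + \<tau>) $ 1))) = 1"
      by (simp only: ee_diff) simp
    moreover have "- of_int n * of_real (w $ 1) + \<beta> (w + e2) - (\<beta> w - of_int n * of_real ((w + \<tau>) $ 1))
        = \<beta> (w + e2) - \<beta> w + of_int n * of_real (\<tau> $ 1)"
      by (simp add: algebra_simps)
    ultimately show ?thesis by (simp only:)
  qed
  have cont2: "continuous_on UNIV (\<lambda>w. \<beta> (w + e2) - \<beta> w + of_int n * of_real (\<tau> $ 1))"
    by (intro continuous_intros lin \<beta>c)
  obtain p2 :: int where p2': "\<And>w. \<beta> (w + e2) - \<beta> w + of_int n * of_real (\<tau> $ 1) = of_int p2"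
    by (rule continuous_integer_valued_constant [OF cont2 one2]) (rule that, assumption+)
  have p2: "\<beta> (w + e2) = \<beta> w + of_int p2 - of_int n * of_real (\<tau> $ 1)" for w
    using p2' [of w] by (simp add: algebra_simps)
  have cs: "continuous_on UNIV s"
  proof -
    have "continuous_on UNIV (\<lambda>w. ee (\<gamma> w))"
      unfolding ee_def by (intro continuous_intros ball_Lipschitz_imp_continuous \<gamma>)
    then show ?thesis unfolding s_def vector_scalar_mult_def
      by (intro continuous_intros cont0)
  qed
  have sl: "s w \<in> l w" for w
  proof -
    have "vec.subspace (l w)" using lines by (auto simp: complex_lines_def)
    then show ?thesis using s0(2) by (simp add: s_def vec.subspace_scale)
  qed
  show ?thesis
    by (rule that [of s \<beta> p1 p2]) (use cs sl snz U1s U2s As \<beta> p1 p2 in \<open>simp_all add: chern\<close>)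
qed

section \<open>Translations of measurable functions on the plane\<close>

lemma AE_lborel_translate:
  fixes a :: "'a::euclidean_space"
  assumes "AE w in lborel. P w" shows "AE w in lborel. P (w + a)"
proof -
  have "AE w in distr lborel borel ((+) a). P w" using assms by (simp only: lborel_distr_plus)
  then have "AE w in lborel. P (a + w)" by (rule AE_distrD [rotated]) simp
  then show ?thesis by (simp add: add.commute)
qed

lemma integral_lborel_translate:
  fixes f :: "'a::euclidean_space \<Rightarrow> real"
  assumes [measurable]: "f \<in> borel_measurable borel"
  shows "(LINT w|lborel. f (w + a)) = (LINT w|lborel. f w)"
proof -
  have "(LINT w|lborel. f w) = (LINT w|distr lborel borel ((+) a). f w)" by (simp only: lborel_distr_plus)
  also have "\<dots> = (LINT w|lborel. f (a + w))" by (subst integral_distr) auto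
  finally show ?thesis by (simp add: add.commute)
qed

lemma integrable_bounded_on_bounded_set:
  fixes f :: "'a::euclidean_space \<Rightarrow> real"
  assumes [measurable]: "f \<in> borel_measurable borel" "S \<in> sets borel"
    and "\<And>w. w \<in> S \<Longrightarrow> \<bar>f w\<bar> \<le> M" and "bounded S"
  shows "integrable lborel (\<lambda>w. indicator S w * f w)"
proof (rule Bochner_Integration.integrable_bound)
  have "emeasure lborel S < \<infinity>" using emeasure_bounded_finite [OF \<open>bounded S\<close>] by (simp add: top.not_eq_extremum)
  then show "integrable lborel (\<lambda>w. M * indicator S w)" by (intro integrable_mult_right) simp
  have "norm (indicator S w * f w) \<le> norm (M * indicator S w)" for w
    using assms(3) [of w] by (auto simp: indicator_def)
  then show "AE w in lborel. norm (indicator S w * f w) \<le> norm (M * indicator S w)" by simp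
qed auto

text \<open>
  Approximate \<open>f\<close> almost everywhere by continuous functions. The truncation \<open>min
  1\<close> is subadditive, bounded, and makes dominated convergence available for arbitrary
  measurable \<open>f\<close>.
\<close>
lemma translation_continuous_in_measure:
  fixes f :: "real^2 \<Rightarrow> complex"
  assumes f [measurable]: "f \<in> borel_measurable borel" and "\<epsilon> > 0"
  obtains \<delta> where "\<delta> > 0"
    "\<And>t. norm t < \<delta> \<Longrightarrow> (LINT w|lborel. indicator (cball 0 R) w * min 1 (norm (f (w + t) - f w))) < \<epsilon>"
proof -
  have "f measurable_on UNIV"
    by (rule lebesgue_measurable_imp_measurable_on) (auto intro: measurable_completion)
  then obtain N g where N: "negligible N" and g: "\<And>k. continuous_on UNIV (g k)"
    and lim: "\<And>w. w \<notin> N \<Longrightarrow> (\<lambda>k. g k w) \<longlonglongrightarrow> f w"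
    unfolding measurable_on_def by auto
  have g_borel [measurable]: "g k \<in> borel_measurable borel" for k by (rule borel_measurable_continuous_onI [OF g])
  define B where "B = cball (0 :: real^2) (R + 1)"
  have [measurable]: "B \<in> sets borel" by (simp add: B_def)
  have "AE w in lebesgue. w \<notin> N" using N by (simp add: negligible_iff_null_sets AE_not_in)
  then have "AE w in lborel. w \<notin> N" by (simp add: AE_completion_iff)
  then have "AE w in lborel. (\<lambda>k. indicator B w * min 1 (norm (f w - g k w))) \<longlonglongrightarrow> 0"
  proof eventually_elim
    case (elim w)
    have "(\<lambda>k. indicator B w * min 1 (norm (f w - g k w))) \<longlonglongrightarrow> indicator B w * min 1 (norm (f w - f w))"
      by (intro tendsto_intros lim elim)
    then show ?case by simp
  qed
  then have "(\<lambda>k. LINT w|lborel. indicator B w * min 1 (norm (f w - g k w))) \<longlonglongrightarrow> (LINT w|(lborel :: (real^2) measure). 0)"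
  proof (intro integral_dominated_convergence [where w = "indicator B"])
    show "integrable lborel (indicator B :: real^2 \<Rightarrow> real)"
      using integrable_bounded_on_bounded_set [of "\<lambda>_. 1" B 1] by (simp add: B_def)
  qed (auto simp: indicator_def)
  then have "\<forall>\<^sub>F k in sequentially. (LINT w|lborel. indicator B w * min 1 (norm (f w - g k w))) < \<epsilon> / 3"
    using \<open>\<epsilon> > 0\<close> by (intro order_tendstoD(2)) auto
  then obtain k where k: "(LINT w|lborel. indicator B w * min 1 (norm (f w - g k w))) < \<epsilon> / 3"
    by (auto simp: eventually_sequentially)
  define V where "V = (LINT w|lborel. indicator (cball (0 :: real^2) R) w * (1 :: real))"
  have V: "V \<ge> 0" unfolding V_def by (intro integral_nonneg_AE) auto
  define \<eta> where "\<eta> = \<epsilon> / (3 * (V + 1))"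
  have \<eta>: "\<eta> > 0" "\<eta> * V < \<epsilon> / 3"
  proof -
    show "\<eta> > 0" using V \<open>\<epsilon> > 0\<close> by (simp add: \<eta>_def)
    then have "\<eta> * V < \<eta> * (V + 1)" by simp
    also have "\<dots> = \<epsilon> / 3"
    proof -
      have "V + 1 \<noteq> 0" using V by linarith
      then have "\<epsilon> / (3 * (V + 1)) * (V + 1) = \<epsilon> / 3" by (metis divide_divide_eq_left nonzero_eq_divide_eq)
      then show ?thesis by (simp only: \<eta>_def)
    qed
    finally show "\<eta> * V < \<epsilon> / 3" .
  qed
  have "uniformly_continuous_on B (g k)"
    unfolding B_def by (rule compact_uniformly_continuous [OF continuous_on_subset [OF g subset_UNIV] compact_cball])
  then obtain d where d: "d > 0" "\<And>w w'. \<lbrakk>w \<in> B; w' \<in> B; dist w' w < d\<rbrakk> \<Longrightarrow> dist (g k w') (g k w) < \<eta>"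
    unfolding uniformly_continuous_on_def using \<eta>(1) by blast
  show ?thesis
  proof
    show "min d 1 > 0" using d by simp
    fix t :: "real^2" assume t: "norm t < min d 1"
    let ?r = "\<lambda>z :: complex. min 1 (norm z)"
    have pointwise: "indicator (cball 0 R) w * ?r (f (w + t) - f w)
        \<le> indicator B (w + t) * ?r (f (w + t) - g k (w + t)) + \<eta> * (indicator (cball 0 R) w * 1)
          + indicator B w * ?r (f w - g k w)" for w
    proof (cases "norm w \<le> R")
      case True
      have "norm (w + t) \<le> R + 1" using True t norm_triangle_ineq [of w t] by simp
      then have B: "w \<in> B" "w + t \<in> B" using True by (auto simp: B_def)
      have "dist (g k (w + t)) (g k w) < \<eta>" using t by (intro d(2) B) (simp add: dist_norm)
      moreover have "norm (f (w + t) - f w)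
          \<le> norm (f (w + t) - g k (w + t)) + norm (g k (w + t) - g k w) + norm (f w - g k w)"
      proof -
        have "f (w + t) - f w = (f (w + t) - g k (w + t)) + (g k (w + t) - g k w) - (f w - g k w)" by simp
        then show ?thesis using norm_triangle_ineq4 norm_triangle_ineq by (metis add_right_mono order_trans)
      qed
      ultimately have "?r (f (w + t) - f w) \<le> ?r (f (w + t) - g k (w + t)) + \<eta> + ?r (f w - g k w)"
        using \<eta>(1) norm_ge_zero [of "f (w + t) - g k (w + t)"] norm_ge_zero [of "f w - g k w"]
        unfolding dist_norm min_def by (smt (verit))
      then show ?thesis using B True by simp
    next
      case False
      then show ?thesis using \<eta>(1) by (simp add: indicator_def)
    qed
    have i1: "integrable lborel (\<lambda>w. indicator B w * ?r (f w - g k w))"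
      by (rule integrable_bounded_on_bounded_set [where M = 1]) (auto simp: B_def)
    have i1': "integrable lborel (\<lambda>w. indicator B (w + t) * ?r (f (w + t) - g k (w + t)))"
    proof -
      have "integrable (distr lborel borel ((+) t)) (\<lambda>w. indicator B w * ?r (f w - g k w))"
        using i1 by (simp only: lborel_distr_plus)
      then show ?thesis by (subst (asm) integrable_distr_eq) (auto simp: add.commute)
    qed
    have i2: "integrable lborel (\<lambda>w. indicator (cball (0 :: real^2) R) w * (1 :: real))"
      by (rule integrable_bounded_on_bounded_set [where M = 1]) auto
    have "(LINT w|lborel. indicator (cball 0 R) w * ?r (f (w + t) - f w))
        \<le> (LINT w|lborel. indicator B (w + t) * ?r (f (w + t) - g k (w + t)) + \<eta> * (indicator (cball 0 R) w * 1)
          + indicator B w * ?r (f w - g k w))"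
    proof (rule integral_mono)
      show "integrable lborel (\<lambda>w. indicator (cball 0 R) w * ?r (f (w + t) - f w))"
        by (rule integrable_bounded_on_bounded_set [where M = 1]) auto
    qed (use i1 i1' i2 pointwise in simp_all)
    also have "\<dots> = (LINT w|lborel. indicator B (w + t) * ?r (f (w + t) - g k (w + t)))
        + \<eta> * V + (LINT w|lborel. indicator B w * ?r (f w - g k w))"
      unfolding V_def using i1 i1' i2 by simp
    also have "(LINT w|lborel. indicator B (w + t) * ?r (f (w + t) - g k (w + t)))
        = (LINT w|lborel. indicator B w * ?r (f w - g k w))"
      by (rule integral_lborel_translate [where f = "\<lambda>w. indicator B w * ?r (f w - g k w)"]) simp
    finally show "(LINT w|lborel. indicator (cball 0 R) w * ?r (f (w + t) - f w)) < \<epsilon>"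
      using k \<eta>(2) by linarith
  qed
qed

lemma AE_eq_on_balls:
  fixes f g :: "real^2 \<Rightarrow> complex"
  assumes [measurable]: "f \<in> borel_measurable borel" "g \<in> borel_measurable borel"
    and "\<And>R. (LINT w|lborel. indicator (cball 0 R) w * min 1 (norm (f w - g w))) = 0"
  shows "AE w in lborel. f w = g w"
proof -
  have "AE w in lborel. \<forall>n::nat. indicator (cball 0 (of_nat n)) w * min 1 (norm (f w - g w)) = (0 :: real)"
  proof (subst AE_all_countable, rule allI)
    fix n :: nat
    have "integrable lborel (\<lambda>w. indicator (cball 0 (of_nat n)) w * min 1 (norm (f w - g w)))"
      by (rule integrable_bounded_on_bounded_set [where M = 1]) auto
    then show "AE w in lborel. indicator (cball 0 (of_nat n)) w * min 1 (norm (f w - g w)) = (0 :: real)"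
      using assms(3) [of "of_nat n"] by (subst (asm) integral_nonneg_eq_0_iff_AE) auto
  qed
  then show ?thesis
  proof eventually_elim
    case (elim w)
    obtain n :: nat where "norm w \<le> of_nat n" using real_arch_simple by blast
    then show ?case using elim [rule_format, of n] by (auto simp: min_def split: if_splits)
  qed
qed

text \<open>
  Continuity of translation in measure extends the invariance from \<open>G\<close> to all
  translations. By Fubini almost every \<open>w\<close> satisfies \<open>f (w + a) = f w\<close> for
  almost all \<open>a\<close>, and one such \<open>w\<close> gives the constant.
\<close>
lemma AE_invariant_dense_imp_constant:
  fixes f :: "real^2 \<Rightarrow> complex"
  assumes f [measurable]: "f \<in> borel_measurable borel"
    and inv: "\<And>b. b \<in> G \<Longrightarrow> AE w in lborel. f (w + b) = f w"
    and dense: "\<And>a \<epsilon>. \<epsilon> > 0 \<Longrightarrow> \<exists>b \<in> G. norm (a - b) < \<epsilon>"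
  obtains c where "AE w in lborel. f w = c"
proof -
  have all: "AE w in lborel. f (w + a) = f w" for a
  proof (rule AE_eq_on_balls)
    fix R
    let ?I = "\<lambda>t. LINT w|lborel. indicator (cball 0 R) w * min 1 (norm (f (w + t) - f w))"
    have meas: "(\<lambda>w. indicator (cball 0 R) w * min 1 (norm (f (w + c) - f w)) :: real) \<in> borel_measurable lborel" for c
    proof -
      have "(\<lambda>w. min 1 (norm (f (w + c) - f w))) \<in> borel_measurable borel" by auto
      moreover have "(indicator (cball 0 R) :: real^2 \<Rightarrow> real) \<in> borel_measurable borel"
        by (intro borel_measurable_indicator borel_closed closed_cball)
      ultimately show ?thesis by simp
    qed
    have "?I a \<le> \<epsilon>" if eps: "\<epsilon> > 0" for \<epsilon>
    proof -
      obtain \<delta> where \<delta>: "\<delta> > 0" "\<And>t. norm t < \<delta> \<Longrightarrow> ?I t < \<epsilon>"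
        by (rule translation_continuous_in_measure [OF f eps, where R = R]) (rule that, assumption+)
      obtain b where b: "b \<in> G" "norm (a - b) < \<delta>" using dense [OF \<delta>(1)] by blast
      have "AE w in lborel. f (w + (a - b) + b) = f (w + (a - b))"
        by (rule AE_lborel_translate [OF inv [OF b(1)]])
      then have "AE w in lborel. f (w + a) = f (w + (a - b))" by simp
      then have "?I a = ?I (a - b)"
      proof (intro integral_cong_AE meas)
        assume "AE w in lborel. f (w + a) = f (w + (a - b))"
        then show "AE w in lborel. indicator (cball 0 R) w * min 1 (norm (f (w + a) - f w))
            = (indicator (cball 0 R) w * min 1 (norm (f (w + (a - b)) - f w)) :: real)"
          by eventually_elim simp
      qed
      then show ?thesis using \<delta>(2) [OF b(2)] by simp
    qed
    then have "?I a \<le> 0" by (rule field_le_epsilon [of _ 0, simplified])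
    moreover have "?I a \<ge> 0" by (intro integral_nonneg_AE) auto
    ultimately show "?I a = 0" by linarith
  qed auto
  have "AE a in lborel. AE w in lborel. f (w + a) = f w" using all by simp
  moreover have "(AE a in lborel. AE w in lborel. f (w + a) = f w) \<longleftrightarrow> (AE w in lborel. AE a in lborel. f (w + a) = f w)"
    by (rule lborel_pair.AE_commute) measurable
  ultimately have "AE w in lborel. AE a in lborel. f (w + a) = f w" by blast
  then obtain w where "AE a in lborel. f (w + a) = f w"
    using eventually_happens [of _ "ae_filter lborel"] by (auto simp: ae_filter_eq_bot_iff)
  from AE_lborel_translate [OF this, of "- w"] have "AE a in lborel. f a = f w" by simp
  then show ?thesis using that by blast
qed

text \<open>
  Kronecker's theorem for \<open>\<tau> 1, \<tau> 2, 1\<close>.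
\<close>
lemma irrational_translation_dense:
  fixes \<tau> :: "real^2"
  assumes indep: "\<And>m1 m2 k :: int. of_int m1 * \<tau> $ 1 + of_int m2 * \<tau> $ 2 = of_int k \<Longrightarrow> m1 = 0 \<and> m2 = 0"
    and "\<epsilon> > 0"
  shows "\<exists>k m1 m2 :: int. norm (a - (of_int k *\<^sub>R \<tau> + of_int m1 *\<^sub>R e1 + of_int m2 *\<^sub>R e2)) < \<epsilon>"
proof -
  define \<theta> where "\<theta> = (\<lambda>i :: nat. if i = 0 then \<tau> $ 1 else if i = 1 then \<tau> $ 2 else 1)"
  define x where "x = (\<lambda>i :: nat. if i = 0 then a $ 1 else a $ 2)"
  interpret int_module: Modules.module "\<lambda>r x. real_of_int r * x"
    by (simp add: Modules.module.intro distrib_left mult.commute)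
  have t1: "\<tau> $ 1 \<noteq> 1" "\<tau> $ 2 \<noteq> 1" "\<tau> $ 1 \<noteq> \<tau> $ 2"
    using indep [of 1 0 1] indep [of 0 1 1] indep [of 1 "-1" 0] by auto
  have two: "{..2 :: nat} = {0, 1, 2}" by auto
  have inj: "inj_on \<theta> {..2}" using t1 unfolding two by (auto simp: \<theta>_def inj_on_def)
  have img: "\<theta> ` {..2} = {\<tau> $ 1, \<tau> $ 2, 1}" unfolding two by (auto simp: \<theta>_def)
  have ind: "int_module.independent (\<theta> ` {..2})"
  proof
    assume "int_module.dependent (\<theta> ` {..2})"
    then obtain u :: "real \<Rightarrow> int" and y where y: "y \<in> \<theta> ` {..2}" "u y \<noteq> 0"
      and 0: "(\<Sum>x\<in>\<theta> ` {..2}. of_int (u x) * x) = 0"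
      by (subst (asm) int_module.dependent_finite) auto
    have eq: "of_int (u (\<tau> $ 1)) * \<tau> $ 1 + of_int (u (\<tau> $ 2)) * \<tau> $ 2 + of_int (u 1) = 0"
      using 0 t1 unfolding img by (simp add: add.assoc)
    then have "u (\<tau> $ 1) = 0 \<and> u (\<tau> $ 2) = 0"
      by (intro indep [of _ _ "- u 1"]) (simp add: algebra_simps)
    with eq show False using y unfolding img by auto
  qed
  have "\<theta> 2 = 1" by (simp add: \<theta>_def)
  have "\<epsilon> / 2 > 0" using \<open>\<epsilon> > 0\<close> by simp
  from Kronecker_thm_2 [OF ind inj \<open>\<theta> 2 = 1\<close> this, of x]
  obtain k m where km: "\<And>i. i < 2 \<Longrightarrow> \<bar>of_int k * \<theta> i - of_int (m i) - x i\<bar> < \<epsilon> / 2" by blast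
  let ?b = "of_int k *\<^sub>R \<tau> + of_int (- m 0) *\<^sub>R e1 + of_int (- m 1) *\<^sub>R e2"
  have "\<bar>(a - ?b) $ 1\<bar> < \<epsilon> / 2" "\<bar>(a - ?b) $ 2\<bar> < \<epsilon> / 2"
    using km [of 0] km [of 1] by (auto simp: \<theta>_def x_def axis_def abs_minus_commute algebra_simps)
  then have "norm (a - ?b) < \<epsilon>" using norm_vec2_le [of "a - ?b"] by simp
  then show ?thesis by blast
qed

lemma AE_periodic_int:
  fixes f :: "real^2 \<Rightarrow> 'b" and a :: "real^2"
  assumes "AE w in lborel. f (w + a) = f w"
  shows "AE w in lborel. f (w + of_int k *\<^sub>R a) = f w"
proof (induction k rule: int_induct [where k = 0])
  case (step1 i)
  have "AE w in lborel. f (w + of_int i *\<^sub>R a + a) = f (w + of_int i *\<^sub>R a)"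
    by (rule AE_lborel_translate [OF assms])
  with step1(2) show ?case by eventually_elim (simp add: algebra_simps)
next
  case (step2 i)
  have "AE w in lborel. f (w + of_int (i - 1) *\<^sub>R a + a) = f (w + of_int (i - 1) *\<^sub>R a)"
    by (rule AE_lborel_translate [OF assms])
  with step2(2) show ?case by eventually_elim (simp add: algebra_simps)
qed simp

theorem irrational_translation_ergodic:
  fixes f :: "real^2 \<Rightarrow> complex" and \<tau> :: "real^2"
  assumes f: "f \<in> borel_measurable borel"
    and per: "AE w in lborel. f (w + e1) = f w" "AE w in lborel. f (w + e2) = f w"
    and inv: "AE w in lborel. f (w + \<tau>) = f w"
    and indep: "\<And>m1 m2 k :: int. of_int m1 * \<tau> $ 1 + of_int m2 * \<tau> $ 2 = of_int k \<Longrightarrow> m1 = 0 \<and> m2 = 0"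
  obtains c where "AE w in lborel. f w = c"
proof (rule AE_invariant_dense_imp_constant [OF f])
  let ?G = "{of_int k *\<^sub>R \<tau> + of_int m1 *\<^sub>R e1 + of_int m2 *\<^sub>R e2 | k m1 m2. True}"
  show "AE w in lborel. f (w + b) = f w" if bG: "b \<in> ?G" for b
  proof -
    obtain k m1 m2 where b: "b = of_int k *\<^sub>R \<tau> + of_int m1 *\<^sub>R e1 + of_int m2 *\<^sub>R e2" using bG by blast
    have "AE w in lborel. f (w + of_int k *\<^sub>R \<tau>) = f w" by (rule AE_periodic_int [OF inv])
    moreover have "AE w in lborel. f (w + of_int k *\<^sub>R \<tau> + of_int m1 *\<^sub>R e1) = f (w + of_int k *\<^sub>R \<tau>)"
      by (rule AE_lborel_translate [OF AE_periodic_int [OF per(1)]])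
    moreover have "AE w in lborel. f (w + (of_int k *\<^sub>R \<tau> + of_int m1 *\<^sub>R e1) + of_int m2 *\<^sub>R e2)
        = f (w + (of_int k *\<^sub>R \<tau> + of_int m1 *\<^sub>R e1))"
      by (rule AE_lborel_translate [OF AE_periodic_int [OF per(2)]])
    ultimately show ?thesis by eventually_elim (simp add: b add.assoc)
  qed
  show "\<exists>b \<in> ?G. norm (a - b) < \<epsilon>" if "\<epsilon> > 0" for a \<epsilon>
  proof -
    have "\<exists>k m1 m2 :: int. norm (a - (of_int k *\<^sub>R \<tau> + of_int m1 *\<^sub>R e1 + of_int m2 *\<^sub>R e2)) < \<epsilon>"
      by (rule irrational_translation_dense) (rule indep, assumption, rule that)
    then show ?thesis by blast
  qed
qed (rule that)

definition unit_cell :: "(real^2) set" where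
  "unit_cell = {w. \<forall>i. 0 \<le> w $ i \<and> w $ i < 1}"

lemma borel_measurable_component [measurable]: "(\<lambda>w :: real^2. w $ i) \<in> borel_measurable borel"
  by (intro borel_measurable_continuous_onI continuous_intros)

lemma unit_cell_measurable [measurable]: "unit_cell \<in> sets borel"
proof -
  have "unit_cell = {w. 0 \<le> w $ 1 \<and> w $ 1 < 1 \<and> 0 \<le> w $ 2 \<and> w $ 2 < 1}"
    by (auto simp: unit_cell_def forall_2)
  also have "\<dots> \<in> sets borel" by measurable
  finally show ?thesis .
qed

lemma unit_cell_subset_cball: "unit_cell \<subseteq> cball 0 2"
proof
  fix w assume "w \<in> unit_cell"
  then have "0 \<le> w $ 1 \<and> w $ 1 < 1" "0 \<le> w $ 2 \<and> w $ 2 < 1" by (auto simp: unit_cell_def)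
  then show "w \<in> cball 0 2" using norm_vec2_le [of w] by auto
qed

lemma integrable_unit_cell:
  fixes f :: "real^2 \<Rightarrow> real"
  assumes "f \<in> borel_measurable borel" "\<And>w. \<bar>f w\<bar> \<le> M"
  shows "integrable lborel (\<lambda>w. indicator unit_cell w * f w)"
  using assms bounded_subset [OF bounded_cball unit_cell_subset_cball]
  by (intro integrable_bounded_on_bounded_set [where M = M]) auto

lemma unit_cell_integral_1: "(LINT w|lborel. indicator unit_cell w * (1 :: real)) > 0"
proof -
  have sub: "box 0 1 \<subseteq> unit_cell"
    by (auto simp: unit_cell_def mem_box_cart less_imp_le)
  have fin: "emeasure lborel unit_cell < \<infinity>"
    using emeasure_bounded_finite [OF bounded_subset [OF bounded_cball unit_cell_subset_cball]]
    by (simp add: top.not_eq_extremum)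
  have "0 < measure lborel (box (0 :: real^2) 1)"
    by (subst measure_lborel_box_eq) (auto simp: Basis_vec_def inner_axis intro!: prod_pos)
  also have "\<dots> \<le> measure lborel unit_cell"
    using sub fin by (intro measure_mono_fmeasurable) (auto simp: fmeasurable_def)
  finally show ?thesis by simp
qed

text \<open>
  With \<open>I a b\<close> the integral over the slab \<open>a \<le> w j < b\<close> of the cell,
  both \<open>I 0 1 + I 1 (r + 1)\<close> and \<open>I 0 r + I r (r + 1)\<close> equal \<open>I 0 (r +
  1)\<close>, and \<open>I 0 r = I 1 (r + 1)\<close> by periodicity. This needs no case distinction on
  the integer part of \<open>r\<close>.
\<close>
lemma unit_cell_integral_translate_axis_nonneg:
  fixes f :: "real^2 \<Rightarrow> real"
  assumes [measurable]: "f \<in> borel_measurable borel" and M: "\<And>w. \<bar>f w\<bar> \<le> M"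
    and per: "AE w in lborel. f (w + axis j 1) = f w" and "r \<ge> 0"
  shows "(LINT w|lborel. indicator unit_cell w * f (w + r *\<^sub>R axis j 1)) = (LINT w|lborel. indicator unit_cell w * f w)"
proof -
  define e :: "real^2" where "e = axis j 1"
  define S where "S = (\<lambda>a b. {w :: real^2. a \<le> w $ j \<and> w $ j < b \<and> (\<forall>i. i \<noteq> j \<longrightarrow> 0 \<le> w $ i \<and> w $ i < 1)})"
  have S_meas [measurable]: "S a b \<in> sets borel" for a b
  proof -
    have "S a b = {w. a \<le> w $ j \<and> w $ j < b \<and> (1 \<noteq> j \<longrightarrow> 0 \<le> w $ 1 \<and> w $ 1 < 1) \<and> (2 \<noteq> j \<longrightarrow> 0 \<le> w $ 2 \<and> w $ 2 < 1)}"
      by (auto simp: S_def forall_2)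
    also have "\<dots> \<in> sets borel" by measurable
    finally show ?thesis .
  qed
  have cell: "unit_cell = S 0 1" by (auto simp: unit_cell_def S_def)
  have comp: "e $ i = (if i = j then 1 else 0)" for i
    by (simp add: e_def axis_def)
  have shift: "w + c *\<^sub>R e \<in> S (a + c) (b + c) \<longleftrightarrow> w \<in> S a b" for w a b c
    by (auto simp: S_def comp)
  have bddS: "bounded (S a b)" for a b
  proof (rule bounded_subset [OF bounded_cball])
    show "S a b \<subseteq> cball 0 (2 * (\<bar>a\<bar> + \<bar>b\<bar> + 1))"
    proof
      fix w assume w: "w \<in> S a b"
      have "\<bar>w $ i\<bar> \<le> \<bar>a\<bar> + \<bar>b\<bar> + 1" for i
        using w by (cases "i = j") (auto simp: S_def)
      from this [of 1] this [of 2] norm_vec2_le [of w] show "w \<in> cball 0 (2 * (\<bar>a\<bar> + \<bar>b\<bar> + 1))" by simp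
    qed
  qed
  define I where "I = (\<lambda>a b. LINT w|lborel. indicator (S a b) w * f w)"
  have int: "integrable lborel (\<lambda>w. indicator (S a b) w * f w)" for a b
    using bddS M by (intro integrable_bounded_on_bounded_set [where M = M]) auto
  have split: "I a b + I b c = I a c" if "a \<le> b" "b \<le> c" for a b c
  proof -
    have "I a b + I b c = (LINT w|lborel. indicator (S a b) w * f w + indicator (S b c) w * f w)"
      unfolding I_def using int by simp
    also have "\<dots> = I a c" unfolding I_def
      using that by (intro Bochner_Integration.integral_cong) (auto simp: indicator_def S_def)
    finally show ?thesis .
  qed
  have translated: "(LINT w|lborel. indicator (S a b) w * f (w + c *\<^sub>R e)) = I (a + c) (b + c)" for a b c
  proof -
    have "(LINT w|lborel. indicator (S a b) w * f (w + c *\<^sub>R e))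
        = (LINT w|lborel. indicator (S (a + c) (b + c)) (w + c *\<^sub>R e) * f (w + c *\<^sub>R e))"
      by (intro Bochner_Integration.integral_cong) (auto simp: indicator_def shift)
    also have "\<dots> = I (a + c) (b + c)" unfolding I_def
      by (rule integral_lborel_translate [where f = "\<lambda>w. indicator (S (a + c) (b + c)) w * f w"]) simp
    finally show ?thesis .
  qed
  have "I 0 r = (LINT w|lborel. indicator (S 0 r) w * f (w + 1 *\<^sub>R e))"
    unfolding I_def using per by (intro integral_cong_AE) (auto simp: e_def elim!: eventually_mono)
  also have "\<dots> = I 1 (r + 1)" by (subst translated) simp
  finally have "I 0 r = I 1 (r + 1)" .
  moreover have "I 0 1 + I 1 (r + 1) = I 0 r + I r (r + 1)"
    using split [of 0 1 "r + 1"] split [of 0 r "r + 1"] \<open>r \<ge> 0\<close> by simp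
  ultimately have "I r (r + 1) = I 0 1" by simp
  then show ?thesis using translated [of 0 1 r] by (simp add: cell I_def e_def add.commute)
qed

lemma unit_cell_integral_translate_axis:
  fixes f :: "real^2 \<Rightarrow> real"
  assumes f [measurable]: "f \<in> borel_measurable borel" and M: "\<And>w. \<bar>f w\<bar> \<le> M"
    and per: "AE w in lborel. f (w + axis j 1) = f w"
  shows "(LINT w|lborel. indicator unit_cell w * f (w + r *\<^sub>R axis j 1)) = (LINT w|lborel. indicator unit_cell w * f w)"
proof (cases "r \<ge> 0")
  case True
  then show ?thesis by (rule unit_cell_integral_translate_axis_nonneg [OF assms])
next
  case False
  let ?g = "\<lambda>w. f (w + r *\<^sub>R axis j 1)"
  have "AE w in lborel. f (w + r *\<^sub>R axis j 1 + axis j 1) = f (w + r *\<^sub>R axis j 1)"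
    by (rule AE_lborel_translate [OF per])
  then have "AE w in lborel. ?g (w + axis j 1) = ?g w" by (simp add: add_ac)
  then have "(LINT w|lborel. indicator unit_cell w * ?g (w + (- r) *\<^sub>R axis j 1)) = (LINT w|lborel. indicator unit_cell w * ?g w)"
    using False M by (intro unit_cell_integral_translate_axis_nonneg [where M = M]) auto
  then show ?thesis by simp
qed

lemma unit_cell_integral_translate:
  fixes f :: "real^2 \<Rightarrow> real"
  assumes f [measurable]: "f \<in> borel_measurable borel" and M: "\<And>w. \<bar>f w\<bar> \<le> M"
    and per: "AE w in lborel. f (w + e1) = f w" "AE w in lborel. f (w + e2) = f w"
  shows "(LINT w|lborel. indicator unit_cell w * f (w + a)) = (LINT w|lborel. indicator unit_cell w * f w)"
proof -
  have a: "w + a = w + (a $ 1) *\<^sub>R e1 + (a $ 2) *\<^sub>R e2" for w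
    by (simp add: vec_eq_iff forall_2 axis_def)
  have "AE w in lborel. f (w + (a $ 2) *\<^sub>R e2 + e1) = f (w + (a $ 2) *\<^sub>R e2)"
    by (rule AE_lborel_translate [OF per(1)])
  then have "AE w in lborel. f (w + e1 + (a $ 2) *\<^sub>R e2) = f (w + (a $ 2) *\<^sub>R e2)" by (simp add: add_ac)
  then have "(LINT w|lborel. indicator unit_cell w * f (w + (a $ 1) *\<^sub>R e1 + (a $ 2) *\<^sub>R e2))
      = (LINT w|lborel. indicator unit_cell w * f (w + (a $ 2) *\<^sub>R e2))"
    using M by (intro unit_cell_integral_translate_axis [where f = "\<lambda>w. f (w + (a $ 2) *\<^sub>R e2)"]) auto
  also have "\<dots> = (LINT w|lborel. indicator unit_cell w * f w)"
    using M per(2) by (intro unit_cell_integral_translate_axis) auto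
  finally show ?thesis by (simp add: a)
qed

section \<open>Winding against a measurable transfer function\<close>

lemma norm_ee_of_real [simp]: "norm (ee (of_real x)) = 1"
proof -
  have "2 * complex_of_real pi * \<i> * of_real x = \<i> * of_real (2 * pi * x)" by simp
  then show ?thesis unfolding ee_def by (simp only: norm_exp_i_times)
qed

lemma cnj_ee_of_real: "cnj (ee (of_real x)) = ee (of_real (- x))"
  by (simp add: ee_def exp_cnj)

lemma sgn_ee: "sgn (ee z) = ee (of_real (Re z))"
proof -
  have "ee z = of_real (exp (- 2 * pi * Im z)) * ee (of_real (Re z))"
    unfolding ee_def exp_of_real [symmetric] exp_add [symmetric]
    by (rule arg_cong [of _ _ exp]) (simp add: complex_eq_iff)
  then show ?thesis by (simp add: sgn_mult sgn_of_real) (simp add: sgn_div_norm)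
qed

text \<open>
  The principal argument measured in full turns, with values in \<open>(- 1/2, 1/2]\<close> on nonzero
  numbers.
\<close>
definition arg_turn :: "complex \<Rightarrow> real" where
  "arg_turn v = Im (Ln v) / (2 * pi)"

lemma borel_measurable_arg_turn [measurable]: "arg_turn \<in> borel_measurable borel"
  unfolding arg_turn_def by measurable

lemma ee_arg_turn:
  assumes "norm v = 1" shows "ee (of_real (arg_turn v)) = v"
proof -
  have "v \<noteq> 0" using assms by auto
  then have "Re (Ln v) = 0" using assms by simp
  then have "Ln v = \<i> * of_real (Im (Ln v))" by (simp add: complex_eq_iff)
  moreover have "2 * complex_of_real pi * \<i> * of_real (arg_turn v) = \<i> * of_real (Im (Ln v))"
    by (simp add: arg_turn_def)
  ultimately show ?thesis using \<open>v \<noteq> 0\<close> unfolding ee_def by (metis exp_Ln)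
qed

text \<open>
  Close to \<open>1\<close> the logarithm is bounded by twice the chord, and twice the chord is less
  than \<open>2 pi\<close> times it; elsewhere the chord is at least \<open>1/2\<close>, the largest
  possible value in turns.
\<close>
lemma arg_turn_le:
  assumes "norm v = 1" shows "\<bar>arg_turn v\<bar> \<le> min 1 (norm (v - 1))" and "\<bar>arg_turn v\<bar> \<le> 1"
proof -
  have "v \<noteq> 0" using assms by auto
  then have "\<bar>Im (Ln v)\<bar> \<le> pi" using Im_Ln_le_pi [of v] mpi_less_Im_Ln [of v] by linarith
  then have half: "\<bar>arg_turn v\<bar> \<le> 1 / 2" by (simp add: arg_turn_def abs_divide divide_le_eq)
  have "\<bar>arg_turn v\<bar> \<le> norm (v - 1)"
  proof (cases "norm (v - 1) < 1 / 2")
    case True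
    then have "norm (Ln (1 + (v - 1))) \<le> 2 * norm (v - 1)" by (rule norm_Ln_le)
    then have "\<bar>Im (Ln v)\<bar> \<le> 2 * norm (v - 1)" using abs_Im_le_cmod [of "Ln v"] by simp
    also have "\<dots> \<le> 2 * pi * norm (v - 1)"
      using pi_gt3 mult_right_mono [of 1 pi "norm (v - 1)"] by simp
    finally show ?thesis by (simp add: arg_turn_def abs_divide divide_le_eq mult_ac)
  next
    case False
    then show ?thesis using half by linarith
  qed
  then show "\<bar>arg_turn v\<bar> \<le> min 1 (norm (v - 1))" "\<bar>arg_turn v\<bar> \<le> 1" using half by auto
qed

lemma AE_iterate_translation:
  fixes u :: "real^2 \<Rightarrow> complex" and B :: "real^2 \<Rightarrow> real"
  assumes "AE w in lborel. u (w + \<tau>) = \<sigma> * ee (of_real (B w)) * u w"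
  shows "AE w in lborel. u (w + of_nat m *\<^sub>R \<tau>) = \<sigma> ^ m * ee (of_real (\<Sum>i<m. B (w + of_nat i *\<^sub>R \<tau>))) * u w"
proof (induction m)
  case (Suc m)
  have "AE w in lborel. u (w + of_nat m *\<^sub>R \<tau> + \<tau>)
      = \<sigma> * ee (of_real (B (w + of_nat m *\<^sub>R \<tau>))) * u (w + of_nat m *\<^sub>R \<tau>)"
    by (rule AE_lborel_translate [OF assms])
  with Suc show ?case by eventually_elim (simp add: algebra_simps ee_add)
qed simp

text \<open>
  The function \<open>k\<close> counts how often the argument of \<open>v\<close> jumps along
  \<open>m\<close> steps of the translation. Its mean is minus the mean \<open>m \<rho> t\<close> of
  \<open>Dm\<close>, as \<open>\<theta>\<close> and its translate have equal means, and it is nonzero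
  only if \<open>\<theta>\<close> is not small at one of the two points.
\<close>
lemma winding_bound:
  fixes u :: "real^2 \<Rightarrow> complex" and B :: "real^2 \<Rightarrow> real" and m :: nat
  assumes u [measurable]: "u \<in> borel_measurable borel" and norm_u: "\<And>w. norm (u w) = 1"
    and per1: "AE w in lborel. u (w + e1) = u w"
    and per2: "AE w in lborel. u (w + e2) = ee (- of_int n * of_real (w $ 1)) * u w"
    and inv: "AE w in lborel. u (w + \<tau>) = \<sigma> * ee (of_real (B w)) * u w" and \<sigma>: "norm \<sigma> = 1"
    and B: "continuous_on UNIV B" and B1: "\<And>w. B (w + e1) = B w + p" and B2: "\<And>w. B (w + e2) = B w + \<rho>"
    and small: "\<And>w. of_nat m * \<bar>B (w + t *\<^sub>R e2) - B w\<bar> \<le> 1 / 4"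
  shows "\<bar>\<rho>\<bar> * (of_nat m * \<bar>t\<bar>) * (LINT w|lborel. indicator unit_cell w * 1)
    \<le> 8 / 3 * (LINT w|lborel. indicator (cball 0 2) w * min 1 (norm (u (w + t *\<^sub>R e2) - u w)))"
proof -
  let ?m = "of_nat m *\<^sub>R \<tau>"
  have B_meas [measurable]: "B \<in> borel_measurable borel" by (rule borel_measurable_continuous_onI [OF B])
  define D where "D = (\<lambda>w. B (w + t *\<^sub>R e2) - B w)"
  define Dm where "Dm = (\<lambda>w. \<Sum>i<m. D (w + of_nat i *\<^sub>R \<tau>))"
  define v where "v = (\<lambda>w. u (w + t *\<^sub>R e2) * cnj (u w))"
  define \<theta> where "\<theta> = (\<lambda>w. arg_turn (v w))"
  define k where "k = (\<lambda>w. \<theta> (w + ?m) - \<theta> w - Dm w)"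
  have D_meas [measurable]: "D \<in> borel_measurable borel" unfolding D_def by measurable
  have Dm_meas [measurable]: "Dm \<in> borel_measurable borel" unfolding Dm_def by measurable
  have v_meas [measurable]: "v \<in> borel_measurable borel"
    unfolding v_def by (intro borel_measurable_times borel_measurable_continuous_on [where f = cnj])
      (auto intro: continuous_intros)
  have \<theta>_meas [measurable]: "\<theta> \<in> borel_measurable borel" unfolding \<theta>_def by measurable
  have norm_v: "norm (v w) = 1" for w by (simp add: v_def norm_mult norm_u)
  have ucnj: "u w * cnj (u w) = 1" for w
    using complex_norm_square [of "u w"] norm_u [of w] by simp
  have v1: "v w - 1 = (u (w + t *\<^sub>R e2) - u w) * cnj (u w)" for w
    using ucnj [of w] by (simp add: v_def algebra_simps)
  have \<theta>1: "\<bar>\<theta> w\<bar> \<le> min 1 (norm (u (w + t *\<^sub>R e2) - u w))" and \<theta>2: "\<bar>\<theta> w\<bar> \<le> 1" for w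
    using arg_turn_le [OF norm_v, of w] by (simp_all add: \<theta>_def v1 norm_mult norm_u)
  have v_per1: "AE w in lborel. v (w + e1) = v w"
  proof -
    have "AE w in lborel. u (w + t *\<^sub>R e2 + e1) = u (w + t *\<^sub>R e2)" by (rule AE_lborel_translate [OF per1])
    with per1 show ?thesis
    proof eventually_elim
      case (elim w)
      have "w + e1 + t *\<^sub>R e2 = w + t *\<^sub>R e2 + e1" by simp
      then show ?case by (simp only: v_def elim)
    qed
  qed
  have v_per2: "AE w in lborel. v (w + e2) = v w"
  proof -
    have "AE w in lborel. u (w + t *\<^sub>R e2 + e2) = ee (- of_int n * of_real ((w + t *\<^sub>R e2) $ 1)) * u (w + t *\<^sub>R e2)"
      by (rule AE_lborel_translate [OF per2])
    with per2 show ?thesis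
    proof eventually_elim
      case (elim w)
      have c1: "(w + t *\<^sub>R e2) $ 1 = w $ 1" by (simp add: axis_def)
      have c2: "w + e2 + t *\<^sub>R e2 = w + t *\<^sub>R e2 + e2" by simp
      have "ee (- of_int n * of_real (w $ 1)) = ee (of_real (- of_int n * w $ 1))" by simp
      then have unit: "ee (- of_int n * of_real (w $ 1)) * cnj (ee (- of_int n * of_real (w $ 1))) = 1"
        by (simp only: cnj_ee_of_real flip: ee_add of_real_add) simp
      have "v (w + e2) = (ee (- of_int n * of_real (w $ 1)) * cnj (ee (- of_int n * of_real (w $ 1)))) * v w"
        unfolding v_def c2 elim c1 complex_cnj_mult by (simp only: mult_ac)
      then show ?case by (simp only: unit) simp
    qed
  qed
  have \<theta>_per: "AE w in lborel. \<theta> (w + e1) = \<theta> w" "AE w in lborel. \<theta> (w + e2) = \<theta> w"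
    unfolding \<theta>_def by (rule eventually_mono [OF v_per1], simp) (rule eventually_mono [OF v_per2], simp)
  have v_inv: "AE w in lborel. v (w + ?m) = ee (of_real (Dm w)) * v w"
  proof -
    note it = AE_iterate_translation [OF inv, of m]
    from AE_lborel_translate [OF it, of "t *\<^sub>R e2"] it show ?thesis
    proof eventually_elim
      case (elim w)
      let ?S = "\<lambda>w. \<Sum>i<m. B (w + of_nat i *\<^sub>R \<tau>)"
      have c: "w + ?m + t *\<^sub>R e2 = w + t *\<^sub>R e2 + ?m" by simp
      have "cmod (\<sigma> ^ m) = 1" using \<sigma> by (simp add: norm_power)
      then have \<sigma>m: "\<sigma> ^ m * cnj (\<sigma> ^ m) = 1" using complex_norm_square [of "\<sigma> ^ m"] by simp
      have "v (w + ?m) = (\<sigma> ^ m * cnj (\<sigma> ^ m))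
          * (ee (of_real (?S (w + t *\<^sub>R e2))) * cnj (ee (of_real (?S w)))) * v w"
        unfolding v_def c elim complex_cnj_mult by (simp only: mult_ac)
      also have "\<dots> = ee (of_real (?S (w + t *\<^sub>R e2) - ?S w)) * v w"
        unfolding \<sigma>m cnj_ee_of_real by (simp flip: ee_add)
      also have "?S (w + t *\<^sub>R e2) - ?S w = Dm w"
        by (simp add: Dm_def D_def sum_subtractf add_ac)
      finally show ?case .
    qed
  qed
  have Dm_le: "\<bar>Dm w\<bar> \<le> 1 / 4" for w
  proof (cases "m = 0")
    case False
    have "\<bar>Dm w\<bar> \<le> (\<Sum>i<m. \<bar>D (w + of_nat i *\<^sub>R \<tau>)\<bar>)" unfolding Dm_def by (rule sum_abs)
    also have "\<dots> \<le> (\<Sum>i<m. 1 / (4 * of_nat m))"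
    proof (rule sum_mono)
      fix i
      show "\<bar>D (w + of_nat i *\<^sub>R \<tau>)\<bar> \<le> 1 / (4 * of_nat m)"
        using small [of "w + of_nat i *\<^sub>R \<tau>"] False by (simp add: D_def field_simps)
    qed
    finally show ?thesis using False by simp
  qed (simp add: Dm_def)
  \<comment> \<open>Being an integer, \<open>k\<close> is either zero or at least \<open>1\<close> in modulus,
    which absorbs the bound \<open>1/4\<close> on \<open>Dm\<close>.\<close>
  have k_le: "AE w in lborel. \<bar>k w\<bar> \<le> 4 / 3 * (\<bar>\<theta> (w + ?m)\<bar> + \<bar>\<theta> w\<bar>)"
    using v_inv
  proof eventually_elim
    case (elim w)
    have "ee (of_real (\<theta> (w + ?m))) = ee (of_real (Dm w)) * ee (of_real (\<theta> w))"
      unfolding \<theta>_def ee_arg_turn [OF norm_v] by (rule elim)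
    then have "ee (of_real (k w)) = 1" by (simp add: k_def ee_diff)
    then have "complex_of_real (k w) \<in> \<int>" by (simp only: ee_eq_1_iff)
    then obtain j :: int where "complex_of_real (k w) = of_int j" by (auto elim: Ints_cases)
    then have j: "k w = of_int j" by (metis Re_complex_of_real of_real_of_int_eq)
    show ?case
    proof (cases "j = 0")
      case False
      then have "1 \<le> \<bar>real_of_int j\<bar>" by linarith
      then have "1 \<le> \<bar>k w\<bar>" by (simp add: j)
      moreover have "\<bar>k w\<bar> \<le> \<bar>\<theta> (w + ?m)\<bar> + \<bar>\<theta> w\<bar> + \<bar>Dm w\<bar>" unfolding k_def by (simp; linarith)
      ultimately show ?thesis using Dm_le [of w] by argo
    qed (simp add: j)
  qed
  have D_per1: "D (w + e1) = D w" and D_per2: "D (w + e2) = D w" for w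
  proof -
    have "w + e1 + t *\<^sub>R e2 = w + t *\<^sub>R e2 + e1" "w + e2 + t *\<^sub>R e2 = w + t *\<^sub>R e2 + e2" by simp_all
    then show "D (w + e1) = D w" "D (w + e2) = D w" by (simp_all only: D_def B1 B2 add_diff_cancel_right)
  qed
  \<comment> \<open>Only the linear part of \<open>B\<close> contributes to the mean of \<open>D\<close>; the
    remainder is periodic and its two translates have equal means.\<close>
  define \<psi> where "\<psi> = (\<lambda>w. B w - p * w $ 1 - \<rho> * w $ 2)"
  have \<psi>_meas [measurable]: "\<psi> \<in> borel_measurable borel" unfolding \<psi>_def by measurable
  have ax: "e1 $ 1 = (1 :: real)" "e1 $ 2 = (0 :: real)" "e2 $ 1 = (0 :: real)" "e2 $ 2 = (1 :: real)"
    by (simp_all add: axis_def)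
  have \<psi>_per: "\<psi> (w + e1) = \<psi> w" "\<psi> (w + e2) = \<psi> w" for w
    by (simp_all add: \<psi>_def B1 B2 ax distrib_left)
  have "continuous_on UNIV \<psi>" unfolding \<psi>_def by (intro continuous_intros B)
  then have "compact (\<psi> ` cball 0 2)"
    by (intro compact_continuous_image compact_cball) (rule continuous_on_subset, auto)
  then obtain M where "\<forall>x\<in>cball 0 2. \<bar>\<psi> x\<bar> \<le> M"
    using compact_imp_bounded [of "\<psi> ` cball 0 2"] by (auto simp: bounded_iff)
  then have \<psi>_bdd: "\<bar>\<psi> w\<bar> \<le> M" for w
  proof -
    obtain a b where ab: "norm (w + of_int a *\<^sub>R e1 + of_int b *\<^sub>R e2) \<le> 2" by (rule lattice_reduction)
    have "\<psi> (w + of_int a *\<^sub>R e1 + of_int b *\<^sub>R e2) = \<psi> w" by (rule periodic_lattice [OF \<psi>_per])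
    with ab \<open>\<forall>x\<in>cball 0 2. \<bar>\<psi> x\<bar> \<le> M\<close> show ?thesis by (metis mem_cball_0)
  qed
  have D_eq: "D w = \<rho> * t + \<psi> (w + t *\<^sub>R e2) - \<psi> w" for w
    by (simp add: D_def \<psi>_def ax distrib_left)
  have D_bdd: "\<bar>D w\<bar> \<le> \<bar>\<rho> * t\<bar> + 2 * M" for w
    using \<psi>_bdd [of "w + t *\<^sub>R e2"] \<psi>_bdd [of w] unfolding D_eq by linarith
  let ?I = "\<lambda>f. LINT w|lborel. indicator unit_cell w * (f w :: real)"
  have D_int: "?I D = \<rho> * t * ?I (\<lambda>_. 1)"
  proof -
    have "?I D = (LINT w|lborel. (\<rho> * t) * (indicator unit_cell w * 1)
        + indicator unit_cell w * \<psi> (w + t *\<^sub>R e2) - indicator unit_cell w * \<psi> w)"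
      by (intro Bochner_Integration.integral_cong) (simp_all add: D_eq algebra_simps)
    also have "\<dots> = \<rho> * t * ?I (\<lambda>_. 1) + ?I (\<lambda>w. \<psi> (w + t *\<^sub>R e2)) - ?I \<psi>"
    proof -
      have "integrable lborel (\<lambda>w. indicator unit_cell w * (1 :: real))"
        by (rule integrable_unit_cell [where M = 1]) auto
      moreover have "integrable lborel (\<lambda>w. indicator unit_cell w * \<psi> w)"
        "integrable lborel (\<lambda>w. indicator unit_cell w * \<psi> (w + t *\<^sub>R e2))"
        using \<psi>_bdd by (auto intro!: integrable_unit_cell [where M = M])
      ultimately show ?thesis by simp
    qed
    also have "?I (\<lambda>w. \<psi> (w + t *\<^sub>R e2)) = ?I \<psi>"
      by (rule unit_cell_integral_translate [where M = M]) (simp_all add: \<psi>_bdd \<psi>_per)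
    finally show ?thesis by simp
  qed
  have D_trans: "?I (\<lambda>w. D (w + a)) = ?I D" for a
    by (rule unit_cell_integral_translate [OF D_meas D_bdd]) (simp_all add: D_per1 D_per2)
  have Dm_int: "?I Dm = of_nat m * (\<rho> * t * ?I (\<lambda>_. 1))"
  proof -
    have "?I Dm = (LINT w|lborel. (\<Sum>i<m. indicator unit_cell w * D (w + of_nat i *\<^sub>R \<tau>)))"
      by (simp add: Dm_def sum_distrib_left)
    also have "\<dots> = (\<Sum>i<m. ?I (\<lambda>w. D (w + of_nat i *\<^sub>R \<tau>)))"
      using D_bdd by (intro Bochner_Integration.integral_sum integrable_unit_cell) auto
    also have "\<dots> = of_nat m * ?I D" by (simp only: D_trans sum_constant card_lessThan)
    finally show ?thesis by (simp only: D_int)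
  qed
  have ints: "integrable lborel (\<lambda>w. indicator unit_cell w * \<theta> w)"
    "integrable lborel (\<lambda>w. indicator unit_cell w * \<theta> (w + ?m))"
    "integrable lborel (\<lambda>w. indicator unit_cell w * \<bar>\<theta> w\<bar>)"
    "integrable lborel (\<lambda>w. indicator unit_cell w * \<bar>\<theta> (w + ?m)\<bar>)"
    using \<theta>2 by (auto intro!: integrable_unit_cell [where M = 1])
  have int_Dm: "integrable lborel (\<lambda>w. indicator unit_cell w * Dm w)"
    using Dm_le by (intro integrable_unit_cell [where M = "1 / 4"]) auto
  have "?I k = ?I (\<lambda>w. \<theta> (w + ?m)) - ?I \<theta> - ?I Dm"
    using ints int_Dm by (simp add: k_def right_diff_distrib)
  also have "?I (\<lambda>w. \<theta> (w + ?m)) = ?I \<theta>"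
    by (rule unit_cell_integral_translate [OF \<theta>_meas \<theta>2 \<theta>_per])
  finally have "?I k = - (of_nat m * (\<rho> * t * ?I (\<lambda>_. 1)))" by (simp add: Dm_int)
  then have "\<bar>?I k\<bar> = \<bar>\<rho>\<bar> * (of_nat m * \<bar>t\<bar>) * ?I (\<lambda>_. 1)"
    using unit_cell_integral_1 by (simp add: abs_mult mult_ac)
  moreover have "\<bar>?I k\<bar> \<le> (LINT w|lborel. \<bar>indicator unit_cell w * k w\<bar>)" by (rule integral_abs_bound)
  moreover have "(LINT w|lborel. \<bar>indicator unit_cell w * k w\<bar>)
      \<le> (LINT w|lborel. 4 / 3 * (indicator unit_cell w * \<bar>\<theta> (w + ?m)\<bar> + indicator unit_cell w * \<bar>\<theta> w\<bar>))"
  proof (rule integral_mono_AE)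
    have "integrable lborel (\<lambda>w. indicator unit_cell w * k w)"
      using ints int_Dm by (simp add: k_def right_diff_distrib)
    then show "integrable lborel (\<lambda>w. \<bar>indicator unit_cell w * k w\<bar>)" by (rule integrable_abs)
    show "AE w in lborel. \<bar>indicator unit_cell w * k w\<bar>
        \<le> 4 / 3 * (indicator unit_cell w * \<bar>\<theta> (w + ?m)\<bar> + indicator unit_cell w * \<bar>\<theta> w\<bar>)"
      using k_le by eventually_elim (auto simp: indicator_def)
  qed (use ints in simp)
  moreover have "(LINT w|lborel. 4 / 3 * (indicator unit_cell w * \<bar>\<theta> (w + ?m)\<bar> + indicator unit_cell w * \<bar>\<theta> w\<bar>))
      = 8 / 3 * ?I (\<lambda>w. \<bar>\<theta> w\<bar>)"
  proof -
    have "?I (\<lambda>w. \<bar>\<theta> (w + ?m)\<bar>) = ?I (\<lambda>w. \<bar>\<theta> w\<bar>)"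
    proof (rule unit_cell_integral_translate [where M = 1 and f = "\<lambda>w. \<bar>\<theta> w\<bar>"])
      show "AE w in lborel. \<bar>\<theta> (w + e1)\<bar> = \<bar>\<theta> w\<bar>" "AE w in lborel. \<bar>\<theta> (w + e2)\<bar> = \<bar>\<theta> w\<bar>"
        by (rule eventually_mono [OF \<theta>_per(1)], simp) (rule eventually_mono [OF \<theta>_per(2)], simp)
    qed (use \<theta>2 in auto)
    then show ?thesis using ints by simp
  qed
  moreover have "?I (\<lambda>w. \<bar>\<theta> w\<bar>) \<le> (LINT w|lborel. indicator (cball 0 2) w * min 1 (norm (u (w + t *\<^sub>R e2) - u w)))"
  proof (rule integral_mono)
    show "integrable lborel (\<lambda>w. indicator (cball 0 2) w * min 1 (norm (u (w + t *\<^sub>R e2) - u w)))"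
      by (rule integrable_bounded_on_bounded_set [where M = 1]) auto
    show "indicator unit_cell w * \<bar>\<theta> w\<bar> \<le> indicator (cball 0 2) w * min 1 (norm (u (w + t *\<^sub>R e2) - u w))" for w
    proof (cases "w \<in> unit_cell")
      case True
      then have "w \<in> cball 0 2" using unit_cell_subset_cball by blast
      then show ?thesis using True \<theta>1 [of w] by simp
    next
      case False
      then show ?thesis by (simp add: indicator_def)
    qed
  qed (use ints in simp)
  ultimately show ?thesis by linarith
qed

text \<open>
  In the bound of the preceding lemma choose \<open>t = \<epsilon> / m\<close>. The left side is then
  \<open>|\<rho>| \<epsilon>\<close> times a positive constant for every \<open>m\<close>, while the
  right side tends to \<open>0\<close>. Lipschitz continuity of \<open>B\<close> is what keeps the
  differences over the distance \<open>\<epsilon> / m\<close> summable to at most \<open>1/4\<close>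
  over \<open>m\<close> steps.
\<close>
theorem measurable_transfer_imp_no_drift:
  fixes u :: "real^2 \<Rightarrow> complex" and B :: "real^2 \<Rightarrow> real"
  assumes u: "u \<in> borel_measurable borel" and norm_u: "\<And>w. norm (u w) = 1"
    and per1: "AE w in lborel. u (w + e1) = u w"
    and per2: "AE w in lborel. u (w + e2) = ee (- of_int n * of_real (w $ 1)) * u w"
    and inv: "AE w in lborel. u (w + \<tau>) = \<sigma> * ee (of_real (B w)) * u w" and \<sigma>: "norm \<sigma> = 1"
    and B: "ball_Lipschitz B" and B1: "\<And>w. B (w + e1) = B w + p" and B2: "\<And>w. B (w + e2) = B w + \<rho>"
  shows "\<rho> = 0"
proof (rule ccontr)
  assume "\<rho> \<noteq> 0"
  obtain L where L: "L \<ge> 0" "\<And>x y. \<lbrakk>norm x \<le> 3; norm y \<le> 3\<rbrakk> \<Longrightarrow> dist (B x) (B y) \<le> L * norm (x - y)"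
    by (rule ball_LipschitzE [OF B, where R = 3]) (rule that, assumption+)
  have lip: "\<bar>B (w + t *\<^sub>R e2) - B w\<bar> \<le> L * \<bar>t\<bar>" if "\<bar>t\<bar> \<le> 1" for w t
  proof -
    obtain a b where ab: "norm (w + of_int a *\<^sub>R e1 + of_int b *\<^sub>R e2) \<le> 2" by (rule lattice_reduction)
    let ?w = "w + of_int a *\<^sub>R e1 + of_int b *\<^sub>R e2"
    have D1: "B (w + e1 + t *\<^sub>R e2) - B (w + e1) = B (w + t *\<^sub>R e2) - B w"
      and D2: "B (w + e2 + t *\<^sub>R e2) - B (w + e2) = B (w + t *\<^sub>R e2) - B w" for w
    proof -
      have "w + e1 + t *\<^sub>R e2 = w + t *\<^sub>R e2 + e1" "w + e2 + t *\<^sub>R e2 = w + t *\<^sub>R e2 + e2" by simp_all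
      then show "B (w + e1 + t *\<^sub>R e2) - B (w + e1) = B (w + t *\<^sub>R e2) - B w"
        "B (w + e2 + t *\<^sub>R e2) - B (w + e2) = B (w + t *\<^sub>R e2) - B w"
        by (simp_all only: B1 B2 add_diff_cancel_right)
    qed
    have "B (?w + t *\<^sub>R e2) - B ?w = B (w + t *\<^sub>R e2) - B w"
      by (rule periodic_lattice [where f = "\<lambda>w. B (w + t *\<^sub>R e2) - B w", OF D1 D2])
    moreover have nt: "norm (t *\<^sub>R e2) = \<bar>t\<bar>" by simp
    moreover have "norm (?w + t *\<^sub>R e2) \<le> 3" using ab that norm_triangle_ineq [of ?w "t *\<^sub>R e2"] unfolding nt by linarith
    moreover have "?w + t *\<^sub>R e2 - ?w = t *\<^sub>R e2" by simp
    ultimately show ?thesis using L(2) [of "?w + t *\<^sub>R e2" ?w] ab by (simp only: dist_real_def)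
  qed
  define c where "c = (LINT w|lborel. indicator unit_cell w * (1 :: real))"
  have c: "c > 0" unfolding c_def by (rule unit_cell_integral_1)
  \<comment> \<open>The sum of \<open>m\<close> differences of \<open>B\<close> over the distance
    \<open>\<epsilon> / m\<close> stays below \<open>L \<epsilon> \<le> 1/4\<close>.\<close>
  define \<epsilon> where "\<epsilon> = 1 / (4 * (L + 1))"
  have \<epsilon>: "\<epsilon> > 0" "\<epsilon> \<le> 1" "L * \<epsilon> \<le> 1 / 4"
    using L(1) by (auto simp: \<epsilon>_def divide_le_eq)
  have pos: "3 / 8 * (\<bar>\<rho>\<bar> * \<epsilon> * c) > 0" using \<open>\<rho> \<noteq> 0\<close> \<epsilon> c by simp
  obtain \<delta> where \<delta>: "\<delta> > 0" "\<And>t. norm t < \<delta> \<Longrightarrow>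
      (LINT w|lborel. indicator (cball 0 2) w * min 1 (norm (u (w + t) - u w))) < 3 / 8 * (\<bar>\<rho>\<bar> * \<epsilon> * c)"
    by (rule translation_continuous_in_measure [OF u pos, where R = 2]) (rule that, assumption+)
  obtain m0 :: nat where m0: "\<epsilon> / \<delta> < of_nat m0" using reals_Archimedean2 by blast
  define m where "m = Suc m0"
  define t where "t = \<epsilon> / of_nat m"
  have t: "t > 0" "t \<le> 1" "of_nat m * t = \<epsilon>"
    using \<epsilon> by (auto simp: t_def m_def divide_le_eq)
  have "\<epsilon> / \<delta> < of_nat m" using m0 by (simp add: m_def)
  then have "t < \<delta>" using \<delta>(1) by (simp add: t_def m_def field_simps)
  have small: "of_nat m * \<bar>B (w + t *\<^sub>R e2) - B w\<bar> \<le> 1 / 4" for w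
  proof -
    have "of_nat m * \<bar>B (w + t *\<^sub>R e2) - B w\<bar> \<le> of_nat m * (L * \<bar>t\<bar>)"
      using lip [of t w] t by (intro mult_left_mono) auto
    also have "\<dots> = L * (of_nat m * t)" using t(1) by simp
    also have "\<dots> \<le> 1 / 4" using \<epsilon>(3) t(3) by simp
    finally show ?thesis .
  qed
  have "\<bar>\<rho>\<bar> * (of_nat m * \<bar>t\<bar>) * c
      \<le> 8 / 3 * (LINT w|lborel. indicator (cball 0 2) w * min 1 (norm (u (w + t *\<^sub>R e2) - u w)))"
    unfolding c_def
    by (rule winding_bound [OF u norm_u per1 per2 inv \<sigma> ball_Lipschitz_imp_continuous [OF B] B1 B2 small])
  also have "\<dots> < 8 / 3 * (3 / 8 * (\<bar>\<rho>\<bar> * \<epsilon> * c))"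
    using t(1) \<open>t < \<delta>\<close> by (intro mult_strict_left_mono \<delta>(2)) auto
  finally show False using t by simp
qed

text \<open>
  The scalar form of the theorem. By ergodicity \<open>h\<close> vanishes almost everywhere or almost
  nowhere; in the second case its phase is a measurable transfer function for a cocycle with drift
  \<open>p2 - n \<tau> 1\<close>.
\<close>
theorem no_eigenfunction_of_nonzero_degree:
  fixes h :: "real^2 \<Rightarrow> complex" and \<beta> :: "real^2 \<Rightarrow> complex" and n p1 p2 :: int
  assumes h [measurable]: "h \<in> borel_measurable borel"
    and per1: "AE w in lborel. h (w + e1) = h w"
    and per2: "AE w in lborel. h (w + e2) = ee (- of_int n * of_real (w $ 1)) * h w"
    and inv: "AE w in lborel. ee (\<beta> w) * h w = lam * h (w + \<tau>)"
    and \<beta>: "ball_Lipschitz \<beta>" "\<And>w. \<beta> (w + e1) = \<beta> w + of_int p1"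
      "\<And>w. \<beta> (w + e2) = \<beta> w + of_int p2 - of_int n * of_real (\<tau> $ 1)"
    and indep: "\<And>m1 m2 k :: int. of_int m1 * \<tau> $ 1 + of_int m2 * \<tau> $ 2 = of_int k \<Longrightarrow> m1 = 0 \<and> m2 = 0"
    and "n \<noteq> 0"
  shows "AE w in lborel. h w = 0"
proof (cases "lam = 0")
  case True
  then show ?thesis using inv by (auto elim!: eventually_mono)
next
  case False
  define f where "f = (\<lambda>w. if h w = 0 then 0 else 1 :: complex)"
  have f_meas: "f \<in> borel_measurable borel" unfolding f_def by measurable
  have f1: "AE w in lborel. f (w + e1) = f w" using per1 by eventually_elim (simp add: f_def)
  have f2: "AE w in lborel. f (w + e2) = f w" using per2 by eventually_elim (simp add: f_def)
  have f3: "AE w in lborel. f (w + \<tau>) = f w"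
    using inv
  proof eventually_elim
    case (elim w)
    then have "h w = 0 \<longleftrightarrow> h (w + \<tau>) = 0" using False by (metis ee_nonzero mult_eq_0_iff)
    then show ?case by (simp add: f_def)
  qed
  obtain c where c: "AE w in lborel. f w = c"
    by (rule irrational_translation_ergodic [OF f_meas f1 f2 f3]) (rule indep, assumption, rule that, assumption+)
  show ?thesis
  proof (cases "c = 0")
    case True
    from c show ?thesis by eventually_elim (auto simp: f_def True split: if_splits)
  next
    case c0: False
    have nz: "AE w in lborel. h w \<noteq> 0" using c by eventually_elim (use c0 in \<open>auto simp: f_def\<close>)
    define u where "u = (\<lambda>w. if h w = 0 then 1 else sgn (h w))"
    have u_meas: "u \<in> borel_measurable borel" unfolding u_def by measurable
    have norm_u: "norm (u w) = 1" for w by (simp add: u_def norm_sgn)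
    have u1: "AE w in lborel. u (w + e1) = u w" using per1 by eventually_elim (simp add: u_def)
    have u2: "AE w in lborel. u (w + e2) = ee (- of_int n * of_real (w $ 1)) * u w"
      using per2 nz by eventually_elim (simp add: u_def sgn_mult sgn_ee)
    have u3: "AE w in lborel. u (w + \<tau>) = inverse (sgn lam) * ee (of_real (Re (\<beta> w))) * u w"
      using inv nz AE_lborel_translate [OF nz, of \<tau>]
    proof eventually_elim
      case (elim w)
      have "sgn (ee (\<beta> w)) * sgn (h w) = sgn lam * sgn (h (w + \<tau>))"
        using arg_cong [OF elim(1), of sgn] by (simp only: sgn_mult)
      then have "ee (of_real (Re (\<beta> w))) * u w = sgn lam * u (w + \<tau>)" using elim by (simp add: u_def sgn_ee)
      moreover have "sgn lam \<noteq> 0" using False by (simp add: sgn_zero_iff)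
      ultimately show ?case by (simp add: mult.assoc)
    qed
    have \<sigma>: "norm (inverse (sgn lam)) = 1" using False by (simp add: norm_inverse norm_sgn)
    have B: "ball_Lipschitz (\<lambda>w. Re (\<beta> w))" by (rule ball_Lipschitz_bounded_linear [OF bounded_linear_Re \<beta>(1)])
    have "of_int p2 - of_int n * \<tau> $ 1 = 0"
      by (rule measurable_transfer_imp_no_drift [OF u_meas norm_u u1 u2 u3 \<sigma> B, where p = "of_int p1"])
        (simp_all add: \<beta>)
    then have "of_int n * \<tau> $ 1 + of_int 0 * \<tau> $ 2 = of_int p2" by simp
    from indep [OF this] show ?thesis using \<open>n \<noteq> 0\<close> by simp
  qed
qed

text \<open>
  A rational relation would make the distance to the nearest integer vanish.
\<close>
lemma DC_imp_rationally_independent: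
  assumes "\<tau> \<in> DC c \<nu>" and "c > 0" and eq: "of_int m1 * \<tau> $ 1 + of_int m2 * \<tau> $ 2 = (of_int k :: real)"
  shows "m1 = 0 \<and> m2 = 0"
proof (rule ccontr)
  assume nz: "\<not> (m1 = 0 \<and> m2 = 0)"
  then have "dist_to_int (of_int m1 * \<tau> $ 1 + of_int m2 * \<tau> $ 2) \<ge> c * of_int (\<bar>m1\<bar> + \<bar>m2\<bar>) powr (- \<nu>)"
    using assms(1) by (auto simp: DC_def)
  moreover have "dist_to_int (of_int m1 * \<tau> $ 1 + of_int m2 * \<tau> $ 2) = 0" by (simp add: dist_to_int_def eq)
  moreover have "real_of_int (\<bar>m1\<bar> + \<bar>m2\<bar>) > 0" using nz by linarith
  then have "c * real_of_int (\<bar>m1\<bar> + \<bar>m2\<bar>) powr (- \<nu>) > 0" using \<open>c > 0\<close> by simp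
  ultimately show False by linarith
qed

lemma lebesgue_measurable_complex_AE_eq_borel:
  fixes h :: "real^2 \<Rightarrow> complex"
  assumes [measurable]: "h \<in> borel_measurable lebesgue"
  obtains h' where "h' \<in> borel_measurable borel" "AE w in lborel. h w = h' w"
proof -
  have "(\<lambda>w. Re (h w)) \<in> borel_measurable lebesgue" "(\<lambda>w. Im (h w)) \<in> borel_measurable lebesgue" by measurable
  from this [THEN completion_ex_borel_measurable_real] obtain r i
    where ri: "r \<in> borel_measurable lborel" "i \<in> borel_measurable lborel"
      "AE w in lborel. Re (h w) = r w" "AE w in lborel. Im (h w) = i w" by blast
  have [measurable]: "r \<in> borel_measurable borel" "i \<in> borel_measurable borel" using ri by simp_all
  have "(\<lambda>w. of_real (r w) + \<i> * of_real (i w)) \<in> borel_measurable borel" by measurable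
  moreover have "AE w in lborel. h w = of_real (r w) + \<i> * of_real (i w)"
    using ri(3,4) by eventually_elim (simp add: complex_eq_iff)
  ultimately show ?thesis using that by blast
qed

theorem theoremB:
  fixes U1 U2 A :: "real^2 \<Rightarrow> complex^2^2"
    and \<tau> :: "real^2"
    and c \<nu> :: real
    and ls lu l :: "real^2 \<Rightarrow> (complex^2) set"
    and lam :: complex
    and F :: "real^2 \<Rightarrow> complex^2"
  assumes "strip_admissible U1 U2 \<tau> A"
    and "dominated_splitting U1 U2 \<tau> A ls lu"
    and "c > 0" and "\<nu> \<ge> 1" and "\<tau> \<in> DC c \<nu>"
    and "l \<in> {ls, lu}"
    and "chern_number U1 U2 l \<noteq> 0"
    and "measurable_section U1 U2 F"
    and "carried_by l F"
    and "AE w in lebesgue. A w *v F w = lam *s F (w + \<tau>)"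
  shows "AE w in lebesgue. F w = 0"
proof -
  let ?n = "chern_number U1 U2 l"
  obtain s \<beta> and p1 p2 :: int where s: "continuous_on UNIV s" "\<And>w. s w \<in> l w" "\<And>w. s w \<noteq> 0"
    and U1s: "\<And>w. U1 w *v s w = s (w + e1)"
    and U2s: "\<And>w. U2 w *v s w = ee (- of_int ?n * of_real (w $ 1)) *s s (w + e2)"
    and As: "\<And>w. A w *v s w = ee (\<beta> w) *s s (w + \<tau>)"
    and \<beta>: "ball_Lipschitz \<beta>" "\<And>w. \<beta> (w + e1) = \<beta> w + of_int p1"
      "\<And>w. \<beta> (w + e2) = \<beta> w + of_int p2 - of_int ?n * of_real (\<tau> $ 1)"
    by (rule invariant_line_normal_form [OF assms(1,2,6)]) (rule that, assumption+)
  have "invariant_line U1 U2 \<tau> A l" using assms(2,6) by (auto simp: dominated_splitting_def)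
  then have lines: "l w \<in> complex_lines" for w by (rule invariant_line_lines)
  define h0 where "h0 = (\<lambda>w. coord (F w) (s w) / coord (s w) (s w))"
  have F_meas: "F \<in> borel_measurable lebesgue" using assms(8) by (simp add: measurable_section_def)
  have "h0 \<in> borel_measurable lebesgue"
  proof -
    have comp: "(\<lambda>w. F w $ i) \<in> borel_measurable lebesgue" for i
      by (rule borel_measurable_continuous_on [OF _ F_meas]) (intro continuous_intros)
    have "(\<lambda>w. cnj (s w $ i)) \<in> borel_measurable borel" "(\<lambda>w. s w $ i) \<in> borel_measurable borel" for i
      by (intro borel_measurable_continuous_onI continuous_intros s)+
    then have "(\<lambda>w. cnj (s w $ i)) \<in> borel_measurable lebesgue" "(\<lambda>w. s w $ i) \<in> borel_measurable lebesgue" for i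
      by (auto intro: measurable_completion)
    then show ?thesis unfolding h0_def coord_def by (intro borel_measurable_divide borel_measurable_add borel_measurable_times comp)
  qed
  then obtain h where h: "h \<in> borel_measurable borel" "AE w in lborel. h0 w = h w"
    by (rule lebesgue_measurable_complex_AE_eq_borel) (rule that, assumption+)
  have "AE w in lborel. F w \<in> l w" using assms(9) by (simp add: carried_by_def AE_completion_iff)
  with h(2) have Fh: "AE w in lborel. F w = h w *s s w"
  proof eventually_elim
    case (elim w)
    obtain a b where ab: "F w = a *s unit_vec (l w)" "s w = b *s unit_vec (l w)"
      using unit_vec(2) [OF lines] elim(2) s(2) [of w] by blast
    have "b \<noteq> 0" using ab s(3) [of w] by auto
    then have Fs: "F w = (a / b) *s s w" by (simp add: ab)
    have "coord (s w) (s w) = of_real ((norm (s w $ 1))\<^sup>2 + (norm (s w $ 2))\<^sup>2)"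
      by (simp add: coord_def complex_norm_square del: of_real_power)
    moreover have "(norm (s w $ 1))\<^sup>2 + (norm (s w $ 2))\<^sup>2 \<noteq> 0"
      using s(3) [of w] by (auto simp: vec_eq_iff forall_2 sum_power2_eq_zero_iff)
    ultimately have nz: "coord (s w) (s w) \<noteq> 0" by (metis of_real_eq_0_iff)
    have "coord (F w) (s w) = (a / b) * coord (s w) (s w)" unfolding Fs by (simp add: coord_def algebra_simps)
    then have "h0 w = a / b" using nz by (simp add: h0_def)
    then show ?case using Fs elim(1) by simp
  qed
  have sec: "AE w in lborel. F (w + e1) = U1 w *v F w" "AE w in lborel. F (w + e2) = U2 w *v F w"
    "AE w in lborel. A w *v F w = lam *s F (w + \<tau>)"
    using assms(8,10) by (simp_all add: measurable_section_def AE_completion_iff)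
  have h1: "AE w in lborel. h (w + e1) = h w"
    using sec(1) Fh AE_lborel_translate [OF Fh, of e1]
    by eventually_elim (simp add: matrix_mult_scaled U1s scaled_eq_iff s(3))
  have h2: "AE w in lborel. h (w + e2) = ee (- of_int ?n * of_real (w $ 1)) * h w"
    using sec(2) Fh AE_lborel_translate [OF Fh, of e2]
  proof eventually_elim
    case (elim w)
    then have "h (w + e2) *s s (w + e2) = (h w * ee (- of_int ?n * of_real (w $ 1))) *s s (w + e2)"
      by (simp only: matrix_mult_scaled U2s vec.scale_scale)
    then show ?case using s(3) by (simp only: scaled_eq_iff mult.commute) simp
  qed
  have h3: "AE w in lborel. ee (\<beta> w) * h w = lam * h (w + \<tau>)"
    using sec(3) Fh AE_lborel_translate [OF Fh, of \<tau>]
  proof eventually_elim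
    case (elim w)
    then have "(h w * ee (\<beta> w)) *s s (w + \<tau>) = (lam * h (w + \<tau>)) *s s (w + \<tau>)"
      by (simp only: matrix_mult_scaled As vec.scale_scale)
    then show ?case using s(3) by (simp add: scaled_eq_iff mult.commute)
  qed
  have "AE w in lborel. h w = 0"
    by (rule no_eigenfunction_of_nonzero_degree [OF h(1) h1 h2 h3 \<beta> DC_imp_rationally_independent [OF assms(5,3)] assms(7)])
  with Fh have "AE w in lborel. F w = 0" by eventually_elim simp
  then show ?thesis by (simp add: AE_completion_iff)
qed

end
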